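(* Let $n\ge 4$ be a power of two, let $T\in\mathbb{C}^{n\times n}$ be a Toeplitz-like matrix with $ZT-TZ=GH^*$, $G,H\in\mathbb{C}^{n\times\rho}$, and let $C=FTF^*$. Given $\epsilon>0$, the HODLR construction described in the context requires $$\mathcal O\big(\rho\, n\log^2 n\cdot(\log\log n+|\log\epsilon|)\big)$$ operations to produce a HODLR matrix $\widetilde C$ such that $\|C-\widetilde C\|_2\le\epsilon\|C\|_2$, provided that the minimum block size of the HODLR partitioning remains bounded. The HODLR rank of $\widetilde C$ is bounded by $k\rho$ with $$k=\mathcal O\big(\log n\cdot(\log\log n+|\log\epsilon|)\big).$$
   Context: Rows and columns are indexed from $0$. $Z=\begin{pmatrix}0&1\\ I_{n-1}&0\end{pmatrix}$ is the cyclic shift, $\omega=\exp(\mathrm{i}\pi/n)$, $F=(\omega^{2jk}/\sqrt n)_{j,k=0}^{n-1}$ is the unitary discrete Fourier transform with $FZF^*=D=\mathrm{diag}(\omega^0,\omega^2,\ldots,\omega^{2n-2})$. Thus $DC-CD=\widetilde G\widetilde H^*$ with $\widetilde G=FG$, $\widetilde H=FH$. $\|\cdot\|_2$ is the spectral norm. HODLR: the index set $\{0,\ldots,n-1\}$ is recursively halved into consecutive halves according to a perfectly balanced binary tree $\mathcal T$ (vertex $v$ has index set $J_v$; the root has $J_0=\{0,\ldots,n-1\}$), until a minimum block size $n_{\min}\ge2$ is reached. For each non-root vertex $v$ with sibling $\tilde v$, the off-diagonal HODLR block is $C_v=C(J_v,J_{\tilde v})$. A HODLR matrix is a matrix in which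 each such off-diagonal block is a low-rank matrix stored in factorized form and the diagonal blocks for the leaves are stored explicitly; its HODLR rank is the maximum rank of its off-diagonal HODLR blocks. Construction: (1) compute $\widetilde G,\widetilde H$ by FFTs. (2) Recover the diagonal of $C$ as the diagonal of $F\Pi(T)F^*$, where $\Pi(T)$ is the average of $T$ along its cyclic diagonals (the orthogonal projection onto circulant matrices), by an FFT of the first column of $\Pi(T)$; this requires $\mathcal O(n\log n)$ operations. The leaf diagonal blocks of $\widetilde C$ are those of $C$, whose off-diagonal entries are $c_{jk}=(\widetilde G\widetilde H^* )_{jk}/(\omega^{2j}-\omega^{2k})$. (3) For each non-root $v$, with $m=|J_v|$, replace $C_v$ by $\widetilde C_v=X^{(k_v)}$ obtained from $k_v=\lceil 2\pi^{-2}\log(4m)\log(4\epsilon_v^{-1})\rceil$ steps of fADI (no steps, $\widetilde C_v=0$, if this number is $\le 0$), with tolerance $\epsilon_v=\epsilon/\log_2 n$. fADI for $X=C_{JK}$, $J=J_v$, $K=J_{\tilde v}$, which satisfies $D_JX-XD_K=\widetilde G_J\widetilde H_K^*$ (subscripts denoting restriction to the indices in $J$, $K$): with shifts $\{(\tau_j,\nu_j)\}_{j=1}^k$, set $Z_1=(\nu_1-\tau_1)(D_J-\nu_1I)^{-1}\widetilde G_J$, $W_1=(D_K^*-\overline\tau_1I)^{-1}\widetilde H_K$, $Z_{j+1}=\frac{\nu_{j+1}-\tau_{j+1}}{\nu_j-\tau_j}(D_J-\tau_jI)(D_J-\nu_{j+1}I)^{-1}Z_j$, $W_{j+1}=(D_K^*-\overline\nu_jI)(D_K^*-\overline\tau_{j+1}I)^{-1}W_j$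 and $X^{(k)}=[Z_1,\ldots,Z_k][W_1,\ldots,W_k]^*$. The shifts are the zeros $\tau_j$ and poles $\nu_j$ of a rational function $r$ with numerator and denominator of degree at most $k$ that minimizes $\sup_{\mathcal A_J}|r|/\inf_{\mathcal A_K}|r|$, where, with $\theta=\frac{\pi}{n}(2\min K+m-1)$, $\mathcal A_K=\{e^{\mathrm{i}(\theta+t)}:|t|\le\frac{\pi}{n}(m-1)\}$ and $\mathcal A_J=\{e^{\mathrm{i}(\theta+t)}:\frac{\pi}{n}(m+1)\le t\le 2\pi-\frac{\pi}{n}(m+1)\}$. These zeros and poles have closed-form expressions in terms of elliptic functions; the cost of evaluating them is considered negligible (constant cost per shift parameter). *)

theory Defs
  imports
    "HOL-Analysis.Analysis"
    "HOL-Library.Monad_Syntax"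
    "HOL-Computational_Algebra.Polynomial"
    "Jordan_Normal_Form.Matrix"
    "Jordan_Normal_Form.Schur_Decomposition"
    "Jordan_Normal_Form.DL_Rank"
    "Jordan_Normal_Form.DL_Submatrix"
begin

no_notation inner (infix "\<bullet>" 70)
no_notation Finite_Cartesian_Product.vec_nth (infixl "$" 90)

definition cyclic_shift :: "nat \<Rightarrow> complex mat" where
  "cyclic_shift n = mat n n (\<lambda>(i, j). if i = (j + 1) mod n then 1 else 0)"

definition unity_root :: "nat \<Rightarrow> nat \<Rightarrow> complex" where
  "unity_root n j = cis (2 * pi * real j / real n)"

definition dft_mat :: "nat \<Rightarrow> complex mat" where
  "dft_mat n = mat n n (\<lambda>(j, k). unity_root n (j * k) / complex_of_real (sqrt (real n)))"

text \<open>The orthogonal projection onto circulant matrices. The \<open>(j, k)\<close> entry lies on the cyclic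
  diagonal of all positions \<open>(a, b)\<close> with \<open>a - b\<close> congruent to \<open>j - k\<close> modulo \<open>n\<close>.\<close>

definition circulant_proj :: "complex mat \<Rightarrow> complex mat" where
  "circulant_proj T = (let n = dim_row T in
     mat n n (\<lambda>(j, k). (\<Sum>i<n. T $$ ((j + (n - k) + i) mod n, i)) / of_nat n))"

definition euclid_norm :: "complex vec \<Rightarrow> real" where
  "euclid_norm x = sqrt (\<Sum>i<dim_vec x. (cmod (x $ i))\<^sup>2)"

definition spectral_norm :: "complex mat \<Rightarrow> real" where
  "spectral_norm A = (SUP x \<in> {x \<in> carrier_vec (dim_col A). euclid_norm x = 1}. euclid_norm (A *\<^sub>v x))"

text \<open>The two arcs belonging to a block whose column index set \<open>K\<close> is \<open>{t..<t+m}\<close>; the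
  first contains the eigenvalues of \<open>D\<^sub>K\<close>, the second those of \<open>D\<^sub>J\<close>.\<close>

definition arc_center :: "nat \<Rightarrow> nat \<Rightarrow> nat \<Rightarrow> real" where
  "arc_center n t m = pi / real n * (2 * real t + real m - 1)"

definition col_arc :: "nat \<Rightarrow> nat \<Rightarrow> nat \<Rightarrow> complex set" where
  "col_arc n t m = {cis (arc_center n t m + s) | s. \<bar>s\<bar> \<le> pi / real n * (real m - 1)}"

definition row_arc :: "nat \<Rightarrow> nat \<Rightarrow> nat \<Rightarrow> complex set" where
  "row_arc n t m = {cis (arc_center n t m + s) | s.
     pi / real n * (real m + 1) \<le> s \<and> s \<le> 2 * pi - pi / real n * (real m + 1)}"

text \<open>Nonzero rational functions \<open>p / q\<close> in lowest terms, so that poles take the value infinity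
  and no \<open>0 / 0\<close> occurs.\<close>

definition rational_pairs :: "nat \<Rightarrow> (complex poly \<times> complex poly) set" where
  "rational_pairs k =
     {(p, q). p \<noteq> 0 \<and> q \<noteq> 0 \<and> coprime p q \<and> degree p \<le> k \<and> degree q \<le> k}"

definition rational_abs :: "complex poly \<Rightarrow> complex poly \<Rightarrow> complex \<Rightarrow> ennreal" where
  "rational_abs p q z = ennreal (cmod (poly p z)) / ennreal (cmod (poly q z))"

definition zolotarev_ratio ::
    "complex set \<Rightarrow> complex set \<Rightarrow> complex poly \<times> complex poly \<Rightarrow> ennreal" where
  "zolotarev_ratio A B r =
     (SUP z\<in>A. rational_abs (fst r) (snd r) z) / (INF z\<in>B. rational_abs (fst r) (snd r) z)"

definition zolotarev_shifts ::
    "complex set \<Rightarrow> complex set \<Rightarrow> nat \<Rightarrow> (nat \<Rightarrow> complex) \<Rightarrow> (nat \<Rightarrow> complex) \<Rightarrow> bool" where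
  "zolotarev_shifts A B k \<tau> \<nu> \<longleftrightarrow>
     (\<exists>p q. (p, q) \<in> rational_pairs k \<and>
        (\<forall>r \<in> rational_pairs k. zolotarev_ratio A B (p, q) \<le> zolotarev_ratio A B r) \<and>
        p = Polynomial.smult (lead_coeff p) (\<Prod>j<k. [:- \<tau> j, 1:]) \<and>
        q = Polynomial.smult (lead_coeff q) (\<Prod>j<k. [:- \<nu> j, 1:]))"

text \<open>Every scalar operation used by the algorithms below is one of the unit-cost primitives;
  moving and indexing data is free. In particular, all complex numbers that occur in a program
  are built by these primitives or are inputs.\<close>

datatype 'a costed = Costed (result: 'a) (ops: nat)

definition return :: "'a \<Rightarrow> 'a costed" where
  "return x = Costed x 0"

definition charge :: "nat \<Rightarrow> 'a \<Rightarrow> 'a costed" where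
  "charge c x = Costed x c"

definition bind_costed :: "'a costed \<Rightarrow> ('a \<Rightarrow> 'b costed) \<Rightarrow> 'b costed" where
  "bind_costed a f = Costed (result (f (result a))) (ops a + ops (f (result a)))"

adhoc_overloading Monad_Syntax.bind \<rightleftharpoons> bind_costed

definition add_c :: "complex \<Rightarrow> complex \<Rightarrow> complex costed" where "add_c x y = charge 1 (x + y)"
definition sub_c :: "complex \<Rightarrow> complex \<Rightarrow> complex costed" where "sub_c x y = charge 1 (x - y)"
definition mul_c :: "complex \<Rightarrow> complex \<Rightarrow> complex costed" where "mul_c x y = charge 1 (x * y)"
definition div_c :: "complex \<Rightarrow> complex \<Rightarrow> complex costed" where "div_c x y = charge 1 (x / y)"
definition cnj_c :: "complex \<Rightarrow> complex costed" where "cnj_c x = charge 1 (cnj x)"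
definition sqrt_c :: "nat \<Rightarrow> complex costed" where
  "sqrt_c n = charge 1 (complex_of_real (sqrt (real n)))"
definition root_c :: "nat \<Rightarrow> nat \<Rightarrow> complex costed" where "root_c n j = charge 1 (unity_root n j)"

definition collect_vec :: "nat \<Rightarrow> (nat \<Rightarrow> 'a costed) \<Rightarrow> 'a vec costed" where
  "collect_vec n f = Costed (vec n (\<lambda>i. result (f i))) (\<Sum>i<n. ops (f i))"

definition collect_mat :: "nat \<Rightarrow> nat \<Rightarrow> (nat \<Rightarrow> nat \<Rightarrow> 'a costed) \<Rightarrow> 'a mat costed" where
  "collect_mat m n f =
     Costed (mat m n (\<lambda>(i, j). result (f i j))) (\<Sum>i<m. \<Sum>j<n. ops (f i j))"

primrec sum_c :: "nat \<Rightarrow> (nat \<Rightarrow> complex costed) \<Rightarrow> complex costed" where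
  "sum_c 0 f = return 0"
| "sum_c (Suc n) f = do { a \<leftarrow> sum_c n f; b \<leftarrow> f n; add_c a b }"

text \<open>Radix-2 FFT of a vector of length \<open>2 ^ p\<close> with positive exponent and without scaling:
  entry \<open>j\<close> of the result is the sum of \<open>unity_root n (j * k) * x $ k\<close> over \<open>k < n = 2 ^ p\<close>.\<close>

primrec fft :: "nat \<Rightarrow> complex vec \<Rightarrow> complex vec costed" where
  "fft 0 x = return x"
| "fft (Suc p) x = do {
     e \<leftarrow> fft p (vec (2 ^ p) (\<lambda>i. x $ (2 * i)));
     f \<leftarrow> fft p (vec (2 ^ p) (\<lambda>i. x $ (2 * i + 1)));
     g \<leftarrow> collect_vec (2 ^ p) (\<lambda>j. do { w \<leftarrow> root_c (2 ^ Suc p) j; mul_c w (f $ j) });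
     a \<leftarrow> collect_vec (2 ^ p) (\<lambda>j. add_c (e $ j) (g $ j));
     b \<leftarrow> collect_vec (2 ^ p) (\<lambda>j. sub_c (e $ j) (g $ j));
     return (a @\<^sub>v b) }"

text \<open>The product of the unitary DFT matrix with \<open>A\<close>, one FFT per column.\<close>

definition fft_cols :: "nat \<Rightarrow> complex mat \<Rightarrow> complex mat costed" where
  "fft_cols p A = do {
     c \<leftarrow> collect_vec (dim_col A) (\<lambda>r. fft p (col A r));
     s \<leftarrow> sqrt_c (2 ^ p);
     collect_mat (2 ^ p) (dim_col A) (\<lambda>i r. div_c (c $ r $ i) s) }"

text \<open>Here \<open>d\<close> holds the diagonal of \<open>D\<^sub>J\<close> (for the left factors) or of \<open>D\<^sub>K\<close> (for the right
  factors), and \<open>\<tau> $ j\<close>, \<open>\<nu> $ j\<close> are the shifts with 0-based numbering. The results are the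
  lists of the first \<open>k\<close> blocks \<open>Z\<close> and \<open>W\<close>.\<close>

fun fadi_left ::
    "complex vec \<Rightarrow> complex vec \<Rightarrow> complex vec \<Rightarrow> complex mat \<Rightarrow> nat \<Rightarrow> complex mat list costed" where
  "fadi_left d \<tau> \<nu> G 0 = return []"
| "fadi_left d \<tau> \<nu> G (Suc 0) = do {
     a \<leftarrow> sub_c (\<nu> $ 0) (\<tau> $ 0);
     Z \<leftarrow> collect_mat (dim_row G) (dim_col G) (\<lambda>i r. do {
       y \<leftarrow> sub_c (d $ i) (\<nu> $ 0);
       q \<leftarrow> div_c a y;
       mul_c q (G $$ (i, r)) });
     return [Z] }"
| "fadi_left d \<tau> \<nu> G (Suc (Suc j)) = do {
     Zs \<leftarrow> fadi_left d \<tau> \<nu> G (Suc j);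
     a \<leftarrow> sub_c (\<nu> $ Suc j) (\<tau> $ Suc j);
     b \<leftarrow> sub_c (\<nu> $ j) (\<tau> $ j);
     s \<leftarrow> div_c a b;
     Z \<leftarrow> collect_mat (dim_row G) (dim_col G) (\<lambda>i r. do {
       x \<leftarrow> sub_c (d $ i) (\<tau> $ j);
       y \<leftarrow> sub_c (d $ i) (\<nu> $ Suc j);
       q \<leftarrow> div_c x y;
       q' \<leftarrow> mul_c s q;
       mul_c q' (last Zs $$ (i, r)) });
     return (Zs @ [Z]) }"

fun fadi_right ::
    "complex vec \<Rightarrow> complex vec \<Rightarrow> complex vec \<Rightarrow> complex mat \<Rightarrow> nat \<Rightarrow> complex mat list costed" where
  "fadi_right d \<tau> \<nu> H 0 = return []"
| "fadi_right d \<tau> \<nu> H (Suc 0) = do {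
     t \<leftarrow> cnj_c (\<tau> $ 0);
     W \<leftarrow> collect_mat (dim_row H) (dim_col H) (\<lambda>i r. do {
       e \<leftarrow> cnj_c (d $ i);
       y \<leftarrow> sub_c e t;
       div_c (H $$ (i, r)) y });
     return [W] }"
| "fadi_right d \<tau> \<nu> H (Suc (Suc j)) = do {
     Ws \<leftarrow> fadi_right d \<tau> \<nu> H (Suc j);
     u \<leftarrow> cnj_c (\<nu> $ j);
     t \<leftarrow> cnj_c (\<tau> $ Suc j);
     W \<leftarrow> collect_mat (dim_row H) (dim_col H) (\<lambda>i r. do {
       e \<leftarrow> cnj_c (d $ i);
       x \<leftarrow> sub_c e u;
       y \<leftarrow> sub_c e t;
       q \<leftarrow> div_c x y;
       mul_c q (last Ws $$ (i, r)) });
     return (Ws @ [W]) }"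

text \<open>\<open>[A\<^sub>1, \<dots>, A\<^sub>k]\<close> for \<open>m\<close> by \<open>\<rho>\<close> matrices.\<close>

definition hconcat :: "nat \<Rightarrow> nat \<Rightarrow> complex mat list \<Rightarrow> complex mat" where
  "hconcat m \<rho> As = mat m (length As * \<rho>) (\<lambda>(i, c). (As ! (c div \<rho>)) $$ (i, c mod \<rho>))"

text \<open>Truncation by \<open>nat\<close> turns a nonpositive value into zero steps.\<close>

definition num_steps :: "nat \<Rightarrow> real \<Rightarrow> nat \<Rightarrow> nat" where
  "num_steps n \<epsilon> m = (let \<epsilon>\<^sub>v = \<epsilon> / log 2 (real n) in
     nat \<lceil>2 / pi\<^sup>2 * ln (4 * real m) * ln (4 / \<epsilon>\<^sub>v)\<rceil>)"

text \<open>\<open>Node A (Z\<^sub>1, W\<^sub>1) (Z\<^sub>2, W\<^sub>2) B\<close> has the off-diagonal blocks \<open>Z\<^sub>1 W\<^sub>1\<^sup>*\<close> (upper right) and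
  \<open>Z\<^sub>2 W\<^sub>2\<^sup>*\<close> (lower left).\<close>

datatype hodlr =
    Leaf "complex mat"
  | Node hodlr "complex mat \<times> complex mat" "complex mat \<times> complex mat" hodlr

fun factored :: "complex mat \<times> complex mat \<Rightarrow> complex mat" where
  "factored (Z, W) = Z * mat_adjoint W"

primrec hodlr_mat :: "hodlr \<Rightarrow> complex mat" where
  "hodlr_mat (Leaf A) = A"
| "hodlr_mat (Node A X Y B) =
     four_block_mat (hodlr_mat A) (factored X) (factored Y) (hodlr_mat B)"

text \<open>A vertex of the partition tree is a block of \<open>2 ^ q\<close> consecutive indices beginning at \<open>s\<close>.
  It is halved as long as the halves do not become smaller than \<open>nmin\<close>.
  The triples \<open>(s, t, m)\<close> collected here stand for the off-diagonal blocks with row indices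
  \<open>{s..<s+m}\<close> and column indices \<open>{t..<t+m}\<close>.\<close>

primrec offdiag_blocks :: "nat \<Rightarrow> nat \<Rightarrow> nat \<Rightarrow> (nat \<times> nat \<times> nat) set" where
  "offdiag_blocks nmin 0 s = {}"
| "offdiag_blocks nmin (Suc q) s =
     (if 2 ^ q < nmin then {}
      else {(s, s + 2 ^ q, 2 ^ q), (s + 2 ^ q, s, 2 ^ q)} \<union>
           offdiag_blocks nmin q s \<union> offdiag_blocks nmin q (s + 2 ^ q))"

fun fits_factors :: "nat \<Rightarrow> complex mat \<times> complex mat \<Rightarrow> bool" where
  "fits_factors m (Z, W) \<longleftrightarrow> (\<exists>r. Z \<in> carrier_mat m r \<and> W \<in> carrier_mat m r)"

text \<open>The stored data follow the partition tree of \<open>2 ^ q\<close> indices.\<close>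

fun fits_partition :: "nat \<Rightarrow> nat \<Rightarrow> hodlr \<Rightarrow> bool" where
  "fits_partition nmin q (Leaf A) \<longleftrightarrow>
     (q = 0 \<or> 2 ^ (q - 1) < nmin) \<and> A \<in> carrier_mat (2 ^ q) (2 ^ q)"
| "fits_partition nmin q (Node A X Y B) \<longleftrightarrow>
     q \<noteq> 0 \<and> nmin \<le> 2 ^ (q - 1) \<and> fits_partition nmin (q - 1) A \<and> fits_partition nmin (q - 1) B \<and>
     fits_factors (2 ^ (q - 1)) X \<and> fits_factors (2 ^ (q - 1)) Y"

definition hodlr_rank :: "nat \<Rightarrow> nat \<Rightarrow> complex mat \<Rightarrow> nat" where
  "hodlr_rank nmin p M =
     Max (insert 0 ((\<lambda>(s, t, m). vec_space.rank m (submatrix M {s..<s+m} {t..<t+m})) `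
       offdiag_blocks nmin p 0))"

text \<open>Throughout, \<open>d\<close> is the diagonal of \<open>D\<close>, \<open>c\<close> the diagonal of \<open>C\<close>, and \<open>G\<close>, \<open>H\<close> are the
  Fourier transformed generators. The families \<open>\<tau> s t\<close> and \<open>\<nu> s t\<close> give the shifts for the block
  with row indices beginning at \<open>s\<close> and column indices beginning at \<open>t\<close> (for siblings, these two
  numbers determine the block). The evaluation of each shift, and of the number of steps,
  is charged with \<open>\<kappa>\<close> operations.\<close>

definition leaf_block ::
    "complex vec \<Rightarrow> complex vec \<Rightarrow> complex mat \<Rightarrow> complex mat \<Rightarrow> nat \<Rightarrow> nat \<Rightarrow> complex mat costed" where
  "leaf_block d c G H s m = collect_mat m m (\<lambda>i j.
     if i = j then return (c $ (s + i))
     else do {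
       x \<leftarrow> sum_c (dim_col G) (\<lambda>r. do { h \<leftarrow> cnj_c (H $$ (s + j, r)); mul_c (G $$ (s + i, r)) h });
       y \<leftarrow> sub_c (d $ (s + i)) (d $ (s + j));
       div_c x y })"

definition fadi_block ::
    "nat \<Rightarrow> (nat \<Rightarrow> nat \<Rightarrow> nat \<Rightarrow> complex) \<Rightarrow> (nat \<Rightarrow> nat \<Rightarrow> nat \<Rightarrow> complex) \<Rightarrow> nat \<Rightarrow> real \<Rightarrow>
     complex vec \<Rightarrow> complex mat \<Rightarrow> complex mat \<Rightarrow> nat \<Rightarrow> nat \<Rightarrow> nat \<Rightarrow>
     (complex mat \<times> complex mat) costed" where
  "fadi_block \<kappa> \<tau> \<nu> n \<epsilon> d G H s t m = do {
     k \<leftarrow> charge \<kappa> (num_steps n \<epsilon> m);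
     ts \<leftarrow> collect_vec k (\<lambda>j. charge \<kappa> (\<tau> s t j));
     ns \<leftarrow> collect_vec k (\<lambda>j. charge \<kappa> (\<nu> s t j));
     Zs \<leftarrow> fadi_left (vec m (\<lambda>i. d $ (s + i))) ts ns (submatrix G {s..<s+m} UNIV) k;
     Ws \<leftarrow> fadi_right (vec m (\<lambda>i. d $ (t + i))) ts ns (submatrix H {t..<t+m} UNIV) k;
     return (hconcat m (dim_col G) Zs, hconcat m (dim_col H) Ws) }"

primrec hodlr_build ::
    "nat \<Rightarrow> (nat \<Rightarrow> nat \<Rightarrow> nat \<Rightarrow> complex) \<Rightarrow> (nat \<Rightarrow> nat \<Rightarrow> nat \<Rightarrow> complex) \<Rightarrow> nat \<Rightarrow> real \<Rightarrow>
     complex vec \<Rightarrow> complex vec \<Rightarrow> complex mat \<Rightarrow> complex mat \<Rightarrow> nat \<Rightarrow> nat \<Rightarrow> nat \<Rightarrow> hodlr costed" where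
  "hodlr_build \<kappa> \<tau> \<nu> n \<epsilon> d c G H nmin 0 s =
     do { A \<leftarrow> leaf_block d c G H s 1; return (Leaf A) }"
| "hodlr_build \<kappa> \<tau> \<nu> n \<epsilon> d c G H nmin (Suc q) s =
     (if 2 ^ q < nmin then do { A \<leftarrow> leaf_block d c G H s (2 ^ Suc q); return (Leaf A) }
      else do {
        A \<leftarrow> hodlr_build \<kappa> \<tau> \<nu> n \<epsilon> d c G H nmin q s;
        X \<leftarrow> fadi_block \<kappa> \<tau> \<nu> n \<epsilon> d G H s (s + 2 ^ q) (2 ^ q);
        Y \<leftarrow> fadi_block \<kappa> \<tau> \<nu> n \<epsilon> d G H (s + 2 ^ q) s (2 ^ q);
        B \<leftarrow> hodlr_build \<kappa> \<tau> \<nu> n \<epsilon> d c G H nmin q (s + 2 ^ q);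
        return (Node A X Y B) })"

text \<open>The argument \<open>avg\<close> is the computation that delivers the first column of the circulant
  projection of \<open>T\<close>. It is a parameter because its cost depends on how \<open>T\<close> is given:
  \<open>G\<close> and \<open>H\<close> determine \<open>T\<close> only up to a circulant matrix, and reading all entries
  of \<open>T\<close> would already need \<open>n\<^sup>2\<close> operations.\<close>

definition hodlr_construction ::
    "nat \<Rightarrow> (nat \<Rightarrow> nat \<Rightarrow> nat \<Rightarrow> complex) \<Rightarrow> (nat \<Rightarrow> nat \<Rightarrow> nat \<Rightarrow> complex) \<Rightarrow> real \<Rightarrow> nat \<Rightarrow> nat \<Rightarrow>
     complex vec costed \<Rightarrow> complex mat \<Rightarrow> complex mat \<Rightarrow> hodlr costed" where
  "hodlr_construction \<kappa> \<tau> \<nu> \<epsilon> nmin p avg G H = do {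
     Gt \<leftarrow> fft_cols p G;
     Ht \<leftarrow> fft_cols p H;
     a \<leftarrow> avg;
     c \<leftarrow> fft p a;
     d \<leftarrow> collect_vec (2 ^ p) (\<lambda>j. root_c (2 ^ p) j);
     hodlr_build \<kappa> \<tau> \<nu> (2 ^ p) \<epsilon> d c Gt Ht nmin p 0 }"

end

theory Submission
  imports Defs "HOL-Library.Nat_Bijection" "HOL-Real_Asymp.Real_Asymp"
begin

text \<open>The only analytic input is a sharp bound on the Zolotarev numbers of the two arcs. A Moebius map
  turns the arcs into the intervals \<open>[-b', -1/b']\<close> and \<open>[1/b', b']\<close> with \<open>b' + 1/b' \<le> 2 m\<close>.
  The quotient \<open>D\<close> of two theta functions of nome \<open>q\<close> maps the circle onto \<open>[1/b, b]\<close>, and the rational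
  function with zeros \<open>D(w)\<close> and poles \<open>-D(w)\<close>, where \<open>w\<close> runs through half of the \<open>2k\<close>-th roots of \<open>-1\<close>,
  satisfies \<open>\<bar>r\<bar> \<le> 2 q ^ k\<close> on \<open>[1/b, b]\<close>: splitting double series by parity factorises \<open>(D(z) - D(w)) / (D(z) + D(w))\<close>,
  and by the triple product the factors over all \<open>w\<close> merge into the corresponding function of nome \<open>q ^ (2k)\<close>.
  The inequality \<open>2 b \<ge> exp (pi\<^sup>2 / (4 c))\<close> for \<open>q = exp (-c)\<close> needs no modular transformation: Landen's transformation
  gives \<open>b(c) \<le> 2 b(2c)\<^sup>2\<close>, so that the leading order of \<open>ln b(c)\<close> as \<open>c\<close> tends to \<open>0\<close> already yields the sharp constant.
  Hence the optimal shifts reduce each off-diagonal block by the factor \<open>\<epsilon> / log 2 n\<close>, and the errors of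
  the less than \<open>log 2 n\<close> levels of the partition add up to at most \<open>\<epsilon>\<close>.\<close>

section \<open>Theta series and the Jacobi triple product\<close>

text \<open>The step count is fixed by the algorithm, so no constant may be lost on the way to it.
  With \<open>c = pi^2 / (4 ln (4 m))\<close> the bound on \<open>b\<close> reads
  \<open>2 b \<ge> 4 m\<close>, hence \<open>b \<ge> 2 m \<ge> b' + 1/b'\<close>, and
  \<open>[1/b, b]\<close> covers the image of the arc. The rational function is at most
  \<open>2 q^k\<close> on one arc and at least the reciprocal on the other, so its ratio is at most
  \<open>4 q^(2k) = 4 exp (- k pi^2 / (2 ln (4 m)))\<close>; \<open>num_steps\<close> is this
  expression solved for \<open>k\<close>. A bound on \<open>b\<close> that only has the right
  leading order would not justify this \<open>k\<close>. The given shifts enter through minimality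
  alone: their ratio cannot exceed that of the explicit function. The error is relative to the norm
  of \<open>C\<close> because all coefficient matrices are diagonal: after \<open>k\<close> steps
  the residual at \<open>(i, j)\<close> is the entry of \<open>C\<close> times
  \<open>r(x_i) / r(y_j)\<close>, a row factor times a column factor, so the residual is the block
  of \<open>C\<close> scaled by diagonal matrices from both sides.\<close>

definition theta_term :: "real \<Rightarrow> complex \<Rightarrow> int \<Rightarrow> complex" where
  "theta_term q z n = of_real (q powi (n\<^sup>2)) * z powi n"

definition theta :: "real \<Rightarrow> complex \<Rightarrow> complex" where
  "theta q z = (\<Sum>\<^sub>\<infinity>n. theta_term q z n)"

lemma summable_gauss_powers:
  fixes q r :: real
  assumes "0 \<le> q" "q < 1" "0 \<le> r"
  shows "summable (\<lambda>n. q ^ n\<^sup>2 * r ^ n)"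
proof (rule summable_comparison_test_ev)
  have "(\<lambda>n. q ^ n * r) \<longlonglongrightarrow> 0 * r"
    by (intro tendsto_intros LIMSEQ_realpow_zero) (use assms in auto)
  then have "eventually (\<lambda>n. q ^ n * r < 1/2) sequentially"
    by (rule order_tendstoD) simp
  then show "eventually (\<lambda>n. norm (q ^ n\<^sup>2 * r ^ n) \<le> (1/2) ^ n) sequentially"
  proof eventually_elim
    case (elim n)
    have "q ^ n\<^sup>2 * r ^ n = (q ^ n * r) ^ n"
      by (simp add: power_mult_distrib power2_eq_square power_mult)
    also have "\<dots> \<le> (1/2) ^ n"
      using elim assms by (intro power_mono) auto
    finally show ?case using assms by simp
  qed
qed simp

lemma theta_term_abs_summable:
  assumes "0 < q" "q < 1" "z \<noteq> 0"
  shows "(\<lambda>n. norm (theta_term q z n)) summable_on UNIV"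
proof -
  have *: "(\<lambda>n. norm (theta_term q z n)) summable_on range int" if "z \<noteq> 0" for z
  proof (subst summable_on_reindex)
    have "summable (\<lambda>n. q ^ n\<^sup>2 * norm z ^ n)"
      using assms by (intro summable_gauss_powers) auto
    moreover have "norm (theta_term q z (int n)) = q ^ n\<^sup>2 * norm z ^ n" for n
    proof -
      have "q powi ((int n)\<^sup>2) = q ^ n\<^sup>2"
        by (metis of_nat_power power_int_of_nat)
      then show ?thesis using assms by (simp add: theta_term_def norm_mult norm_power)
    qed
    ultimately have "summable (\<lambda>n. norm (norm (theta_term q z (int n))))"
      using assms by simp
    then show "((\<lambda>n. norm (theta_term q z n)) \<circ> int) summable_on UNIV"
      unfolding comp_def by (rule norm_summable_imp_summable_on)
  qed simp
  have "(\<lambda>n. norm (theta_term q z n)) summable_on range (\<lambda>n. - int n)"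
  proof -
    have "(\<lambda>n. norm (theta_term q (1/z) n)) summable_on range int"
      using * assms by simp
    moreover have "theta_term q (1/z) n = theta_term q z (- n)" for n
      by (simp add: theta_term_def power_int_minus power_int_one_over field_simps)
    ultimately have "(\<lambda>n. norm (theta_term q z (- n))) summable_on range int"
      by simp
    then have "(\<lambda>n. norm (theta_term q z n)) summable_on uminus ` range int"
      by (subst summable_on_reindex) (auto simp: comp_def)
    then show ?thesis by (simp add: image_image)
  qed
  then have "(\<lambda>n. norm (theta_term q z n)) summable_on (range (\<lambda>n. - int n) \<union> (range int - range (\<lambda>n. - int n)))"
    using summable_on_subset_banach[OF *[OF assms(3)], of "range int - range (\<lambda>n. - int n)"]
    by (intro summable_on_Un_disjoint) auto
  moreover have "(range (\<lambda>n. - int n) \<union> (range int - range (\<lambda>n. - int n))) = UNIV"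
  proof -
    have "n \<in> range (\<lambda>n. - int n) \<union> range int" for n :: int
      by (cases n rule: int_cases2) auto
    then show ?thesis by blast
  qed
  ultimately show ?thesis by (simp only:)
qed

lemma theta_has_sum:
  assumes "0 < q" "q < 1" "z \<noteq> 0"
  shows "(theta_term q z has_sum theta q z) UNIV"
  unfolding theta_def
  by (rule has_sum_infsum[OF abs_summable_summable[OF theta_term_abs_summable[OF assms]]])

section \<open>Euler products and the finite form of the triple product\<close>

definition euler_prod :: "real \<Rightarrow> nat \<Rightarrow> real" where
  "euler_prod q n = (\<Prod>i<n. 1 - q ^ (i + 1))"

text \<open>The value 0 at negative arguments makes the recursion in \<open>m\<close> hold for all
  integers and gives the coefficients built from it finite support.\<close>

definition euler_recip :: "real \<Rightarrow> int \<Rightarrow> real" where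
  "euler_recip q m = (if m < 0 then 0 else 1 / euler_prod q (nat m))"

text \<open>Summability gives absolute convergence of the product, which excludes the limit 0; since
  the partial products decrease, the limit is also a uniform lower bound.\<close>

lemma prod_one_minus_LIMSEQ:
  fixes a :: "nat \<Rightarrow> real"
  assumes "summable a" "\<And>i. 0 \<le> a i" "\<And>i. a i < 1"
  obtains L where "0 < L" "(\<lambda>n. \<Prod>i<n. 1 - a i) \<longlonglongrightarrow> L" "\<And>n. L \<le> (\<Prod>i<n. 1 - a i)"
proof -
  have "abs_convergent_prod (\<lambda>i. 1 - a i)"
    by (rule summable_imp_abs_convergent_prod) (use assms in auto)
  then have cp: "convergent_prod (\<lambda>i. 1 - a i)"
    by (rule abs_convergent_prod_imp_convergent_prod)
  define L where "L = prodinf (\<lambda>i. 1 - a i)"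
  have "(\<lambda>n. \<Prod>i\<le>n. 1 - a i) \<longlonglongrightarrow> L"
    unfolding L_def by (rule convergent_prod_LIMSEQ[OF cp])
  then have lim: "(\<lambda>n. \<Prod>i<n. 1 - a i) \<longlonglongrightarrow> L"
    by (subst (asm) lessThan_Suc_atMost[symmetric]) (rule LIMSEQ_imp_Suc)
  have dec: "decseq (\<lambda>n. \<Prod>i<n. 1 - a i)"
    using assms by (intro decseq_SucI) (auto simp: less_imp_le intro!: mult_left_le prod_nonneg)
  have le: "L \<le> (\<Prod>i<n. 1 - a i)" for n
    using decseq_ge[OF dec lim] .
  have "L \<noteq> 0" unfolding L_def
    by (rule prodinf_nonzero[OF cp]) (use assms in \<open>auto simp: less_le\<close>)
  moreover have "L \<ge> 0"
    using lim by (rule LIMSEQ_le_const) (use assms in \<open>auto intro!: prod_nonneg simp: less_imp_le\<close>)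
  ultimately have "0 < L" by simp
  with lim le show ?thesis by (intro that) auto
qed

lemma euler_prod_LIMSEQ:
  assumes "0 < q" "q < 1"
  obtains L where "0 < L" "euler_prod q \<longlonglongrightarrow> L" "\<And>n. L \<le> euler_prod q n"
proof -
  have "summable (\<lambda>i. q ^ (i + 1))" using assms by (simp add: summable_geometric)
  moreover have "q ^ (i + 1) < 1" for i using assms power_Suc_less_one[of q i] by simp
  ultimately show ?thesis
    using assms by (elim prod_one_minus_LIMSEQ) (auto simp: euler_prod_def[abs_def] intro: that)
qed

lemma euler_prod_pos: "0 < q \<Longrightarrow> q < 1 \<Longrightarrow> 0 < euler_prod q n"
  unfolding euler_prod_def by (intro prod_pos) (use power_Suc_less_one[of q] in simp)

lemma euler_prod_le_one: "0 < q \<Longrightarrow> q < 1 \<Longrightarrow> euler_prod q n \<le> 1"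
  unfolding euler_prod_def by (intro prod_le_1) (use power_Suc_less_one[of q] in \<open>simp add: less_imp_le\<close>)

lemma euler_recip_shift:
  assumes "0 < q" "q < 1"
  shows "euler_recip q (m - 1) = (1 - q powi m) * euler_recip q m"
proof (cases "m \<le> 0")
  case True then show ?thesis by (cases "m = 0") (auto simp: euler_recip_def)
next
  case False
  then obtain k where m: "m = int (Suc k)" by (metis not_le zero_less_imp_eq_int gr0_conv_Suc of_nat_0_less_iff)
  have "q powi m = q ^ Suc k" by (simp only: m power_int_of_nat)
  moreover have "1 - q ^ Suc k \<noteq> 0" using assms power_Suc_less_one[of q k] by simp
  moreover have "nat m = Suc k" "nat (m - 1) = k" using m by auto
  ultimately show ?thesis
    using False by (simp add: euler_recip_def euler_prod_def)
qed

text \<open>The Gaussian binomial coefficient of \<open>2 N\<close> over \<open>N + j\<close> in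
  base \<open>q\<close>; it vanishes for \<open>\<bar>j\<bar> > N\<close>.\<close>

definition jtp_coeff :: "real \<Rightarrow> nat \<Rightarrow> int \<Rightarrow> real" where
  "jtp_coeff q N j = euler_prod q (2 * N) * euler_recip q (int N + j) * euler_recip q (int N - j)"

text \<open>Pascal-type rule for two steps at once: it expresses what happens to the coefficients
  when the factor with index \<open>N\<close> is multiplied onto the finite triple product, which
  uses base \<open>q^2\<close>.\<close>

lemma jtp_coeff_Suc:
  assumes "0 < q" "q < 1"
  shows "jtp_coeff q (Suc N) j = (1 + q ^ (2 * N + 1)) * jtp_coeff q N j
    + q powi (int N + 1 - j) * jtp_coeff q N (j - 1) + q powi (int N + 1 + j) * jtp_coeff q N (j + 1)"
proof -
  define A where "A = euler_recip q (int N + 1 + j)"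
  define B where "B = euler_recip q (int N + 1 - j)"
  define X where "X = q powi (int N + 1 + j)"
  define Y where "Y = q powi (int N + 1 - j)"
  have sh: "q powi (m - 1) = q powi m / q" for m using assms by (simp add: power_int_diff)
  have A1: "euler_recip q (int N + j) = (1 - X) * A"
    using euler_recip_shift[OF assms, of "int N + 1 + j"] by (simp add: A_def X_def algebra_simps)
  have B1: "euler_recip q (int N - j) = (1 - Y) * B"
    using euler_recip_shift[OF assms, of "int N + 1 - j"] by (simp add: B_def Y_def algebra_simps)
  have A2: "euler_recip q (int N + (j - 1)) = (1 - X / q) * ((1 - X) * A)"
  proof -
    have "q powi (int N + j) = X / q"
      using sh[of "int N + 1 + j"] by (simp add: X_def)
    then show ?thesis using euler_recip_shift[OF assms, of "int N + j"] by (simp add: A1 add_diff_eq)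
  qed
  have B2: "euler_recip q (int N - (j + 1)) = (1 - Y / q) * ((1 - Y) * B)"
  proof -
    have "q powi (int N - j) = Y / q"
      using sh[of "int N + 1 - j"] by (simp add: Y_def)
    then show ?thesis using euler_recip_shift[OF assms, of "int N - j"] by (simp add: B1 diff_diff_eq)
  qed
  have XY: "X * Y = q ^ (2 * N + 2)"
  proof -
    have "X * Y = q powi (int (2 * N + 2))"
      using assms by (simp add: X_def Y_def add.commute flip: power_int_add)
    then show ?thesis by (simp only: power_int_of_nat)
  qed
  have P: "q ^ (2 * N + 1) = X * Y / q" using assms by (simp add: XY)
  have E: "euler_prod q (2 * Suc N) = euler_prod q (2 * N) * (1 - X * Y / q) * (1 - X * Y)"
    using P XY by (simp add: euler_prod_def)
  \<comment> \<open>With \<open>X\<close> and \<open>Y\<close> for the two powers of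
    \<open>q\<close>, every coefficient is a multiple of \<open>A * B\<close>, and the recursion
    collapses to this identity in \<open>X\<close>, \<open>Y\<close> and \<open>q\<close>.\<close>
  have f1: "(1 - X * Y / q) * (1 - X * Y) = (1 + X * Y / q) * (1 - X) * (1 - Y)
     + Y * (1 - X / q) * (1 - X) + X * (1 - Y / q) * (1 - Y)"
    using assms by (simp add: field_simps)
  have f2: "E * u * A * B = (1 + p) * (E * (x * A) * (y * B)) + Y * (E * (x' * (x * A)) * B) + X * (E * A * (y' * (y * B)))"
    if "u = (1 + p) * x * y + Y * x' * x + X * y' * y" for E u p x y x' y' :: real
    unfolding that by (simp add: algebra_simps)
  have id: "euler_prod q (2 * N) * ((1 - X * Y / q) * (1 - X * Y)) * A * B =
    (1 + X * Y / q) * (euler_prod q (2 * N) * ((1 - X) * A) * ((1 - Y) * B)) +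
    Y * (euler_prod q (2 * N) * ((1 - X / q) * ((1 - X) * A)) * B) + X * (euler_prod q (2 * N) * A * ((1 - Y / q) * ((1 - Y) * B)))"
    by (rule f2[OF f1])
  have s: "int (Suc N) + j = int N + 1 + j" "int (Suc N) - j = int N + 1 - j"
    "int N + (j + 1) = int N + 1 + j" "int N - (j - 1) = int N + 1 - j" by auto
  show ?thesis
    unfolding jtp_coeff_def E P s A1 B1 A2 B2 A_def[symmetric] B_def[symmetric] X_def[symmetric] Y_def[symmetric]
      id[unfolded mult.assoc[symmetric]] mult.assoc[symmetric] ..
qed

definition jtp_prod :: "real \<Rightarrow> nat \<Rightarrow> complex \<Rightarrow> complex" where
  "jtp_prod q N z = (\<Prod>n<N. (1 + of_real (q ^ (2 * n + 1)) * z) * (1 + of_real (q ^ (2 * n + 1)) / z))"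

lemma theta_term_shift:
  assumes "q > 0" "z \<noteq> 0"
  shows "theta_term q z (n - 1) = of_real (q powi (1 - 2 * n)) / z * theta_term q z n"
    and "theta_term q z (n + 1) = of_real (q powi (1 + 2 * n)) * z * theta_term q z n"
proof -
  have "(n - 1)\<^sup>2 = (1 - 2 * n) + n\<^sup>2" "(n + 1)\<^sup>2 = (1 + 2 * n) + n\<^sup>2"
    by (simp_all add: power2_eq_square algebra_simps)
  then have "q powi ((n - 1)\<^sup>2) = q powi (1 - 2 * n) * q powi (n\<^sup>2)"
       "q powi ((n + 1)\<^sup>2) = q powi (1 + 2 * n) * q powi (n\<^sup>2)"
    using assms by (metis power_int_add less_irrefl)+
  then show "theta_term q z (n - 1) = of_real (q powi (1 - 2 * n)) / z * theta_term q z n"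
    and "theta_term q z (n + 1) = of_real (q powi (1 + 2 * n)) * z * theta_term q z n"
    using assms by (simp_all add: theta_term_def power_int_diff power_int_add)
qed

text \<open>As a sum over all integers with finite support, the product with one more factor is a
  combination of the sum and its two index shifts, without any bookkeeping of ranges.\<close>

lemma jtp_finite:
  assumes "0 < q" "q < 1" "z \<noteq> 0"
  shows "((\<lambda>j. of_real (jtp_coeff (q\<^sup>2) N j) * theta_term q z j) has_sum jtp_prod q N z) UNIV"
proof (induction N)
  case 0
  have "((\<lambda>j. of_real (jtp_coeff (q\<^sup>2) 0 j) * theta_term q z j) has_sum (\<Sum>j\<in>{0}. of_real (jtp_coeff (q\<^sup>2) 0 j) * theta_term q z j)) {0}"
    by (rule has_sum_finite) simp
  then have "((\<lambda>j. of_real (jtp_coeff (q\<^sup>2) 0 j) * theta_term q z j) has_sum jtp_prod q 0 z) {0}"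
    by (simp add: jtp_coeff_def euler_recip_def theta_term_def jtp_prod_def euler_prod_def)
  then show ?case
    by (rule has_sum_cong_neutral[THEN iffD1, rotated -1]) (auto simp: jtp_coeff_def euler_recip_def)
next
  case (Suc N)
  define a where "a = (\<lambda>j. of_real (jtp_coeff (q\<^sup>2) N j) * theta_term q z j)"
  define c :: complex where "c = of_real (q ^ (2 * N + 1))"
  have q2: "0 < q\<^sup>2" "q\<^sup>2 < 1" using assms by (auto simp: power_less_one_iff)
  have h0: "(a has_sum jtp_prod q N z) UNIV" using Suc by (simp add: a_def)
  have h1: "((\<lambda>j. a (j - 1)) has_sum jtp_prod q N z) UNIV"
    using h0 by (subst has_sum_reindex_bij_witness[of UNIV "\<lambda>j. j + 1" "\<lambda>j. j - 1" UNIV a]) auto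
  have h2: "((\<lambda>j. a (j + 1)) has_sum jtp_prod q N z) UNIV"
    using h0 by (subst has_sum_reindex_bij_witness[of UNIV "\<lambda>j. j - 1" "\<lambda>j. j + 1" UNIV a]) auto
  have "((\<lambda>j. (1 + c * c) * a j + c * z * a (j - 1) + c / z * a (j + 1)) has_sum
     ((1 + c * c) * jtp_prod q N z + c * z * jtp_prod q N z + c / z * jtp_prod q N z)) UNIV"
    by (intro has_sum_add has_sum_cmult_right h0 h1 h2)
  moreover have "(1 + c * c) * jtp_prod q N z + c * z * jtp_prod q N z + c / z * jtp_prod q N z = jtp_prod q (Suc N) z"
    using assms by (simp add: jtp_prod_def c_def field_simps)
  moreover have "(1 + c * c) * a j + c * z * a (j - 1) + c / z * a (j + 1) =
      of_real (jtp_coeff (q\<^sup>2) (Suc N) j) * theta_term q z j" for j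
  proof -
    have sq: "(q\<^sup>2) powi k = q powi (2 * k)" for k
      by (simp add: power_int_mult)
    have ad: "q ^ (2 * N + 1) * q powi k = q powi (2 * int N + 1 + k)" for k
    proof -
      have "q ^ (2 * N + 1) = q powi (2 * int N + 1)"
        using power_int_of_nat[of q "2 * N + 1"] by (simp add: add.commute)
      then show ?thesis using assms by (simp add: power_int_add)
    qed
    \<comment> \<open>The powers from the coefficient recursion in base \<open>q^2\<close> split
      into \<open>c\<close> and exactly the power that a shift of the Gaussian term produces, so
      both sides agree term by term.\<close>
    have e1: "(q\<^sup>2) powi (int N + 1 - j) = q ^ (2 * N + 1) * q powi (1 - 2 * j)"
      unfolding sq ad by (rule arg_cong[where f = "\<lambda>k. q powi k"]) simp
    have e2: "(q\<^sup>2) powi (int N + 1 + j) = q ^ (2 * N + 1) * q powi (1 + 2 * j)"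
      unfolding sq ad by (rule arg_cong[where f = "\<lambda>k. q powi k"]) simp
    have e3: "(q\<^sup>2) ^ (2 * N + 1) = q ^ (2 * N + 1) * q ^ (2 * N + 1)"
      by (simp only: power2_eq_square power_mult_distrib)
    show ?thesis
      unfolding jtp_coeff_Suc[OF q2] a_def e1 e2 e3 theta_term_shift[OF assms(1,3)]
      using assms(3) by (simp add: c_def algebra_simps)
  qed
  ultimately show ?case by simp
qed

text \<open>Limit of the finite form by dominated convergence. \<open>K\<close> is the reciprocal of
  the product of all \<open>1 - q^(2i)\<close>; it cancels in every quotient of theta functions, so
  only its sign is recorded.\<close>

lemma jacobi_triple_product:
  assumes "0 < q" "q < 1"
  obtains K where "0 < K" "\<And>z. z \<noteq> 0 \<Longrightarrow> (\<lambda>N. jtp_prod q N z) \<longlonglongrightarrow> of_real K * theta q z"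
proof -
  have q2: "0 < q\<^sup>2" "q\<^sup>2 < 1" using assms by (auto simp: power_less_one_iff)
  obtain L where L: "0 < L" "euler_prod (q\<^sup>2) \<longlonglongrightarrow> L" "\<And>n. L \<le> euler_prod (q\<^sup>2) n"
    using euler_prod_LIMSEQ[OF q2] by blast
  have lim: "(\<lambda>N. jtp_coeff (q\<^sup>2) N j) \<longlonglongrightarrow> 1 / L" for j
  proof -
    have fl: "filterlim (\<lambda>N. nat (int N + j)) sequentially sequentially" for j
      unfolding filterlim_at_top
    proof
      fix Z show "\<forall>\<^sub>F N in sequentially. Z \<le> nat (int N + j)"
        by (rule eventually_sequentiallyI[of "nat (int Z - j)"]) linarith
    qed
    have r: "(\<lambda>N. euler_recip (q\<^sup>2) (int N + j)) \<longlonglongrightarrow> 1 / L" for j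
    proof (rule Lim_transform_eventually)
      show "(\<lambda>N. 1 / euler_prod (q\<^sup>2) (nat (int N + j))) \<longlonglongrightarrow> 1 / L"
        by (intro tendsto_intros filterlim_compose[OF L(2) fl]) (use L in auto)
      show "\<forall>\<^sub>F N in sequentially. 1 / euler_prod (q\<^sup>2) (nat (int N + j)) = euler_recip (q\<^sup>2) (int N + j)"
        by (rule eventually_sequentiallyI[of "nat (- j)"]) (auto simp: euler_recip_def)
    qed
    have "(\<lambda>N. euler_prod (q\<^sup>2) (2 * N)) \<longlonglongrightarrow> L"
      by (rule filterlim_compose[OF L(2)]) (simp add: mult_nat_left_at_top)
    then have "(\<lambda>N. jtp_coeff (q\<^sup>2) N j) \<longlonglongrightarrow> L * (1 / L) * (1 / L)"
      unfolding jtp_coeff_def using r[of j] r[of "- j"] by (intro tendsto_mult) auto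
    then show ?thesis using L by simp
  qed
  have ri: "0 \<le> euler_recip (q\<^sup>2) m" "euler_recip (q\<^sup>2) m \<le> 1 / L" for m
    using L euler_prod_pos[OF q2] by (auto simp: euler_recip_def less_imp_le intro!: divide_left_mono)
  \<comment> \<open>This uniform bound supplies the summable majorant for the exchange of limit and
    series.\<close>
  have bound: "\<bar>jtp_coeff (q\<^sup>2) N j\<bar> \<le> 1 * (1 / L) * (1 / L)" for N j
  proof -
    have "0 \<le> jtp_coeff (q\<^sup>2) N j"
      unfolding jtp_coeff_def using ri(1)[of "int N + j"] ri(1)[of "int N - j"] euler_prod_pos[OF q2, of "2 * N"] by simp
    moreover have "jtp_coeff (q\<^sup>2) N j \<le> 1 * (1 / L) * (1 / L)"
      unfolding jtp_coeff_def
      by (intro mult_mono ri euler_prod_le_one[OF q2] mult_nonneg_nonneg) (use L(1) in auto)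
    ultimately show ?thesis by simp
  qed
  have "(\<lambda>N. jtp_prod q N z) \<longlonglongrightarrow> of_real (1 / L) * theta q z" if z: "z \<noteq> 0" for z
  proof -
    \<comment> \<open>Tannery's theorem speaks of series over the naturals, so the integers are
      enumerated.\<close>
    have bij: "bij_betw int_decode UNIV UNIV" by (rule bij_int_decode)
    define a where "a = (\<lambda>k N. of_real (jtp_coeff (q\<^sup>2) N (int_decode k)) * theta_term q z (int_decode k))"
    define b where "b = (\<lambda>k. of_real (1 / L) * theta_term q z (int_decode k))"
    define M where "M = (\<lambda>k. 1 * (1 / L) * (1 / L) * norm (theta_term q z (int_decode k)))"
    have "(\<lambda>k. norm (theta_term q z (int_decode k))) summable_on UNIV"
      by (rule iffD2[OF summable_on_reindex_bij_betw[OF bij] theta_term_abs_summable[OF assms z]])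
    then have "summable (\<lambda>k. norm (theta_term q z (int_decode k)))"
      using summable_on_imp_summable by blast
    then have "summable M" unfolding M_def by (rule summable_mult)
    have "(\<lambda>N. suminf (\<lambda>k. a k N)) \<longlonglongrightarrow> suminf b"
    proof (rule conjunct2[OF conjunct2[OF tannerys_theorem]])
      show "(\<lambda>N. a k N) \<longlonglongrightarrow> b k" for k
        unfolding a_def b_def by (intro tendsto_intros lim)
      show "\<forall>\<^sub>F (k, N) in sequentially \<times>\<^sub>F sequentially. norm (a k N) \<le> M k"
      proof -
        have "norm (a k N) \<le> M k" for k N
          unfolding a_def M_def norm_mult norm_of_real by (intro mult_right_mono bound) simp
        then show ?thesis by (simp add: case_prod_unfold)
      qed
    qed (use \<open>summable M\<close> in auto)
    moreover have "suminf (\<lambda>k. a k N) = jtp_prod q N z" for N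
    proof -
      have "((\<lambda>k. a k N) has_sum jtp_prod q N z) UNIV"
        unfolding a_def
        by (rule iffD2[OF has_sum_reindex_bij_betw[OF bij, of "\<lambda>j. of_real (jtp_coeff (q\<^sup>2) N j) * theta_term q z j"] jtp_finite[OF assms z]])
      then show ?thesis by (rule sums_unique[OF has_sum_imp_sums, symmetric])
    qed
    moreover have "suminf b = of_real (1 / L) * theta q z"
    proof -
      have "((\<lambda>k. theta_term q z (int_decode k)) has_sum theta q z) UNIV"
        by (rule iffD2[OF has_sum_reindex_bij_betw[OF bij] theta_has_sum[OF assms z]])
      then have "(b has_sum (of_real (1 / L) * theta q z)) UNIV"
        unfolding b_def by (rule has_sum_cmult_right)
      then show ?thesis by (rule sums_unique[OF has_sum_imp_sums, symmetric])
    qed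
    ultimately show ?thesis by simp
  qed
  then show ?thesis using L by (intro that[of "1 / L"]) auto
qed

section \<open>Addition formulas for theta functions\<close>

lemma theta_term_uminus: "theta_term q (- z) n = (- 1) powi n * theta_term q z n"
proof -
  have "(- z) powi n = (- 1) powi n * z powi n"
    using power_int_mult_distrib[of "- 1" z n] by simp
  then show ?thesis by (simp add: theta_term_def)
qed

lemma minus_one_powi_mult:
  "(- 1 :: complex) powi n * (- 1) powi m = (if even (n + m) then 1 else - 1)"
  by (auto simp: power_int_minus_left)

lemma theta_mult_has_sum:
  assumes "0 < q" "q < 1" "z \<noteq> 0" "w \<noteq> 0"
  shows "((\<lambda>(n, m). theta_term q z n * theta_term q w m) has_sum theta q z * theta q w) UNIV"
proof -
  let ?f = "\<lambda>(n, m). theta_term q z n * theta_term q w m"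
  have "(\<lambda>x. norm (?f x)) summable_on UNIV \<times> UNIV"
  proof (rule Infinite_Sum.abs_summable_on_Sigma_iff[THEN iffD2], intro conjI ballI)
    fix n
    show "(\<lambda>m. norm (?f (n, m))) summable_on UNIV"
      using summable_on_cmult_right[OF theta_term_abs_summable[OF assms(1,2,4)]] by (simp add: norm_mult)
    have "(\<Sum>\<^sub>\<infinity>m. norm (?f (n, m))) = norm (theta_term q z n) * (\<Sum>\<^sub>\<infinity>m. norm (theta_term q w m))" for n
      by (simp add: norm_mult infsum_cmult_right')
    then show "(\<lambda>n. norm (\<Sum>\<^sub>\<infinity>m. norm (?f (n, m)))) summable_on UNIV"
      using summable_on_cmult_left[OF theta_term_abs_summable[OF assms(1-3)]]
      by (simp add: norm_mult infsum_nonneg)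
  qed
  then have "?f summable_on UNIV \<times> UNIV" by (rule abs_summable_summable)
  moreover have "((\<lambda>m. ?f (n, m)) has_sum theta_term q z n * theta q w) UNIV" for n
    using has_sum_cmult_right[OF theta_has_sum[OF assms(1,2,4)]] by simp
  moreover have "((\<lambda>n. theta_term q z n * theta q w) has_sum theta q z * theta q w) UNIV"
    by (rule has_sum_cmult_left[OF theta_has_sum[OF assms(1-3)]])
  ultimately have "(?f has_sum theta q z * theta q w) (UNIV \<times> UNIV)"
    by (intro has_sum_SigmaI)
  then show ?thesis by simp
qed

text \<open>From \<open>(a+b)^2 + (a-b)^2 = 2 a^2 + 2 b^2\<close>. In the odd case the exponent
  \<open>(a+b+1)^2 + (a-b)^2\<close> has the additional terms \<open>2a + 2b + 1\<close>: the 1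
  gives the factor \<open>q\<close>, the others move both arguments by \<open>q^2\<close>.\<close>

lemma theta_term_rotate:
  assumes "0 < q" "z \<noteq> 0" "w \<noteq> 0"
  shows "theta_term q z (a + b) * theta_term q w (a - b)
    = theta_term (q\<^sup>2) (z * w) a * theta_term (q\<^sup>2) (z / w) b"
    and "theta_term q z (a + b + 1) * theta_term q w (a - b)
    = of_real q * z * theta_term (q\<^sup>2) (of_real (q\<^sup>2) * (z * w)) a * theta_term (q\<^sup>2) (of_real (q\<^sup>2) * (z / w)) b"
proof -
  have sq: "(q\<^sup>2) powi k = q powi (2 * k)" for k
    by (simp add: power_int_mult)
  have sqc: "(of_real (q\<^sup>2) :: complex) powi k = of_real (q powi (2 * k))" for k
    by (simp only: sq[symmetric] of_real_power_int)
  have "q powi ((a + b)\<^sup>2) * q powi ((a - b)\<^sup>2) = q powi (2 * a\<^sup>2) * q powi (2 * b\<^sup>2)"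
    unfolding power_int_add[OF disjI1[OF less_imp_neq[OF assms(1), symmetric]], symmetric]
    by (rule arg_cong[where f = "\<lambda>k. q powi k"]) (simp add: power2_eq_square algebra_simps)
  moreover have "z powi (a + b) * w powi (a - b) = (z * w) powi a * (z / w) powi b"
    using assms by (simp add: power_int_add power_int_diff power_int_mult_distrib power_int_divide_distrib)
  ultimately have "of_real (q powi ((a + b)\<^sup>2) * q powi ((a - b)\<^sup>2)) * (z powi (a + b) * w powi (a - b)) =
    of_real (q powi (2 * a\<^sup>2) * q powi (2 * b\<^sup>2)) * ((z * w) powi a * (z / w) powi b)"
    by (simp only:)
  then show "theta_term q z (a + b) * theta_term q w (a - b)
    = theta_term (q\<^sup>2) (z * w) a * theta_term (q\<^sup>2) (z / w) b"
    unfolding theta_term_def sq of_real_mult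
    by (simp only: mult_ac)
  have "q powi ((a + b + 1)\<^sup>2) * q powi ((a - b)\<^sup>2)
     = q powi 1 * (q powi (2 * a\<^sup>2) * q powi (2 * a)) * (q powi (2 * b\<^sup>2) * q powi (2 * b))"
    unfolding power_int_add[OF disjI1[OF less_imp_neq[OF assms(1), symmetric]], symmetric]
    by (rule arg_cong[where f = "\<lambda>k. q powi k"]) (simp add: power2_eq_square algebra_simps)
  moreover have "z powi (a + b + 1) * w powi (a - b) = z * ((z * w) powi a * (z / w) powi b)"
    using assms by (simp add: power_int_add power_int_diff power_int_mult_distrib power_int_divide_distrib)
  ultimately have "of_real (q powi ((a + b + 1)\<^sup>2) * q powi ((a - b)\<^sup>2)) * (z powi (a + b + 1) * w powi (a - b)) =
    of_real (q powi 1 * (q powi (2 * a\<^sup>2) * q powi (2 * a)) * (q powi (2 * b\<^sup>2) * q powi (2 * b))) * (z * ((z * w) powi a * (z / w) powi b))"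
    by (simp only:)
  then show "theta_term q z (a + b + 1) * theta_term q w (a - b)
    = of_real q * z * theta_term (q\<^sup>2) (of_real (q\<^sup>2) * (z * w)) a * theta_term (q\<^sup>2) (of_real (q\<^sup>2) * (z / w)) b"
    unfolding theta_term_def sq power_int_mult_distrib[of "of_real (q\<^sup>2)"] sqc of_real_mult power_int_1_right
    by (simp only: mult_ac)
qed

text \<open>Splitting the double series of a product of two theta functions by the parity of
  \<open>n + m\<close> and rotating the index lattice by 45 degrees.\<close>

lemma theta_mult_add:
  assumes "0 < q" "q < 1" "z \<noteq> 0" "w \<noteq> 0"
  shows "theta q z * theta q w + theta q (- z) * theta q (- w) = 2 * theta (q\<^sup>2) (z * w) * theta (q\<^sup>2) (z / w)"
    (is "?L = _")
proof -
  have q2: "0 < q\<^sup>2" "q\<^sup>2 < 1" using assms by (auto simp: power_less_one_iff)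
  let ?f = "\<lambda>(n, m). theta_term q z n * theta_term q w m"
  let ?E = "{(n, m). even (n + m :: int)}"
  have "((\<lambda>x. ?f x + (case x of (n, m) \<Rightarrow> theta_term q (- z) n * theta_term q (- w) m)) has_sum ?L) UNIV"
    by (intro has_sum_add theta_mult_has_sum) (use assms in auto)
  also have "(\<lambda>x. ?f x + (case x of (n, m) \<Rightarrow> theta_term q (- z) n * theta_term q (- w) m)) = (\<lambda>x. if x \<in> ?E then 2 * ?f x else 0)"
  proof
    fix x :: "int \<times> int"
    obtain n m where x: "x = (n, m)" by fastforce
    have "theta_term q (- z) n * theta_term q (- w) m = ((- 1) powi n * (- 1) powi m) * (theta_term q z n * theta_term q w m)"
      unfolding theta_term_uminus by (simp only: mult_ac)
    then show "?f x + (case x of (n, m) \<Rightarrow> theta_term q (- z) n * theta_term q (- w) m) = (if x \<in> ?E then 2 * ?f x else 0)"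
      unfolding x minus_one_powi_mult by simp
  qed
  also have "((\<lambda>x. if x \<in> ?E then 2 * ?f x else 0) has_sum ?L) UNIV \<longleftrightarrow> ((\<lambda>x. 2 * ?f x) has_sum ?L) ?E"
    by (rule has_sum_cong_neutral) auto
  also have "\<dots> \<longleftrightarrow> ((\<lambda>x. 2 * ?f ((\<lambda>(a, b). (a + b, a - b)) x)) has_sum ?L) UNIV"
  proof (rule has_sum_reindex_bij_betw[symmetric], rule bij_betwI')
    fix y assume "y \<in> ?E"
    then obtain n m where y: "y = (n, m)" "even (n + m)" by blast
    then obtain k where "n + m = 2 * k" by (elim evenE)
    then have "y = (\<lambda>(a, b). (a + b, a - b)) (k, k - m)" using y by auto
    then show "\<exists>x\<in>UNIV. y = (\<lambda>(a, b). (a + b, a - b)) x" by blast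
  qed auto
  finally have "((\<lambda>(a, b). 2 * (theta_term (q\<^sup>2) (z * w) a * theta_term (q\<^sup>2) (z / w) b)) has_sum ?L) UNIV"
    using assms by (simp add: theta_term_rotate case_prod_unfold)
  moreover have "((\<lambda>(a, b). 2 * (theta_term (q\<^sup>2) (z * w) a * theta_term (q\<^sup>2) (z / w) b)) has_sum
     2 * (theta (q\<^sup>2) (z * w) * theta (q\<^sup>2) (z / w))) UNIV"
    using has_sum_cmult_right[OF theta_mult_has_sum[OF q2, of "z * w" "z / w"], of 2] assms
    by (simp add: case_prod_unfold)
  ultimately have "?L = 2 * (theta (q\<^sup>2) (z * w) * theta (q\<^sup>2) (z / w))"
    by (rule has_sum_unique)
  then show ?thesis by (simp only: mult.assoc)
qed

text \<open>The difference keeps the terms with \<open>n + m\<close> odd. Together with the sum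
  formula it factorises numerator and denominator of the cross ratio of two theta quotients.\<close>

lemma theta_mult_diff:
  assumes "0 < q" "q < 1" "z \<noteq> 0" "w \<noteq> 0"
  shows "theta q z * theta q w - theta q (- z) * theta q (- w)
    = 2 * of_real q * z * theta (q\<^sup>2) (of_real (q\<^sup>2) * (z * w)) * theta (q\<^sup>2) (of_real (q\<^sup>2) * (z / w))"
    (is "?L = _")
proof -
  have q2: "0 < q\<^sup>2" "q\<^sup>2 < 1" using assms by (auto simp: power_less_one_iff)
  let ?f = "\<lambda>(n, m). theta_term q z n * theta_term q w m"
  let ?E = "{(n, m). odd (n + m :: int)}"
  let ?g = "\<lambda>(a, b). theta_term (q\<^sup>2) (of_real (q\<^sup>2) * (z * w)) a * theta_term (q\<^sup>2) (of_real (q\<^sup>2) * (z / w)) b"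
  have "((\<lambda>x. ?f x - (case x of (n, m) \<Rightarrow> theta_term q (- z) n * theta_term q (- w) m)) has_sum ?L) UNIV"
    using has_sum_add[OF theta_mult_has_sum[OF assms] has_sum_cmult_right[OF theta_mult_has_sum[OF assms(1,2), of "- z" "- w"], of "- 1"]] assms
    by simp
  also have "(\<lambda>x. ?f x - (case x of (n, m) \<Rightarrow> theta_term q (- z) n * theta_term q (- w) m)) = (\<lambda>x. if x \<in> ?E then 2 * ?f x else 0)"
  proof
    fix x :: "int \<times> int"
    obtain n m where x: "x = (n, m)" by fastforce
    have "theta_term q (- z) n * theta_term q (- w) m = ((- 1) powi n * (- 1) powi m) * (theta_term q z n * theta_term q w m)"
      unfolding theta_term_uminus by (simp only: mult_ac)
    then show "?f x - (case x of (n, m) \<Rightarrow> theta_term q (- z) n * theta_term q (- w) m) = (if x \<in> ?E then 2 * ?f x else 0)"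
      unfolding x minus_one_powi_mult by simp
  qed
  also have "((\<lambda>x. if x \<in> ?E then 2 * ?f x else 0) has_sum ?L) UNIV \<longleftrightarrow> ((\<lambda>x. 2 * ?f x) has_sum ?L) ?E"
    by (rule has_sum_cong_neutral) auto
  also have "\<dots> \<longleftrightarrow> ((\<lambda>x. 2 * ?f ((\<lambda>(a, b). (a + b + 1, a - b)) x)) has_sum ?L) UNIV"
  proof (rule has_sum_reindex_bij_betw[symmetric], rule bij_betwI')
    fix y assume "y \<in> ?E"
    then obtain n m where y: "y = (n, m)" "odd (n + m)" by blast
    then obtain k where "n + m = 2 * k + 1" by (elim oddE)
    then have "y = (\<lambda>(a, b). (a + b + 1, a - b)) (k, k - m)" using y by auto
    then show "\<exists>x\<in>UNIV. y = (\<lambda>(a, b). (a + b + 1, a - b)) x" by blast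
  qed auto
  also have "(\<lambda>x. 2 * ?f ((\<lambda>(a, b). (a + b + 1, a - b)) x)) = (\<lambda>x. 2 * of_real q * z * ?g x)"
    using assms by (auto simp: theta_term_rotate(2) mult.assoc simp del: of_real_power)
  finally have "((\<lambda>x. 2 * of_real q * z * ?g x) has_sum ?L) UNIV" .
  moreover have "((\<lambda>x. 2 * of_real q * z * ?g x) has_sum
     2 * of_real q * z * (theta (q\<^sup>2) (of_real (q\<^sup>2) * (z * w)) * theta (q\<^sup>2) (of_real (q\<^sup>2) * (z / w)))) UNIV"
    by (intro has_sum_cmult_right theta_mult_has_sum q2) (use assms in auto)
  ultimately have "?L = 2 * of_real q * z * (theta (q\<^sup>2) (of_real (q\<^sup>2) * (z * w)) * theta (q\<^sup>2) (of_real (q\<^sup>2) * (z / w)))"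
    by (rule has_sum_unique)
  then show ?thesis by (simp only: mult.assoc)
qed

section \<open>Quotients of theta functions\<close>

definition theta_re :: "real \<Rightarrow> complex \<Rightarrow> real" where
  "theta_re q z = Re (theta q z)"

text \<open>This is the function \<open>D\<close> of the overview. Classically it is theta_3 /
  theta_4, that is, Jacobi's dn up to a constant factor; real parts are taken because both theta
  values are real on the unit circle.\<close>

definition theta_quot :: "real \<Rightarrow> complex \<Rightarrow> real" where
  "theta_quot q z = theta_re q z / theta_re q (- z)"

lemma norm_one_plus_real_mult:
  assumes "cmod z = 1" "0 \<le> a" "a < 1"
  shows "1 - a \<le> cmod (1 + of_real a * z)" "cmod (1 + of_real a * z) \<le> 1 + a"
    "(1 + of_real a * z) * (1 + of_real a / z) = of_real ((cmod (1 + of_real a * z))\<^sup>2)"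
proof -
  have "norm (of_real a * z) = a" using assms by (simp add: norm_mult)
  then show "1 - a \<le> cmod (1 + of_real a * z)" "cmod (1 + of_real a * z) \<le> 1 + a"
    using norm_triangle_ineq[of 1 "of_real a * z"] norm_diff_ineq[of 1 "of_real a * z"] by simp_all
  have "1 + of_real a / z = cnj (1 + of_real a * z)"
    using divide_conv_cnj[OF assms(1), of "of_real a"] by simp
  then show "(1 + of_real a * z) * (1 + of_real a / z) = of_real ((cmod (1 + of_real a * z))\<^sup>2)"
    by (simp only: complex_norm_square)
qed

lemma power_odd_bounds:
  assumes "0 < q" "q < 1"
  shows "0 \<le> q ^ (2 * n + 1)" "q ^ (2 * n + 1) < (1::real)"
  using assms power_Suc_less_one[of q "2 * n"] by auto

text \<open>For \<open>cmod z = 1\<close> the two factors of index \<open>n\<close> in the triple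
  product are conjugate, so the partial products are products of squares
  \<open>(cmod (1 + a z))^2\<close> with \<open>0 < a < 1\<close>; each of these is largest at
  \<open>z = 1\<close> and smallest at \<open>z = -1\<close>.\<close>

lemma theta_circle:
  assumes "0 < q" "q < 1" "cmod z = 1"
  shows "theta q z = of_real (theta_re q z)" "0 < theta_re q z" "theta_re q z \<le> theta_re q 1"
     "theta_re q (- 1) \<le> theta_re q z"
proof -
  obtain K where K: "0 < K" "\<And>z. z \<noteq> 0 \<Longrightarrow> (\<lambda>N. jtp_prod q N z) \<longlonglongrightarrow> of_real K * theta q z"
    using jacobi_triple_product[OF assms(1,2)] by blast
  define P where "P = (\<lambda>z N. \<Prod>n<N. (cmod (1 + of_real (q ^ (2 * n + 1)) * z))\<^sup>2)"
  have jp: "jtp_prod q N z = of_real (P z N)" if "cmod z = 1" for z N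
    unfolding jtp_prod_def P_def of_real_prod
    by (intro prod.cong refl norm_one_plus_real_mult that power_odd_bounds assms)
  have lim: "P z \<longlonglongrightarrow> K * theta_re q z" and im: "Im (theta q z) = 0" if z: "cmod z = 1" for z
  proof -
    have "z \<noteq> 0" using z by auto
    from K(2)[OF this] have l: "(\<lambda>N. of_real (P z N)) \<longlonglongrightarrow> of_real K * theta q z"
      by (simp only: jp[OF z])
    from tendsto_Re[OF l] show "P z \<longlonglongrightarrow> K * theta_re q z"
      by (simp add: theta_re_def)
    from tendsto_Im[OF l] have "(\<lambda>N. 0) \<longlonglongrightarrow> K * Im (theta q z)" by simp
    then have "K * Im (theta q z) = 0" using LIMSEQ_unique tendsto_const by blast
    then show "Im (theta q z) = 0" using K by simp
  qed
  show "theta q z = of_real (theta_re q z)"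
    using im[OF assms(3)] by (simp add: theta_re_def complex_eq_iff)
  have b: "1 - q ^ (2 * n + 1) \<le> cmod (1 + of_real (q ^ (2 * n + 1)) * z)"
     "cmod (1 + of_real (q ^ (2 * n + 1)) * z) \<le> 1 + q ^ (2 * n + 1)" for n
    by (rule norm_one_plus_real_mult[OF assms(3) power_odd_bounds[OF assms(1,2)]])+
  have P1: "P 1 N = (\<Prod>n<N. (1 + q ^ (2 * n + 1))\<^sup>2)" for N
  proof -
    have "cmod (1 + of_real (q ^ (2 * n + 1)) * 1) = 1 + q ^ (2 * n + 1)" for n
    proof -
      have "1 + of_real (q ^ (2 * n + 1)) * 1 = (of_real (1 + q ^ (2 * n + 1)) :: complex)" by simp
      then show ?thesis using power_odd_bounds[OF assms(1,2), of n] by (simp only: norm_of_real)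
    qed
    then show ?thesis by (simp only: P_def)
  qed
  have Pm1: "P (- 1) N = (\<Prod>n<N. (1 - q ^ (2 * n + 1))\<^sup>2)" for N
  proof -
    have "cmod (1 + of_real (q ^ (2 * n + 1)) * - 1) = 1 - q ^ (2 * n + 1)" for n
    proof -
      have "1 + of_real (q ^ (2 * n + 1)) * - 1 = (of_real (1 - q ^ (2 * n + 1)) :: complex)" by simp
      then show ?thesis using power_odd_bounds[OF assms(1,2), of n] by (simp only: norm_of_real)
    qed
    then show ?thesis by (simp only: P_def)
  qed
  have "P z N \<le> P 1 N" for N
    unfolding P1 unfolding P_def using b by (intro prod_mono conjI power_mono) auto
  then have "K * theta_re q z \<le> K * theta_re q 1"
    using lim[OF assms(3)] lim[of 1] by (intro LIMSEQ_le[of "P z" _ "P 1"]) auto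
  then show "theta_re q z \<le> theta_re q 1" using K by simp
  have le: "P (- 1) N \<le> P z N" for N
    unfolding Pm1 unfolding P_def using b power_odd_bounds(2)[OF assms(1,2)]
    by (intro prod_mono conjI power_mono) (auto simp: less_imp_le)
  then have le': "K * theta_re q (- 1) \<le> K * theta_re q z"
    using lim[OF assms(3)] lim[of "- 1"] by (intro LIMSEQ_le[of "P (- 1)" _ "P z"]) auto
  then show "theta_re q (- 1) \<le> theta_re q z" using K by simp
  \<comment> \<open>Positive partial products alone would only give a nonnegative limit; a uniform
    positive lower bound is required.\<close>
  have "summable (\<lambda>n. q ^ (2 * n + 1))"
    using assms summable_mult2[OF summable_geometric[of "q\<^sup>2"], of q]
    by (simp add: power_mult power_less_one_iff abs_square_less_1)
  then obtain L where L: "0 < L" "\<And>n. L \<le> (\<Prod>i<n. 1 - q ^ (2 * i + 1))"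
    using prod_one_minus_LIMSEQ[of "\<lambda>n. q ^ (2 * n + 1)"] power_odd_bounds[OF assms(1,2)] by metis
  have "L\<^sup>2 \<le> P (- 1) N" for N
    unfolding Pm1 prod_power_distrib[symmetric] using L by (intro power_mono) auto
  then have "L\<^sup>2 \<le> K * theta_re q (- 1)"
    using lim[of "- 1"] by (intro LIMSEQ_le_const[of "P (- 1)"]) auto
  then have "0 < K * theta_re q z" using L le' by (smt (verit) zero_less_power)
  then show "0 < theta_re q z" using K by (simp add: zero_less_mult_iff)
qed

lemma theta_quot_bounds:
  assumes "0 < q" "q < 1" "cmod z = 1"
  shows "0 < theta_quot q z" "theta_quot q z \<le> theta_quot q 1" "1 / theta_quot q 1 \<le> theta_quot q z" "theta_quot q (- z) = 1 / theta_quot q z"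
proof -
  note a = theta_circle[OF assms] theta_circle[OF assms(1,2), of "- z"] theta_circle[OF assms(1,2), of "- 1"]
  show "0 < theta_quot q z" using a assms by (simp add: theta_quot_def)
  show "theta_quot q z \<le> theta_quot q 1" unfolding theta_quot_def using a assms by (intro frac_le) auto
  show "1 / theta_quot q 1 \<le> theta_quot q z" unfolding theta_quot_def using a assms by (simp add: frac_le)
  show "theta_quot q (- z) = 1 / theta_quot q z" by (simp add: theta_quot_def)
qed

text \<open>Up to a constant factor the modulus of Jacobi's sn for the nome \<open>q^2\<close>: the
  shift of the argument by \<open>q^2\<close> turns the theta_4 of the denominator into theta_1,
  which vanishes at \<open>x = 1\<close>.\<close>

definition sn_quot :: "real \<Rightarrow> complex \<Rightarrow> real" where
  "sn_quot q x = cmod (theta (q\<^sup>2) (- (of_real (q\<^sup>2) * x))) / theta_re (q\<^sup>2) (- x)"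

text \<open>After clearing denominators, numerator and denominator are the difference and the sum
  formula for the pair \<open>z\<close>, \<open>- w\<close>.\<close>

lemma theta_quot_cross_ratio:
  assumes "0 < q" "q < 1" "cmod z = 1" "cmod w = 1"
  shows "\<bar>theta_quot q z - theta_quot q w\<bar> / (theta_quot q z + theta_quot q w) = q * sn_quot q (z * w) * sn_quot q (z / w)"
proof -
  have q2: "0 < q\<^sup>2" "q\<^sup>2 < 1" using assms by (auto simp: power_less_one_iff)
  have nz: "z \<noteq> 0" "w \<noteq> 0" using assms by auto
  define A where "A = theta_re q z" define B where "B = theta_re q (- z)"
  define A' where "A' = theta_re q w" define B' where "B' = theta_re q (- w)"
  have pos: "0 < A" "0 < B" "0 < A'" "0 < B'"
    unfolding A_def B_def A'_def B'_def using assms by (auto intro!: theta_circle)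
  have th: "theta q z = of_real A" "theta q (- z) = of_real B" "theta q w = of_real A'" "theta q (- w) = of_real B'"
    unfolding A_def B_def A'_def B'_def using assms by (auto intro!: theta_circle)
  have th2: "theta (q\<^sup>2) (- (z * w)) = of_real (theta_re (q\<^sup>2) (- (z * w)))" "theta (q\<^sup>2) (- (z / w)) = of_real (theta_re (q\<^sup>2) (- (z / w)))"
    using assms q2 by (auto intro!: theta_circle simp: norm_mult norm_divide)
  have pos2: "0 < theta_re (q\<^sup>2) (- (z * w))" "0 < theta_re (q\<^sup>2) (- (z / w))"
    using assms q2 by (auto intro!: theta_circle simp: norm_mult norm_divide)
  have "of_real (A * B' + B * A') = (2 * of_real (theta_re (q\<^sup>2) (- (z * w))) * of_real (theta_re (q\<^sup>2) (- (z / w))) :: complex)"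
    using theta_mult_add[OF assms(1,2) nz(1), of "- w"] nz th th2 by simp
  then have "complex_of_real (A * B' + B * A') = of_real (2 * theta_re (q\<^sup>2) (- (z * w)) * theta_re (q\<^sup>2) (- (z / w)))"
    by simp
  then have sum: "A * B' + B * A' = 2 * theta_re (q\<^sup>2) (- (z * w)) * theta_re (q\<^sup>2) (- (z / w))"
    unfolding of_real_eq_iff .
  have "of_real (A * B' - B * A') = 2 * of_real q * z * theta (q\<^sup>2) (- (of_real (q\<^sup>2) * (z * w))) * theta (q\<^sup>2) (- (of_real (q\<^sup>2) * (z / w)))"
    using theta_mult_diff[OF assms(1,2) nz(1), of "- w"] nz th by simp
  then have "cmod (of_real (A * B' - B * A')) = cmod (2 * of_real q * z * theta (q\<^sup>2) (- (of_real (q\<^sup>2) * (z * w))) * theta (q\<^sup>2) (- (of_real (q\<^sup>2) * (z / w))))"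
    by (simp only:)
  then have diff: "\<bar>A * B' - B * A'\<bar> = 2 * q * cmod (theta (q\<^sup>2) (- (of_real (q\<^sup>2) * (z * w)))) * cmod (theta (q\<^sup>2) (- (of_real (q\<^sup>2) * (z / w))))"
    unfolding norm_mult norm_of_real using assms by simp
  have "\<bar>A / B - A' / B'\<bar> / (A / B + A' / B') = \<bar>A * B' - B * A'\<bar> / (A * B' + B * A')"
  proof -
    have "A / B - A' / B' = (A * B' - B * A') / (B * B')" "A / B + A' / B' = (A * B' + B * A') / (B * B')"
      using pos by (simp_all add: field_simps)
    then show ?thesis using pos by (simp add: abs_divide abs_mult)
  qed
  also have "\<dots> = q * sn_quot q (z * w) * sn_quot q (z / w)"
    unfolding sum diff sn_quot_def using pos2 by (simp add: field_simps)
  finally show ?thesis unfolding theta_quot_def A_def B_def A'_def B'_def .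
qed

text \<open>Quotient of the triple products of \<open>sn_quot\<close>. The shift by
  \<open>q^2\<close> moves the exponents \<open>4n + 2\<close> to \<open>4n + 4\<close> and
  \<open>4n\<close>; on the circle the factors in \<open>1 / x\<close> have the same modulus as
  those in \<open>x\<close>.\<close>

definition sn_partial :: "real \<Rightarrow> nat \<Rightarrow> complex \<Rightarrow> real" where
  "sn_partial q N x = (\<Prod>n<N. cmod (1 - of_real (q ^ (4 * n)) * x) * cmod (1 - of_real (q ^ (4 * n + 4)) * x)
     / (cmod (1 - of_real (q ^ (4 * n + 2)) * x))\<^sup>2)"

lemma norm_one_minus_divide:
  assumes "cmod x = 1"
  shows "cmod (1 - of_real a / x) = cmod (1 - of_real a * x)"
proof -
  have "1 - of_real a / x = cnj (1 - of_real a * x)"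
    using divide_conv_cnj[OF assms, of "of_real a"] by simp
  then show ?thesis by (simp only: complex_mod_cnj)
qed

lemma sn_partial_LIMSEQ:
  assumes "0 < q" "q < 1" "cmod x = 1"
  shows "(\<lambda>N. sn_partial q N x) \<longlonglongrightarrow> sn_quot q x"
proof -
  have q2: "0 < q\<^sup>2" "q\<^sup>2 < 1" using assms by (auto simp: power_less_one_iff)
  have x: "x \<noteq> 0" using assms by auto
  obtain K where K: "0 < K" "\<And>z. z \<noteq> 0 \<Longrightarrow> (\<lambda>N. jtp_prod (q\<^sup>2) N z) \<longlonglongrightarrow> of_real K * theta (q\<^sup>2) z"
    using jacobi_triple_product[OF q2] by blast
  have e: "(q\<^sup>2) ^ (2 * n + 1) = q ^ (4 * n + 2)" for n
    unfolding power_mult[symmetric] by (rule arg_cong[where f = "\<lambda>k. q ^ k"]) simp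
  have num: "cmod (jtp_prod (q\<^sup>2) N (- (of_real (q\<^sup>2) * x)))
     = (\<Prod>n<N. cmod (1 - of_real (q ^ (4 * n + 4)) * x) * cmod (1 - of_real (q ^ (4 * n)) * x))" for N
  proof -
    have "of_real (q ^ (4 * n + 2)) * - (of_real (q\<^sup>2) * x) = - (of_real (q ^ (4 * n + 4)) * x)"
      "of_real (q ^ (4 * n + 2)) / - (of_real (q\<^sup>2) * x) = - (of_real (q ^ (4 * n)) / x)" for n
      using assms by (simp_all add: power_add power2_eq_square power4_eq_xxxx)
    then show ?thesis
      unfolding jtp_prod_def e prod_norm[symmetric] norm_mult
      by (simp only: add_uminus_conv_diff norm_one_minus_divide[OF assms(3)])
  qed
  have den: "cmod (jtp_prod (q\<^sup>2) N (- x)) = (\<Prod>n<N. cmod (1 - of_real (q ^ (4 * n + 2)) * x) * cmod (1 - of_real (q ^ (4 * n + 2)) * x))" for N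
  proof -
    have "of_real (q ^ (4 * n + 2)) * - x = - (of_real (q ^ (4 * n + 2)) * x)"
      "of_real (q ^ (4 * n + 2)) / - x = - (of_real (q ^ (4 * n + 2)) / x)" for n
      by simp_all
    then show ?thesis
      unfolding jtp_prod_def e prod_norm[symmetric] norm_mult
      by (simp only: add_uminus_conv_diff norm_one_minus_divide[OF assms(3)])
  qed
  have th: "theta (q\<^sup>2) (- x) = of_real (theta_re (q\<^sup>2) (- x))" "0 < theta_re (q\<^sup>2) (- x)"
    using theta_circle[OF q2, of "- x"] assms by auto
  have "(\<lambda>N. cmod (jtp_prod (q\<^sup>2) N (- (of_real (q\<^sup>2) * x))) / cmod (jtp_prod (q\<^sup>2) N (- x)))
     \<longlonglongrightarrow> cmod (of_real K * theta (q\<^sup>2) (- (of_real (q\<^sup>2) * x))) / cmod (of_real K * theta (q\<^sup>2) (- x))"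
    using K(1) th x assms by (intro tendsto_intros K) auto
  moreover have "cmod (of_real K * theta (q\<^sup>2) (- (of_real (q\<^sup>2) * x))) / cmod (of_real K * theta (q\<^sup>2) (- x)) = sn_quot q x"
    unfolding sn_quot_def th(1) norm_mult norm_of_real using th(2) K(1) by simp
  moreover have "cmod (jtp_prod (q\<^sup>2) N (- (of_real (q\<^sup>2) * x))) / cmod (jtp_prod (q\<^sup>2) N (- x)) = sn_partial q N x" for N
    unfolding num den unfolding sn_partial_def power2_eq_square prod_dividef[symmetric] by (simp only: mult.commute)
  ultimately show ?thesis by simp
qed

text \<open>At \<open>x = -1\<close> all factors are \<open>1 + q^m\<close>. The numerator factor
  with exponent 0 is the 2; every other one is paired with a denominator factor of smaller exponent,
  hence of larger value.\<close>

lemma sn_quot_minus_one_le: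
  assumes "0 < q" "q < 1"
  shows "sn_quot q (- 1) \<le> 2" "0 \<le> sn_quot q (- 1)"
proof -
  have n: "cmod (1 - of_real (q ^ n) * - 1) = 1 + q ^ n" for n
  proof -
    have "1 - of_real (q ^ n) * - 1 = (of_real (1 + q ^ n) :: complex)" by simp
    moreover have "0 < 1 + q ^ n" using assms by (simp add: add_pos_pos)
    ultimately show ?thesis by (simp only: norm_of_real abs_of_pos)
  qed
  have pos: "0 < 1 + q ^ n" for n using assms by (simp add: add_pos_pos)
  have nn: "0 \<le> (\<Prod>n<N. 1 + q ^ f n)" for N and f :: "nat \<Rightarrow> nat"
    by (intro prod_nonneg) (use pos less_imp_le in blast)
  have mono: "1 + q ^ (4 * n + 4) \<le> 1 + q ^ (4 * n + 2)" for n
    using assms by (intro add_left_mono power_decreasing) auto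
  have le1: "(\<Prod>n<N. 1 + q ^ (4 * n + 4)) \<le> (\<Prod>n<N. 1 + q ^ (4 * n + 2))" for N
    using mono pos by (intro prod_mono) (auto simp: less_imp_le)
  have le2: "(\<Prod>n<N. 1 + q ^ (4 * n)) \<le> 2 * (\<Prod>n<N. 1 + q ^ (4 * n + 2))" for N
  proof (cases N)
    case (Suc M)
    have "(\<Prod>n<Suc M. 1 + q ^ (4 * n)) = 2 * (\<Prod>n<M. 1 + q ^ (4 * n + 4))"
      unfolding prod.lessThan_Suc_shift by (simp add: add.commute)
    also have "\<dots> \<le> 2 * (\<Prod>n<M. 1 + q ^ (4 * n + 2))" using le1 by simp
    also have "\<dots> = 2 * ((\<Prod>n<M. 1 + q ^ (4 * n + 2)) * 1)" by simp
    also have "\<dots> \<le> 2 * ((\<Prod>n<M. 1 + q ^ (4 * n + 2)) * (1 + q ^ (4 * M + 2)))"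
      using nn[of "\<lambda>n. 4 * n + 2" M] assms by (intro mult_left_mono) auto
    finally show ?thesis using Suc by simp
  qed simp
  have "sn_partial q N (- 1) = (\<Prod>n<N. 1 + q ^ (4 * n)) * (\<Prod>n<N. 1 + q ^ (4 * n + 4)) / ((\<Prod>n<N. 1 + q ^ (4 * n + 2)) * (\<Prod>n<N. 1 + q ^ (4 * n + 2)))" for N
    unfolding sn_partial_def n prod_dividef power2_eq_square prod.distrib ..
  moreover have "(\<Prod>n<N. 1 + q ^ (4 * n)) * (\<Prod>n<N. 1 + q ^ (4 * n + 4)) \<le> 2 * (\<Prod>n<N. 1 + q ^ (4 * n + 2)) * (\<Prod>n<N. 1 + q ^ (4 * n + 2))" for N
    using nn[of "\<lambda>n. 4 * n + 2" N] nn[of "\<lambda>n. 4 * n + 4" N] by (intro mult_mono[OF le2 le1]) simp_all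
  moreover have "0 < (\<Prod>n<N. 1 + q ^ (4 * n + 2))" for N by (intro prod_pos pos)
  ultimately have "sn_partial q N (- 1) \<le> 2" for N
    by (simp add: divide_le_eq mult.assoc)
  moreover have "(\<lambda>N. sn_partial q N (- 1)) \<longlonglongrightarrow> sn_quot q (- 1)"
    by (rule sn_partial_LIMSEQ) (use assms in auto)
  moreover have "0 \<le> sn_partial q N (- 1)" for N unfolding sn_partial_def by (intro prod_nonneg) simp
  ultimately show "sn_quot q (- 1) \<le> 2" "0 \<le> sn_quot q (- 1)"
    by (auto intro: LIMSEQ_le_const2 LIMSEQ_le_const)
qed

text \<open>The maximum is at \<open>x = -1\<close>. The cross ratio with \<open>w = 1\<close> shows
  this: it equals \<open>q\<close> times the square of \<open>sn_quot\<close>, and it is decreasing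
  in \<open>theta_quot q x\<close>, whose minimum is at \<open>-1\<close>.\<close>

lemma sn_quot_le_2:
  assumes "0 < q" "q < 1" "cmod x = 1"
  shows "sn_quot q x \<le> 2"
proof -
  define b where "b = theta_quot q 1"
  define y where "y = theta_quot q x"
  have b: "0 < b" "0 < y" "y \<le> b" "1 / b \<le> y" "theta_quot q (- 1) = 1 / b"
    unfolding b_def y_def using theta_quot_bounds[OF assms] theta_quot_bounds[OF assms(1,2), of 1] by auto
  have "q * (sn_quot q x * sn_quot q x) = \<bar>y - b\<bar> / (y + b)"
    using theta_quot_cross_ratio[OF assms, of 1] by (simp add: y_def b_def)
  also have "\<dots> = (b - y) / (b + y)" using b by (simp add: add.commute)
  also have "\<dots> \<le> (b - 1 / b) / (b + 1 / b)" using b by (intro frac_le add_left_mono diff_left_mono) (auto intro: add_pos_pos)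
  also have "\<dots> = q * (sn_quot q (- 1) * sn_quot q (- 1))"
  proof -
    have "1 / b \<le> b" using b by linarith
    then have "\<bar>b - 1 / b\<bar> = b - 1 / b" by simp
    moreover have "\<bar>b - 1 / b\<bar> / (b + 1 / b) = q * (sn_quot q (- 1) * sn_quot q (- 1))"
      using theta_quot_cross_ratio[OF assms(1,2), of 1 "- 1"] b(5) by (simp add: b_def mult.assoc)
    ultimately show ?thesis by (simp only:)
  qed
  finally have "(sn_quot q x)\<^sup>2 \<le> (sn_quot q (- 1))\<^sup>2" using assms by (simp add: power2_eq_square)
  then have "sn_quot q x \<le> sn_quot q (- 1)"
    by (rule power2_le_imp_le) (rule sn_quot_minus_one_le[OF assms(1,2)])
  then show ?thesis using sn_quot_minus_one_le[OF assms(1,2)] by simp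
qed

text \<open>Two monic polynomials of degree \<open>N\<close> that agree at the \<open>N\<close>
  roots of \<open>-1\<close> coincide; evaluation at \<open>1 / y\<close> gives the claim.\<close>

lemma prod_roots_minus_one:
  fixes y :: complex
  assumes "0 < N"
  shows "(\<Prod>w\<in>{w. w ^ N = - 1}. 1 - y * w) = 1 + y ^ N"
proof -
  define R where "R = {w :: complex. w ^ N = - 1}"
  have fin: "finite R" and card: "card R = N"
    unfolding R_def using assms by (auto intro!: finite_nth_roots card_nth_roots)
  have deg: "degree (\<Prod>w\<in>R. [:- w, 1:]) = N"
    using degree_prod_eq_sum_degree[of R "\<lambda>w. [:- w, 1:]"] card by simp
  have eq: "(\<Prod>w\<in>R. [:- w, 1:]) = monom 1 N + 1"
  proof (rule poly_eqI_degree_lead_coeff[where n = N and A = R])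
    have "lead_coeff (\<Prod>w\<in>R. [:- w, 1:]) = 1" by (simp add: lead_coeff_prod)
    then show "Polynomial.coeff (\<Prod>w\<in>R. [:- w, 1:]) N = Polynomial.coeff (monom 1 N + 1) N"
      using deg assms by (simp add: Polynomial.coeff_1)
    show "degree (monom 1 N + (1 :: complex poly)) \<le> N"
      by (intro degree_add_le) (auto simp: degree_monom_le)
    show "poly (\<Prod>w\<in>R. [:- w, 1:]) z = poly (monom 1 N + 1) z" if "z \<in> R" for z
    proof -
      have "(\<Prod>w\<in>R. z - w) = 0" using that fin by (intro prod_zero) auto
      then show ?thesis using that by (simp add: poly_prod poly_monom R_def)
    qed
  qed (use card deg in auto)
  show ?thesis
  proof (cases "y = 0")
    case True then show ?thesis using assms by (simp add: R_def)
  next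
    case False
    have "(\<Prod>w\<in>R. 1 - y * w) = (\<Prod>w\<in>R. y * (1 / y - w))"
      using False by (intro prod.cong) (auto simp: field_simps)
    also have "\<dots> = y ^ N * poly (\<Prod>w\<in>R. [:- w, 1:]) (1 / y)"
      by (simp add: prod.distrib card poly_prod)
    also have "\<dots> = 1 + y ^ N" unfolding eq using False by (simp add: poly_monom field_simps)
    finally show ?thesis by (simp add: R_def)
  qed
qed

text \<open>No root of \<open>-1\<close> of even order is real, so the roots form \<open>k\<close>
  pairs \<open>w\<close>, \<open>1 / w\<close>. These are the pairs that the arguments
  \<open>z * w\<close> and \<open>z / w\<close> of the cross ratio call for.\<close>

lemma roots_minus_one_upper_half:
  assumes "0 < k"
  obtains w :: "nat \<Rightarrow> complex" where "\<And>j. j < k \<Longrightarrow> cmod (w j) = 1"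
    and "\<And>y. (\<Prod>j<k. (1 - y * w j) * (1 - y / w j)) = 1 + y ^ (2 * k)"
proof -
  define R where "R = {w :: complex. w ^ (2 * k) = - 1}"
  define U where "U = {w \<in> R. 0 < Im w}"
  have fin: "finite R" and card: "card R = 2 * k"
    unfolding R_def using assms by (auto intro!: finite_nth_roots card_nth_roots)
  have norm: "cmod w = 1" if "w \<in> R" for w
  proof -
    have "cmod w ^ (2 * k) = cmod (w ^ (2 * k))" by (rule norm_power[symmetric])
    also have "\<dots> = 1" using that by (simp add: R_def)
    finally have "cmod w ^ (2 * k) = 1" .
    then show ?thesis using assms power_eq_imp_eq_base[of "cmod w" "2 * k" 1] by simp
  qed
  have im: "Im w \<noteq> 0" if "w \<in> R" for w
  proof
    assume "Im w = 0"
    then obtain x where x: "w = of_real x" by (metis complex_is_Real_iff Reals_cases)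
    have "complex_of_real (x ^ (2 * k)) = of_real (- 1)" using that by (simp add: R_def x)
    then have "x ^ (2 * k) = - 1" unfolding of_real_eq_iff .
    moreover have "0 \<le> x ^ (2 * k)" by simp
    ultimately show False by simp
  qed
  have cnjR: "cnj w \<in> R" if "w \<in> R" for w
    using that by (simp add: R_def flip: complex_cnj_power)
  have R: "R = U \<union> cnj ` U"
  proof
    show "R \<subseteq> U \<union> cnj ` U"
    proof
      fix w assume w: "w \<in> R"
      show "w \<in> U \<union> cnj ` U"
      proof (cases "0 < Im w")
        case True then show ?thesis using w by (simp add: U_def)
      next
        case False
        then have "cnj w \<in> U" using w im[OF w] cnjR[OF w] by (simp add: U_def)
        then have "cnj (cnj w) \<in> cnj ` U" by (rule imageI)
        then show ?thesis by simp
      qed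
    qed
    show "U \<union> cnj ` U \<subseteq> R" using cnjR by (auto simp: U_def)
  qed
  have disj: "U \<inter> cnj ` U = {}" by (auto simp: U_def)
  have finU: "finite U" using fin by (simp add: U_def)
  have inj: "inj_on cnj U" by (auto intro!: inj_onI)
  have "2 * k = card U + card (cnj ` U)"
    unfolding card[symmetric] R using finU disj by (intro card_Un_disjoint) auto
  then have "card U = k" using card_image[OF inj] by simp
  then obtain w where w: "bij_betw w {..<k} U"
    using ex_bij_betw_nat_finite[OF finU] by (auto simp: atLeast0LessThan)
  have wU: "w j \<in> U" if "j < k" for j using bij_betwE[OF w] that by auto
  show thesis
  proof
    show "cmod (w j) = 1" if "j < k" for j using wU[OF that] norm by (simp add: U_def)
    fix y :: complex
    have "(\<Prod>j<k. (1 - y * w j) * (1 - y / w j)) = (\<Prod>j<k. (1 - y * w j) * (1 - y * cnj (w j)))"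
    proof (intro prod.cong refl)
      fix j assume "j \<in> {..<k}"
      then have "w j \<in> R" using wU by (simp add: U_def)
      then have "y / w j = y * cnj (w j)" using divide_conv_cnj[OF norm] by blast
      then show "(1 - y * w j) * (1 - y / w j) = (1 - y * w j) * (1 - y * cnj (w j))" by simp
    qed
    also have "\<dots> = (\<Prod>u\<in>U. (1 - y * u) * (1 - y * cnj u))"
      by (rule prod.reindex_bij_betw[OF w])
    also have "\<dots> = (\<Prod>u\<in>U. 1 - y * u) * (\<Prod>u\<in>cnj ` U. 1 - y * u)"
      by (simp add: prod.distrib prod.reindex[OF inj])
    also have "\<dots> = (\<Prod>u\<in>R. 1 - y * u)"
      unfolding R using finU disj by (intro prod.union_disjoint[symmetric]) auto
    also have "\<dots> = 1 + y ^ (2 * k)"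
      unfolding R_def using assms by (intro prod_roots_minus_one) simp
    finally show "(\<Prod>j<k. (1 - y * w j) * (1 - y / w j)) = 1 + y ^ (2 * k)" .
  qed
qed

text \<open>The factors of nome \<open>q\<close> multiply to \<open>q^k\<close> times a single
  \<open>sn_quot\<close> of nome \<open>q^(2k)\<close>, which is at most 2 whatever the
  nome.\<close>

lemma theta_quot_prod_le:
  assumes "0 < q" "q < 1" "0 < k"
  obtains w :: "nat \<Rightarrow> complex" where "\<And>j. j < k \<Longrightarrow> cmod (w j) = 1"
    and "\<And>z. cmod z = 1 \<Longrightarrow>
      (\<Prod>j<k. \<bar>theta_quot q z - theta_quot q (w j)\<bar> / (theta_quot q z + theta_quot q (w j))) \<le> 2 * q ^ k"
proof -
  obtain w :: "nat \<Rightarrow> complex" where w: "\<And>j. j < k \<Longrightarrow> cmod (w j) = 1"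
    and pr: "\<And>y. (\<Prod>j<k. (1 - y * w j) * (1 - y / w j)) = 1 + y ^ (2 * k)"
    using roots_minus_one_upper_half[OF assms(3)] by blast
  show thesis
  proof
    show "cmod (w j) = 1" if "j < k" for j by (rule w[OF that])
    fix z assume z: "cmod z = 1"
    \<comment> \<open>With these choices \<open>1 + (q^m z)^(2k)\<close> becomes
      \<open>1 - Q^m x\<close>, the shape of a factor of \<open>sn_partial Q\<close>.\<close>
    define Q where "Q = q ^ (2 * k)"
    define x where "x = - (z ^ (2 * k))"
    have Q: "0 < Q" "Q < 1" unfolding Q_def using assms by (auto simp: power_less_one_iff)
    have x: "cmod x = 1" unfolding x_def using z by (simp add: norm_power)
    have merge: "(\<Prod>j<k. cmod (1 - of_real (q ^ m) * (z * w j)) * cmod (1 - of_real (q ^ m) * (z / w j)))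
        = cmod (1 - of_real (Q ^ m) * x)" for m
    proof -
      have "(\<Prod>j<k. cmod (1 - of_real (q ^ m) * (z * w j)) * cmod (1 - of_real (q ^ m) * (z / w j)))
        = cmod (\<Prod>j<k. (1 - (of_real (q ^ m) * z) * w j) * (1 - (of_real (q ^ m) * z) / w j))"
        by (simp add: norm_mult flip: prod_norm) (simp add: mult.assoc)
      also have "\<dots> = cmod (1 + (of_real (q ^ m) * z) ^ (2 * k))" unfolding pr ..
      also have "1 + (of_real (q ^ m) * z) ^ (2 * k) = 1 - of_real (Q ^ m) * x"
        by (simp add: x_def Q_def power_mult_distrib mult.commute flip: power_mult)
      finally show ?thesis .
    qed
    have "(\<Prod>j<k. sn_partial q N (z * w j) * sn_partial q N (z / w j)) = sn_partial Q N x" for N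
    proof -
      have "(\<Prod>j<k. sn_partial q N (z * w j) * sn_partial q N (z / w j)) =
        (\<Prod>j<k. \<Prod>n<N. (cmod (1 - of_real (q ^ (4 * n)) * (z * w j)) * cmod (1 - of_real (q ^ (4 * n)) * (z / w j)))
         * (cmod (1 - of_real (q ^ (4 * n + 4)) * (z * w j)) * cmod (1 - of_real (q ^ (4 * n + 4)) * (z / w j)))
         / (cmod (1 - of_real (q ^ (4 * n + 2)) * (z * w j)) * cmod (1 - of_real (q ^ (4 * n + 2)) * (z / w j)))\<^sup>2)"
        unfolding sn_partial_def prod.distrib[symmetric]
        by (intro prod.cong refl) (simp only: times_divide_times_eq power_mult_distrib mult_ac)
      also have "\<dots> = sn_partial Q N x"
        unfolding sn_partial_def
        by (subst prod.swap, intro prod.cong refl)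
          (simp only: prod_dividef prod_power_distrib[symmetric] prod.distrib merge[unfolded prod.distrib])
      finally show ?thesis .
    qed
    moreover have "(\<lambda>N. \<Prod>j<k. sn_partial q N (z * w j) * sn_partial q N (z / w j)) \<longlonglongrightarrow> (\<Prod>j<k. sn_quot q (z * w j) * sn_quot q (z / w j))"
      by (intro tendsto_prod tendsto_mult sn_partial_LIMSEQ assms) (auto simp: norm_mult norm_divide z w)
    ultimately have "(\<Prod>j<k. sn_quot q (z * w j) * sn_quot q (z / w j)) = sn_quot Q x"
      using sn_partial_LIMSEQ[OF Q x] LIMSEQ_unique by simp
    moreover have "(\<Prod>j<k. \<bar>theta_quot q z - theta_quot q (w j)\<bar> / (theta_quot q z + theta_quot q (w j)))
        = (\<Prod>j<k. q * (sn_quot q (z * w j) * sn_quot q (z / w j)))"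
      by (intro prod.cong refl) (simp add: theta_quot_cross_ratio[OF assms(1,2) z w])
    ultimately have "(\<Prod>j<k. \<bar>theta_quot q z - theta_quot q (w j)\<bar> / (theta_quot q z + theta_quot q (w j))) = q ^ k * sn_quot Q x"
      by (simp add: prod.distrib)
    also have "\<dots> \<le> q ^ k * 2"
      using sn_quot_le_2[OF Q x] assms by (intro mult_left_mono) auto
    finally show "(\<Prod>j<k. \<bar>theta_quot q z - theta_quot q (w j)\<bar> / (theta_quot q z + theta_quot q (w j))) \<le> 2 * q ^ k"
      by simp
  qed
qed

lemma continuous_on_theta_re_cis:
  assumes "0 < q" "q < 1"
  shows "continuous_on A (\<lambda>t. theta_re q (cis t))"
proof -
  define f where "f = (\<lambda>n t. theta_term q (cis t) (int_decode n))"
  define M where "M = (\<lambda>n. norm (theta_term q 1 (int_decode n)))"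
  have "M summable_on UNIV" unfolding M_def
    by (rule iffD2[OF summable_on_reindex_bij_betw[OF bij_int_decode] theta_term_abs_summable[OF assms]]) simp
  then have M: "summable M" by (rule summable_on_imp_summable)
  have fM: "norm (f n t) \<le> M n" for n t
    by (simp add: f_def M_def theta_term_def norm_mult norm_power_int)
  have "uniform_limit A (\<lambda>N t. \<Sum>n<N. f n t) (\<lambda>t. suminf (\<lambda>n. f n t)) sequentially"
    using fM M by (intro Weierstrass_m_test)
  moreover have "\<forall>\<^sub>F N in sequentially. continuous_on A (\<lambda>t. \<Sum>n<N. f n t)"
    unfolding f_def theta_term_def by (intro always_eventually allI continuous_intros) auto
  ultimately have "continuous_on A (\<lambda>t. suminf (\<lambda>n. f n t))"
    by (intro uniform_limit_theorem[where F = sequentially]) auto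
  moreover have "suminf (\<lambda>n. f n t) = theta q (cis t)" for t
  proof -
    have "(theta_term q (cis t) has_sum theta q (cis t)) UNIV" by (rule theta_has_sum[OF assms]) simp
    then have "((\<lambda>n. f n t) has_sum theta q (cis t)) UNIV"
      unfolding f_def by (rule iffD2[OF has_sum_reindex_bij_betw[OF bij_int_decode]])
    then show ?thesis by (rule sums_unique[OF has_sum_imp_sums, symmetric])
  qed
  ultimately show ?thesis unfolding theta_re_def by (simp add: continuous_on_Re)
qed

text \<open>Intermediate values on the upper half circle, which joins the minimum
  \<open>1 / b\<close> at \<open>-1\<close> to the maximum \<open>b\<close> at
  \<open>1\<close>.\<close>

lemma theta_quot_surj:
  assumes "0 < q" "q < 1" "1 / theta_quot q 1 \<le> y" "y \<le> theta_quot q 1"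
  obtains z where "cmod z = 1" "theta_quot q z = y"
proof -
  have eq: "- cis t = cis (t + pi)" for t by (simp add: cis_mult[symmetric])
  have "continuous_on {0..pi} (\<lambda>t. theta_quot q (cis t))"
    unfolding theta_quot_def eq
  proof (intro continuous_on_divide continuous_on_theta_re_cis assms ballI)
    show "continuous_on {0..pi} (\<lambda>t. theta_re q (cis (t + pi)))"
      by (rule continuous_on_compose2[OF continuous_on_theta_re_cis[OF assms(1,2), of UNIV]]) (auto intro!: continuous_intros)
    fix t show "theta_re q (cis (t + pi)) \<noteq> 0"
      using theta_circle(2)[OF assms(1,2), of "cis (t + pi)"] by simp
  qed
  moreover have "theta_quot q (cis pi) \<le> y" "y \<le> theta_quot q (cis 0)"
    using theta_quot_bounds(4)[OF assms(1,2), of 1] assms by auto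
  ultimately obtain t where "theta_quot q (cis t) = y"
    using IVT2'[of "\<lambda>t. theta_quot q (cis t)" pi y 0] by auto
  then show ?thesis by (intro that[of "cis t"]) auto
qed

text \<open>Substitution \<open>y = theta_quot q z\<close> and
  \<open>d j = theta_quot q (w j)\<close> in the bound on the circle.\<close>

theorem real_zolotarev_bound:
  assumes "0 < q" "q < 1" "0 < k"
  obtains d :: "nat \<Rightarrow> real" where "\<And>j. j < k \<Longrightarrow> 0 < d j"
    and "\<And>y. 1 / theta_quot q 1 \<le> y \<Longrightarrow> y \<le> theta_quot q 1 \<Longrightarrow> (\<Prod>j<k. \<bar>y - d j\<bar> / (y + d j)) \<le> 2 * q ^ k"
proof -
  obtain w :: "nat \<Rightarrow> complex" where w: "\<And>j. j < k \<Longrightarrow> cmod (w j) = 1"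
    and le: "\<And>z. cmod z = 1 \<Longrightarrow>
      (\<Prod>j<k. \<bar>theta_quot q z - theta_quot q (w j)\<bar> / (theta_quot q z + theta_quot q (w j))) \<le> 2 * q ^ k"
    using theta_quot_prod_le[OF assms] by blast
  show thesis
  proof (rule that[of "\<lambda>j. theta_quot q (w j)"])
    show "0 < theta_quot q (w j)" if "j < k" for j
      by (rule theta_quot_bounds[OF assms(1,2) w[OF that]])
    show "(\<Prod>j<k. \<bar>y - theta_quot q (w j)\<bar> / (y + theta_quot q (w j))) \<le> 2 * q ^ k" if y: "1 / theta_quot q 1 \<le> y" "y \<le> theta_quot q 1" for y
    proof -
      obtain z where "cmod z = 1" "theta_quot q z = y" using theta_quot_surj[OF assms(1,2) y] by blast
      then show ?thesis using le[of z] by simp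
    qed
  qed
qed

section \<open>The elliptic modulus\<close>

text \<open>With \<open>A\<close>, \<open>B\<close> for nome \<open>q\<close> and \<open>A'\<close>,
  \<open>B'\<close> for \<open>q^2\<close>, the addition formulas give
  \<open>A^2 + B^2 = 2 A'^2\<close> and \<open>A B = B'^2\<close>. The only loss in the estimate of
  \<open>A / B = A^2 / (A B)\<close> is the summand \<open>B^2\<close>.\<close>

lemma theta_quot_square:
  assumes "0 < q" "q < 1"
  shows "theta_quot q 1 \<le> 2 * (theta_quot (q\<^sup>2) 1)\<^sup>2"
proof -
  have q2: "0 < q\<^sup>2" "q\<^sup>2 < 1" using assms by (auto simp: power_less_one_iff)
  define A where "A = theta_re q 1" define B where "B = theta_re q (- 1)"
  define A' where "A' = theta_re (q\<^sup>2) 1" define B' where "B' = theta_re (q\<^sup>2) (- 1)"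
  have pos: "0 < A" "0 < B" "0 < A'" "0 < B'"
    unfolding A_def B_def A'_def B'_def using assms q2 by (auto intro!: theta_circle)
  have th: "theta q 1 = of_real A" "theta q (- 1) = of_real B" "theta (q\<^sup>2) 1 = of_real A'" "theta (q\<^sup>2) (- 1) = of_real B'"
    unfolding A_def B_def A'_def B'_def using assms q2 by (auto intro!: theta_circle)
  have "of_real (A * A + B * B) = (of_real (2 * A' * A') :: complex)"
    using theta_mult_add[OF assms, of 1 1] th by simp
  then have s: "A * A + B * B = 2 * A' * A'" unfolding of_real_eq_iff .
  have "of_real (2 * A * B) = (of_real (2 * B' * B') :: complex)"
    using theta_mult_add[OF assms, of 1 "- 1"] th by simp
  then have p: "A * B = B' * B'" unfolding of_real_eq_iff by simp
  have "A / B = A * A / (A * B)" using pos by simp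
  also have "\<dots> \<le> 2 * A' * A' / (A * B)" unfolding s[symmetric] using pos by (intro divide_right_mono) auto
  also have "\<dots> = 2 * (A' / B')\<^sup>2" unfolding p by (simp add: power2_eq_square)
  finally show ?thesis by (simp add: theta_quot_def A_def B_def A'_def B'_def)
qed

text \<open>Truncation of the series of \<open>2 artanh x\<close>, whose terms are nonnegative; the
  comparison of derivatives is a finite geometric sum.\<close>

lemma ln_ratio_ge:
  fixes x :: real
  assumes "0 \<le> x" "x < 1"
  shows "2 * (\<Sum>j<J. x ^ (2 * j + 1) / real (2 * j + 1)) \<le> ln ((1 + x) / (1 - x))"
proof -
  define f where "f = (\<lambda>x. ln (1 + x) - ln (1 - x) - 2 * (\<Sum>j<J. x ^ (2 * j + 1) / real (2 * j + 1)))"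
  have "f 0 \<le> f x"
  proof (rule DERIV_nonneg_imp_nondecreasing[OF assms(1)])
    fix t assume t: "0 \<le> t" "t \<le> x"
    then have t1: "t < 1" using assms by simp
    have "((\<lambda>x. x ^ (2 * j + 1) / real (2 * j + 1)) has_real_derivative (t\<^sup>2) ^ j) (at t)" for j
    proof -
      have "((\<lambda>x. x ^ (2 * j + 1) / real (2 * j + 1)) has_real_derivative (real (2 * j + 1) * t ^ (2 * j)) / real (2 * j + 1)) (at t)"
        using DERIV_cdivide[OF DERIV_pow[of "2 * j + 1" t], of "real (2 * j + 1)"] by simp
      moreover have "real (2 * j + 1) * t ^ (2 * j) / real (2 * j + 1) = (t\<^sup>2) ^ j"
        by (simp add: power_mult del: of_nat_Suc of_nat_add)
      ultimately show ?thesis by (simp only:)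
    qed
    then have dS: "((\<lambda>x. \<Sum>j<J. x ^ (2 * j + 1) / real (2 * j + 1)) has_real_derivative (\<Sum>j<J. (t\<^sup>2) ^ j)) (at t)"
      by (intro DERIV_sum)
    have dL: "((\<lambda>x. ln (1 + x) - ln (1 - x)) has_real_derivative 1 / (1 + t) + 1 / (1 - t)) (at t)"
      using t t1 by (auto intro!: derivative_eq_intros)
    have "(f has_real_derivative (1 / (1 + t) + 1 / (1 - t) - 2 * (\<Sum>j<J. (t\<^sup>2) ^ j))) (at t)"
      unfolding f_def by (rule DERIV_diff[OF dL DERIV_cmult[OF dS]])
    moreover have "0 \<le> 1 / (1 + t) + 1 / (1 - t) - 2 * (\<Sum>j<J. (t\<^sup>2) ^ j)"
    proof -
      have t2: "t\<^sup>2 < 1" using t t1 by (simp add: abs_square_less_1)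
      have "(\<Sum>j<J. (t\<^sup>2) ^ j) = (1 - (t\<^sup>2) ^ J) / (1 - t\<^sup>2)"
        using t2 by (simp add: sum_gp_strict)
      also have "\<dots> \<le> 1 / (1 - t\<^sup>2)" using t2 by (intro divide_right_mono) auto
      also have "2 * (1 / (1 - t\<^sup>2)) = 1 / (1 + t) + 1 / (1 - t)"
        using t t1 t2 by (simp add: field_simps power2_eq_square)
      finally show ?thesis by simp
    qed
    ultimately show "\<exists>y. (f has_real_derivative y) (at t) \<and> 0 \<le> y" by blast
  qed
  moreover have "f 0 = 0" by (simp add: f_def)
  moreover have "ln (1 + x) - ln (1 - x) = ln ((1 + x) / (1 - x))"
    using assms by (simp add: ln_div)
  ultimately show ?thesis by (simp add: f_def)
qed

text \<open>The triple product turns the logarithm into a sum of \<open>2 ln ((1+x)/(1-x))\<close>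
  over \<open>x = q^(2n+1)\<close>. After truncating each series, the order of summation is
  exchanged and the sum over \<open>n\<close> is geometric.\<close>

lemma ln_theta_quot_ge:
  assumes "0 < q" "q < 1"
  shows "4 * (\<Sum>j<J. q ^ (2 * j + 1) / (1 - q ^ (2 * (2 * j + 1))) / real (2 * j + 1)) \<le> ln (theta_quot q 1)"
proof -
  obtain K where K: "0 < K" "\<And>z. z \<noteq> 0 \<Longrightarrow> (\<lambda>N. jtp_prod q N z) \<longlonglongrightarrow> of_real K * theta q z"
    using jacobi_triple_product[OF assms(1,2)] by blast
  define r where "r = (\<lambda>n. (1 + q ^ (2 * n + 1)) / (1 - q ^ (2 * n + 1)))"
  note ob = power_odd_bounds[OF assms]
  have rpos: "0 < r n" for n unfolding r_def using ob[of n] by (simp add: add_pos_nonneg)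
  have th: "theta q 1 = of_real (theta_re q 1)" "0 < theta_re q 1" "theta q (- 1) = of_real (theta_re q (- 1))" "0 < theta_re q (- 1)"
    using assms by (auto intro!: theta_circle)
  have "(\<lambda>N. Re (jtp_prod q N 1 / jtp_prod q N (- 1))) \<longlonglongrightarrow> Re ((of_real K * theta q 1) / (of_real K * theta q (- 1)))"
    using K(1) th by (intro tendsto_Re tendsto_divide K) auto
  moreover have "Re ((of_real K * theta q 1) / (of_real K * theta q (- 1))) = theta_quot q 1"
    unfolding th theta_quot_def using K(1) by simp
  moreover have "Re (jtp_prod q N 1 / jtp_prod q N (- 1)) = (\<Prod>n<N. (r n)\<^sup>2)" for N
  proof -
    have "jtp_prod q N 1 / jtp_prod q N (- 1) = of_real (\<Prod>n<N. (r n)\<^sup>2)"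
      unfolding jtp_prod_def prod_dividef[symmetric] of_real_prod r_def by (simp add: power2_eq_square)
    then show ?thesis by (simp only: Re_complex_of_real)
  qed
  ultimately have "(\<lambda>N. \<Prod>n<N. (r n)\<^sup>2) \<longlonglongrightarrow> theta_quot q 1" by simp
  then have "(\<lambda>N. ln (\<Prod>n<N. (r n)\<^sup>2)) \<longlonglongrightarrow> ln (theta_quot q 1)"
    using theta_quot_bounds(1)[OF assms, of 1] by (intro tendsto_ln) auto
  moreover have "ln (\<Prod>n<N. (r n)\<^sup>2) = (\<Sum>n<N. 2 * ln (r n))" for N
    using rpos by (subst ln_prod) (auto simp: ln_realpow less_imp_neq[symmetric])
  ultimately have lim: "(\<lambda>N. \<Sum>n<N. 2 * ln (r n)) \<longlonglongrightarrow> ln (theta_quot q 1)" by simp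
  have "(\<lambda>N. \<Sum>j<J. (\<Sum>n<N. q ^ (2 * j + 1) * (q ^ (2 * (2 * j + 1))) ^ n) / real (2 * j + 1))
      \<longlonglongrightarrow> (\<Sum>j<J. q ^ (2 * j + 1) * (1 / (1 - q ^ (2 * (2 * j + 1)))) / real (2 * j + 1))"
  proof (intro tendsto_sum tendsto_divide tendsto_const)
    fix j
    have "2 * (2 * j + 1) = Suc (4 * j + 1)" by simp
    then have "norm (q ^ (2 * (2 * j + 1))) < 1"
      using power_Suc_less_one[OF assms, of "4 * j + 1"] zero_less_power[OF assms(1), of "Suc (4 * j + 1)"]
      by (simp only: real_norm_def abs_of_pos)
    from sums_mult[OF geometric_sums[OF this], of "q ^ (2 * j + 1)"]
    show "(\<lambda>N. \<Sum>n<N. q ^ (2 * j + 1) * (q ^ (2 * (2 * j + 1))) ^ n) \<longlonglongrightarrow> q ^ (2 * j + 1) * (1 / (1 - q ^ (2 * (2 * j + 1))))"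
      by (simp only: sums_def)
  qed auto
  then have lim2: "(\<lambda>N. 4 * (\<Sum>j<J. (\<Sum>n<N. q ^ (2 * j + 1) * (q ^ (2 * (2 * j + 1))) ^ n) / real (2 * j + 1)))
     \<longlonglongrightarrow> 4 * (\<Sum>j<J. q ^ (2 * j + 1) * (1 / (1 - q ^ (2 * (2 * j + 1)))) / real (2 * j + 1))"
    by (intro tendsto_mult tendsto_const)
  have "4 * (\<Sum>j<J. (\<Sum>n<N. q ^ (2 * j + 1) * (q ^ (2 * (2 * j + 1))) ^ n) / real (2 * j + 1)) \<le> (\<Sum>n<N. 2 * ln (r n))" for N
  proof -
    have "4 * (\<Sum>j<J. (\<Sum>n<N. q ^ (2 * j + 1) * (q ^ (2 * (2 * j + 1))) ^ n) / real (2 * j + 1))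
       = (\<Sum>n<N. 2 * (2 * (\<Sum>j<J. (q ^ (2 * n + 1)) ^ (2 * j + 1) / real (2 * j + 1))))"
    proof -
      have e: "q ^ (2 * j + 1) * (q ^ (2 * (2 * j + 1))) ^ n = (q ^ (2 * n + 1)) ^ (2 * j + 1)" for j n
        unfolding power_mult[symmetric] power_add[symmetric] by (rule arg_cong[where f = "\<lambda>k. q ^ k"]) (simp add: algebra_simps)
      show ?thesis
        unfolding e sum_divide_distrib sum_distrib_left by (subst sum.swap) simp
    qed
    also have "\<dots> \<le> (\<Sum>n<N. 2 * ln (r n))"
      unfolding r_def using ob by (intro sum_mono mult_left_mono ln_ratio_ge) auto
    finally show ?thesis .
  qed
  then have "4 * (\<Sum>j<J. q ^ (2 * j + 1) * (1 / (1 - q ^ (2 * (2 * j + 1)))) / real (2 * j + 1)) \<le> ln (theta_quot q 1)"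
    by (intro LIMSEQ_le[OF lim2 lim]) auto
  then show ?thesis by simp
qed

text \<open>The even terms of the Basel series contribute a quarter of it.\<close>

lemma odd_inverse_squares_sums: "(\<lambda>j. 1 / (real (2 * j + 1))\<^sup>2) sums (pi\<^sup>2 / 8)"
proof -
  define g where "g = (\<lambda>n. 1 / (real n + 1)\<^sup>2)"
  have s: "g sums (pi\<^sup>2 / 6)" using inverse_squares_sums by (simp add: g_def add.commute)
  have "(\<lambda>n. sum g {n * 2..<n * 2 + 2}) sums (pi\<^sup>2 / 6)"
    by (rule sums_group[OF s]) simp
  moreover have "sum g {n * 2..<n * 2 + 2} = g (2 * n) + g (2 * n + 1)" for n
    by (simp add: numeral_2_eq_2 mult.commute)
  ultimately have "(\<lambda>n. g (2 * n) + g (2 * n + 1)) sums (pi\<^sup>2 / 6)" by simp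
  moreover have "(\<lambda>n. g (2 * n + 1)) sums (1 / 4 * (pi\<^sup>2 / 6))"
  proof -
    have "g (2 * n + 1) = 1 / 4 * g n" for n
    proof -
      have "(real (2 * n + 1) + 1)\<^sup>2 = 4 * (real n + 1)\<^sup>2" by (simp add: power2_eq_square algebra_simps)
      then show ?thesis by (simp add: g_def)
    qed
    then show ?thesis using sums_mult[OF s, of "1 / 4"] by (simp only:)
  qed
  ultimately have "(\<lambda>n. (g (2 * n) + g (2 * n + 1)) - g (2 * n + 1)) sums (pi\<^sup>2 / 6 - 1 / 4 * (pi\<^sup>2 / 6))"
    by (rule sums_diff)
  then show ?thesis by (simp add: g_def add.commute)
qed

text \<open>Halving \<open>t\<close> at most doubles \<open>ln (2 b(t))\<close>, so
  \<open>t * ln (2 b(t))\<close> can only decrease along \<open>c, c/2, c/4, ...\<close>; its value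
  at \<open>c\<close> is therefore at least any lower bound for the limit, which is
  \<open>pi^2 / 4\<close>.\<close>

theorem theta_quot_ge:
  assumes "0 < c"
  shows "exp (pi\<^sup>2 / (4 * c)) \<le> 2 * theta_quot (exp (- c)) 1"
proof -
  define b where "b = (\<lambda>t. theta_quot (exp (- t)) 1)"
  have qb: "0 < exp (- t)" "exp (- t) < 1" if "0 < t" for t :: real using that by auto
  have bpos: "0 < b t" if "0 < t" for t unfolding b_def using theta_quot_bounds(1)[OF qb[OF that], of 1] by simp
  \<comment> \<open>The 2 of the Landen inequality is absorbed by measuring \<open>2 b\<close>
    instead of \<open>b\<close>: it becomes \<open>2 b(t/2) \<le> (2 b(t))^2\<close>.\<close>
  have step: "ln (2 * b (t / 2)) \<le> 2 * ln (2 * b t)" if t: "0 < t" for t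
  proof -
    have "(exp (- (t / 2)))\<^sup>2 = exp (- t)" by (simp flip: exp_of_nat_mult)
    then have "b (t / 2) \<le> 2 * (b t)\<^sup>2"
      unfolding b_def using theta_quot_square[OF qb[of "t / 2"]] t by simp
    then have "2 * b (t / 2) \<le> (2 * b t)\<^sup>2" by (simp add: power_mult_distrib)
    then have "ln (2 * b (t / 2)) \<le> ln ((2 * b t)\<^sup>2)"
      using bpos[of "t / 2"] bpos[OF t] t by (subst ln_le_cancel_iff) auto
    also have "\<dots> = 2 * ln (2 * b t)" using bpos[OF t] by (subst ln_realpow) auto
    finally show ?thesis .
  qed
  have iter: "ln (2 * b (c / 2 ^ n)) \<le> 2 ^ n * ln (2 * b c)" for n
  proof (induction n)
    case (Suc n)
    have "ln (2 * b (c / 2 ^ n / 2)) \<le> 2 * ln (2 * b (c / 2 ^ n))" by (rule step) (use assms in simp)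
    also have "\<dots> \<le> 2 * (2 ^ n * ln (2 * b c))" using Suc by (intro mult_left_mono) auto
    also have "\<dots> = 2 ^ Suc n * ln (2 * b c)" by (simp only: power_Suc mult.assoc)
    finally show ?case by (simp only: power_Suc2 divide_divide_eq_left)
  qed simp
  \<comment> \<open>For fixed \<open>J\<close> the bound at \<open>t = c / 2^n\<close> is scaled by
    \<open>2^(-n)\<close>; since \<open>s / (1 - exp (- 2 l c s))\<close> tends to
    \<open>1 / (2 l c)\<close> as \<open>s\<close> tends to 0, every term has a finite
    limit.\<close>
  have main: "4 * (\<Sum>j<J. 1 / (2 * c) * (1 / (real (2 * j + 1))\<^sup>2)) \<le> ln (2 * b c)" for J
  proof -
    have lim: "(\<lambda>n. 4 * (\<Sum>j<J. (1 / 2 ^ n) * (exp (- (real (2 * j + 1) * (c / 2 ^ n))) / (1 - exp (- (2 * real (2 * j + 1) * (c / 2 ^ n))))) / real (2 * j + 1)))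
       \<longlonglongrightarrow> 4 * (\<Sum>j<J. 1 / (2 * real (2 * j + 1) * c) / real (2 * j + 1))"
    proof (intro tendsto_mult tendsto_const tendsto_sum tendsto_divide)
      fix j
      define l where "l = real (2 * j + 1)"
      have l: "0 < l" by (simp add: l_def)
      have lim0: "((\<lambda>s. s * (exp (- (l * (c * s))) / (1 - exp (- (2 * l * (c * s)))))) \<longlongrightarrow> inverse l * inverse c / 2) (at_right 0)"
        using l assms by real_asymp
      have fl: "filterlim (\<lambda>n. 1 / 2 ^ n :: real) (at_right 0) sequentially"
        by real_asymp
      have "inverse l * inverse c / 2 = 1 / (2 * l * c)" by (simp add: field_simps)
      with filterlim_compose[OF lim0 fl]
      show "(\<lambda>n. 1 / 2 ^ n * (exp (- (real (2 * j + 1) * (c / 2 ^ n))) / (1 - exp (- (2 * real (2 * j + 1) * (c / 2 ^ n))))))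
        \<longlonglongrightarrow> 1 / (2 * real (2 * j + 1) * c)"
        unfolding l_def[symmetric] by simp
    qed auto
    have "4 * (\<Sum>j<J. (1 / 2 ^ n) * (exp (- (real (2 * j + 1) * (c / 2 ^ n))) / (1 - exp (- (2 * real (2 * j + 1) * (c / 2 ^ n))))) / real (2 * j + 1)) \<le> ln (2 * b c)" for n
    proof -
      define t where "t = c / 2 ^ n"
      have t: "0 < t" using assms by (simp add: t_def)
      have e: "exp (- t) ^ m = exp (- (real m * t))" for m by (simp flip: exp_of_nat_mult)
      have "4 * (\<Sum>j<J. exp (- (real (2 * j + 1) * t)) / (1 - exp (- (real (2 * (2 * j + 1)) * t))) / real (2 * j + 1)) \<le> ln (b t)"
        using ln_theta_quot_ge[OF qb[OF t], of J] unfolding e b_def .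
      also have "\<dots> \<le> ln (2 * b t)" using bpos[OF t] by simp
      also have "\<dots> \<le> 2 ^ n * ln (2 * b c)" using iter[of n] by (simp add: t_def)
      finally have "1 / 2 ^ n * (4 * (\<Sum>j<J. exp (- (real (2 * j + 1) * t)) / (1 - exp (- (real (2 * (2 * j + 1)) * t))) / real (2 * j + 1)))
         \<le> 1 / 2 ^ n * (2 ^ n * ln (2 * b c))"
        by (intro mult_left_mono) auto
      then show ?thesis by (simp add: sum_distrib_left t_def mult.left_commute mult.assoc)
    qed
    then have "4 * (\<Sum>j<J. 1 / (2 * real (2 * j + 1) * c) / real (2 * j + 1)) \<le> ln (2 * b c)"
      by (intro LIMSEQ_le_const2[OF lim]) blast
    moreover have "1 / (2 * real (2 * j + 1) * c) / real (2 * j + 1) = 1 / (2 * c) * (1 / (real (2 * j + 1))\<^sup>2)" for j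
      by (simp add: power2_eq_square)
    ultimately show ?thesis by (simp only:)
  qed
  \<comment> \<open>Only now \<open>J\<close> tends to infinity; the constant is
    \<open>4 / (2c) * pi^2 / 8 = pi^2 / (4c)\<close>.\<close>
  have "(\<lambda>J. \<Sum>j<J. 1 / (real (2 * j + 1))\<^sup>2) \<longlonglongrightarrow> pi\<^sup>2 / 8"
    using odd_inverse_squares_sums unfolding sums_def .
  then have "(\<lambda>J. 4 * (1 / (2 * c) * (\<Sum>j<J. 1 / (real (2 * j + 1))\<^sup>2))) \<longlonglongrightarrow> 4 * (1 / (2 * c) * (pi\<^sup>2 / 8))"
    by (intro tendsto_mult tendsto_const)
  then have "4 * (1 / (2 * c) * (pi\<^sup>2 / 8)) \<le> ln (2 * b c)"
    using main unfolding sum_distrib_left[symmetric] by (intro LIMSEQ_le_const2) auto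
  then have "pi\<^sup>2 / (4 * c) \<le> ln (2 * b c)" by simp
  then show ?thesis using bpos[OF assms] by (subst (asm) ln_ge_iff) (auto simp: b_def)
qed

section \<open>Zolotarev's problem for two arcs\<close>

lemma infinite_cis_image:
  assumes "x < y" "y - x < 2 * pi"
  shows "infinite (cis ` {x..y})"
proof
  assume "finite (cis ` {x..y})"
  moreover have "inj_on cis {x..y}"
  proof (rule inj_onI)
    fix s t assume st: "s \<in> {x..y}" "t \<in> {x..y}" "cis s = cis t"
    then have "sin s = sin t \<and> cos s = cos t" by (simp add: complex_eq_iff)
    then obtain i :: int where i: "s = t + 2 * pi * of_int i" using sin_cos_eq_iff[of s t] by auto
    have "\<bar>2 * pi * of_int i\<bar> < 2 * pi" using i st assms by auto
    then have "\<bar>of_int i :: real\<bar> < 1" by (simp add: abs_mult)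
    then have "i = 0" by simp
    then show "s = t" using i by simp
  qed
  ultimately have "finite {x..y}" by (rule finite_imageD)
  then show False using assms infinite_Icc by blast
qed

lemma scaled_pi_less: "0 < n \<Longrightarrow> x < n \<Longrightarrow> pi / n * x < pi" for n x :: real
  using mult_strict_left_mono[of "x / n" 1 pi] by simp

lemma infinite_row_arc:
  assumes "2 * m \<le> n" "2 \<le> m"
  shows "infinite (row_arc n t m)"
proof (rule infinite_super)
  let ?x = "arc_center n t m + pi / real n * (real m + 1)"
  let ?y = "arc_center n t m + (2 * pi - pi / real n * (real m + 1))"
  have n: "0 < real n" using assms by simp
  show "infinite (cis ` {?x..?y})"
  proof (rule infinite_cis_image)
    have "real m + 1 < real n" using assms by linarith
    then have "pi / real n * (real m + 1) < pi" by (rule scaled_pi_less[OF n])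
    then show "?x < ?y" by simp
    have "0 < pi / real n * (real m + 1)" using n by (simp add: add_nonneg_pos)
    then show "?y - ?x < 2 * pi" by simp
  qed
  show "cis ` {?x..?y} \<subseteq> row_arc n t m"
  proof
    fix z assume "z \<in> cis ` {?x..?y}"
    then obtain s where "s \<in> {?x..?y}" "z = cis s" by blast
    then show "z \<in> row_arc n t m"
      unfolding row_arc_def by (intro CollectI exI[of _ "s - arc_center n t m"]) auto
  qed
qed

text \<open>For \<open>m = 1\<close> this arc is a single point. Blocks of size at least 2 give an
  infinite arc, on which no nonzero polynomial vanishes identically.\<close>

lemma infinite_col_arc:
  assumes "2 * m \<le> n" "2 \<le> m"
  shows "infinite (col_arc n t m)"
proof (rule infinite_super)
  let ?r = "pi / real n * (real m - 1)"
  let ?x = "arc_center n t m - ?r" and ?y = "arc_center n t m + ?r"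
  have n: "0 < real n" using assms by simp
  show "infinite (cis ` {?x..?y})"
  proof (rule infinite_cis_image)
    have "real m - 1 < real n" using assms by linarith
    then have "?r < pi" by (rule scaled_pi_less[OF n])
    then show "?y - ?x < 2 * pi" by simp
    have "0 < ?r" using n assms by simp
    then show "?x < ?y" by simp
  qed
  show "cis ` {?x..?y} \<subseteq> col_arc n t m"
  proof
    fix z assume "z \<in> cis ` {?x..?y}"
    then obtain s where "s \<in> {?x..?y}" "z = cis s" by blast
    then show "z \<in> col_arc n t m"
      unfolding col_arc_def by (intro CollectI exI[of _ "s - arc_center n t m"]) auto
  qed
qed

text \<open>The assumption concerns the resultant: eliminating the variable shows that every common
  divisor divides this nonzero constant.\<close>

lemma coprime_linear_poly:
  fixes a b c d :: "'a :: field"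
  assumes "a * d - b * c \<noteq> 0"
  shows "coprime [:a, b:] [:c, d:]"
proof (rule coprimeI)
  fix r assume "r dvd [:a, b:]" "r dvd [:c, d:]"
  then have "r dvd Polynomial.smult d [:a, b:] - Polynomial.smult b [:c, d:]"
    by (intro dvd_diff dvd_smult)
  also have "Polynomial.smult d [:a, b:] - Polynomial.smult b [:c, d:] = [:a * d - b * c:]"
    by (simp add: mult.commute)
  finally have "r dvd [:a * d - b * c:]" .
  moreover have "is_unit [:a * d - b * c:]" using assms by (simp add: is_unit_const_poly_iff dvd_field_iff)
  ultimately show "is_unit r" by (rule dvd_trans)
qed

text \<open>Used for \<open>sin (a + b) \<le> m sin (b - a)\<close> with
  \<open>a + b = m pi / n\<close> and \<open>b - a = pi / n\<close>, which is how the block size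
  enters the geometry of the arcs.\<close>

lemma sin_mult_le:
  assumes "0 \<le> sin x"
  shows "\<bar>sin (real m * x)\<bar> \<le> real m * sin x"
proof (induction m)
  case (Suc m)
  have "real (Suc m) * x = real m * x + x" by (simp add: distrib_right)
  then have "\<bar>sin (real (Suc m) * x)\<bar> = \<bar>sin (real m * x) * cos x + cos (real m * x) * sin x\<bar>"
    by (simp only: sin_add)
  also have "\<dots> \<le> \<bar>sin (real m * x)\<bar> * \<bar>cos x\<bar> + \<bar>cos (real m * x)\<bar> * \<bar>sin x\<bar>"
    unfolding abs_mult[symmetric] by (rule abs_triangle_ineq)
  also have "\<dots> \<le> \<bar>sin (real m * x)\<bar> * 1 + 1 * \<bar>sin x\<bar>"
    by (intro add_mono mult_mono) auto
  also have "\<dots> \<le> real (Suc m) * sin x" using Suc assms by (simp add: distrib_right)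
  finally show ?case .
qed simp

text \<open>Here \<open>u\<close> stands for \<open>x / g\<close> on the column arc and for
  \<open>g / x\<close> on the row arc, where \<open>x = tan (s / 2)\<close>; one estimate serves
  both arcs.\<close>

lemma moebius_bounds:
  fixes u \<kappa> b :: real
  assumes "\<bar>u\<bar> \<le> \<kappa>" "0 \<le> \<kappa>" "\<kappa> < 1" "(1 + \<kappa>) / (1 - \<kappa>) \<le> b"
  shows "1 / b \<le> (1 - u) / (1 + u)" "(1 - u) / (1 + u) \<le> b"
proof -
  have b: "0 < b" using assms by (smt (verit) divide_pos_pos)
  have u: "0 < 1 + u" "0 < 1 - u" using assms by auto
  have *: "1 + \<kappa> \<le> b * (1 - \<kappa>)" using assms by (simp add: pos_divide_le_eq)
  have "b * (1 - \<kappa>) \<le> b * (1 + u)" "b * (1 - \<kappa>) \<le> b * (1 - u)" using assms b by (auto intro!: mult_left_mono)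
  then have "1 - u \<le> b * (1 + u)" "1 + u \<le> b * (1 - u)" using * assms by auto
  then show "1 / b \<le> (1 - u) / (1 + u)" "(1 - u) / (1 + u) \<le> b"
    using u b by (simp_all add: field_simps)
qed

text \<open>Up to the rotation by \<open>\<theta>\<close>, these linear polynomials are numerator and denominator of the Moebius
  map that corresponds to \<open>x \<mapsto> (x - g) / (x + g)\<close> for \<open>x = tan (s / 2)\<close> at the point \<open>cis (\<theta> + s)\<close>.
  If \<open>g\<^sup>2\<close> is the product of the values of \<open>x\<close> at the end points of the two arcs, the images of the arcs
  are the negatives of each other.\<close>

definition arc_num :: "real \<Rightarrow> real \<Rightarrow> complex poly" where
  "arc_num \<theta> g = [:\<i> - of_real g, - (\<i> + of_real g) * cis (- \<theta>):]"

definition arc_den :: "real \<Rightarrow> real \<Rightarrow> complex poly" where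
  "arc_den \<theta> g = [:\<i> + of_real g, (of_real g - \<i>) * cis (- \<theta>):]"

lemma poly_arc:
  "poly (arc_num \<theta> g) (cis (\<theta> + s)) = 2 * cis (s / 2) * of_real (sin (s / 2) - g * cos (s / 2))"
  "poly (arc_den \<theta> g) (cis (\<theta> + s)) = 2 * cis (s / 2) * of_real (sin (s / 2) + g * cos (s / 2))"
proof -
  define h where "h = s / 2"
  have e: "cis (- \<theta>) * cis (\<theta> + s) = cis h * cis h" by (simp add: cis_mult h_def)
  have n1: "cis h * cnj (cis h) = 1" by (simp add: cis_cnj cis_mult)
  have s: "of_real (sin h) = (cis h - cnj (cis h)) / (2 * \<i>)" "of_real (cos h) = (cis h + cnj (cis h)) / 2"
    by (simp_all add: complex_eq_iff)
  have "poly (arc_num \<theta> g) (cis (\<theta> + s)) = (\<i> - of_real g) - (\<i> + of_real g) * (cis h * cis h)"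
    unfolding arc_num_def e[symmetric] by (simp add: algebra_simps)
  also have "\<dots> = (\<i> - of_real g) * (cis h * cnj (cis h)) - (\<i> + of_real g) * (cis h * cis h)"
    unfolding n1 by simp
  also have "\<dots> = 2 * cis h * of_real (sin h - g * cos h)"
    unfolding of_real_diff of_real_mult s by (simp add: field_simps)
  finally show "poly (arc_num \<theta> g) (cis (\<theta> + s)) = 2 * cis (s / 2) * of_real (sin (s / 2) - g * cos (s / 2))"
    by (simp add: h_def)
  have "poly (arc_den \<theta> g) (cis (\<theta> + s)) = (\<i> + of_real g) + (of_real g - \<i>) * (cis h * cis h)"
    unfolding arc_den_def e[symmetric] by (simp add: algebra_simps)
  also have "\<dots> = (\<i> + of_real g) * (cis h * cnj (cis h)) + (of_real g - \<i>) * (cis h * cis h)"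
    unfolding n1 by simp
  also have "\<dots> = 2 * cis h * of_real (sin h + g * cos h)"
    unfolding of_real_add of_real_mult s by (simp add: field_simps)
  finally show "poly (arc_den \<theta> g) (cis (\<theta> + s)) = 2 * cis (s / 2) * of_real (sin (s / 2) + g * cos (s / 2))"
    by (simp add: h_def)
qed

text \<open>Numerator of the Moebius map plus \<open>d\<close>: it vanishes where the map takes the
  value \<open>- d\<close>.\<close>

definition arc_factor :: "real \<Rightarrow> real \<Rightarrow> real \<Rightarrow> complex poly" where
  "arc_factor \<theta> g d = arc_num \<theta> g + Polynomial.smult (of_real d) (arc_den \<theta> g)"

lemma norm_poly_arc_factor:
  "cmod (poly (arc_factor \<theta> g d) (cis (\<theta> + s)))
    = 2 * \<bar>(sin (s / 2) - g * cos (s / 2)) + d * (sin (s / 2) + g * cos (s / 2))\<bar>"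
proof -
  have "poly (arc_factor \<theta> g d) (cis (\<theta> + s))
    = 2 * cis (s / 2) * of_real ((sin (s / 2) - g * cos (s / 2)) + d * (sin (s / 2) + g * cos (s / 2)))"
    unfolding arc_factor_def poly_add poly_smult poly_arc by (simp add: algebra_simps)
  then show ?thesis by (simp only: norm_mult norm_cis norm_of_real) simp
qed

text \<open>A Moebius map cannot take two values at one point; the resultant is
  \<open>4 \<i> g (d' - d)\<close> times a unit complex number, nonzero because the map is not
  constant for \<open>g > 0\<close>.\<close>

lemma coprime_arc_factor:
  assumes "0 < g" "d \<noteq> d'"
  shows "coprime (arc_factor \<theta> g d) (arc_factor \<theta> g d')"
proof -
  let ?e = "cis (- \<theta>)"
  have f1: "arc_factor \<theta> g d = [:\<i> - of_real g + of_real d * (\<i> + of_real g), (- (\<i> + of_real g) + of_real d * (of_real g - \<i>)) * ?e:]" for d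
    by (simp add: arc_factor_def arc_num_def arc_den_def algebra_simps)
  have f2: "(\<i> - of_real g + of_real d * (\<i> + of_real g)) * ((- (\<i> + of_real g) + of_real d' * (of_real g - \<i>)) * ?e)
     - ((- (\<i> + of_real g) + of_real d * (of_real g - \<i>)) * ?e) * (\<i> - of_real g + of_real d' * (\<i> + of_real g))
     = 4 * \<i> * of_real g * of_real (d' - d) * ?e"
    by (simp add: algebra_simps)
  have "4 * \<i> * of_real g * of_real (d' - d) * ?e \<noteq> 0" using assms by simp
  then show ?thesis unfolding f1 f2[symmetric] by (rule coprime_linear_poly)
qed

lemma arc_factor_nonzero: "0 < g \<Longrightarrow> arc_factor \<theta> g d \<noteq> 0"
proof
  assume g: "0 < g" and "arc_factor \<theta> g d = 0"
  then have "\<bar>(sin (s / 2) - g * cos (s / 2)) + d * (sin (s / 2) + g * cos (s / 2))\<bar> = 0" for s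
    using norm_poly_arc_factor[of \<theta> g d s] by simp
  from this[of 0] this[of pi] g show False by simp
qed

lemma degree_arc_factor: "degree (arc_factor \<theta> g d) \<le> 1"
  unfolding arc_factor_def arc_num_def arc_den_def by (intro degree_add_le) (auto intro: order_trans[OF degree_smult_le])

text \<open>The bound \<open>s\<close> is used once for the supremum over \<open>A\<close> and once
  for the infimum over \<open>B\<close>. A pole in \<open>B\<close> is allowed: there the value is
  infinity, which respects the lower bound.\<close>

lemma zolotarev_ratio_le:
  assumes "0 < s" "\<And>z. z \<in> A \<Longrightarrow> cmod (poly q z) \<noteq> 0 \<and> cmod (poly p z) \<le> s * cmod (poly q z)"
    "\<And>z. z \<in> B \<Longrightarrow> cmod (poly p z) \<noteq> 0 \<and> cmod (poly q z) \<le> s * cmod (poly p z)"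
  shows "zolotarev_ratio A B (p, q) \<le> ennreal (s * s)"
proof -
  have "(SUP z\<in>A. rational_abs p q z) \<le> ennreal s"
  proof (rule SUP_least)
    fix z assume z: "z \<in> A"
    then have "rational_abs p q z = ennreal (cmod (poly p z) / cmod (poly q z))"
      unfolding rational_abs_def using assms(2) by (intro divide_ennreal) auto
    also have "\<dots> \<le> ennreal s"
      using assms(1) assms(2)[OF z] by (intro ennreal_leI) (simp add: divide_le_eq)
    finally show "rational_abs p q z \<le> ennreal s" .
  qed
  moreover have "ennreal (1 / s) \<le> (INF z\<in>B. rational_abs p q z)"
  proof (rule INF_greatest)
    fix z assume z: "z \<in> B"
    show "ennreal (1 / s) \<le> rational_abs p q z"
    proof (cases "cmod (poly q z) = 0")
      case True then show ?thesis using assms(3)[OF z] by (simp add: rational_abs_def)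
    next
      case False
      then have "rational_abs p q z = ennreal (cmod (poly p z) / cmod (poly q z))"
        unfolding rational_abs_def by (intro divide_ennreal) auto
      moreover have "1 / s \<le> cmod (poly p z) / cmod (poly q z)"
        using False assms(1) assms(3)[OF z] by (simp add: field_simps)
      ultimately show ?thesis by (simp add: ennreal_leI)
    qed
  qed
  then have "inverse (INF z\<in>B. rational_abs p q z) \<le> ennreal s"
  proof (cases "INF z\<in>B. rational_abs p q z" rule: ennreal_cases)
    case (real r)
    assume "ennreal (1 / s) \<le> (INF z\<in>B. rational_abs p q z)"
    then have r: "1 / s \<le> r" unfolding real using real by (simp add: ennreal_le_iff)
    then have "0 < r" using assms(1) by (smt (verit) divide_pos_pos)
    then show ?thesis unfolding real using r assms(1)
      by (subst inverse_ennreal) (auto intro!: ennreal_leI simp: field_simps)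
  qed simp
  ultimately have "zolotarev_ratio A B (p, q) \<le> ennreal s * ennreal s"
    unfolding zolotarev_ratio_def fst_conv snd_conv divide_ennreal_def
    by (intro mult_mono) auto
  then show ?thesis using assms(1) by (simp add: ennreal_mult)
qed

lemma coprime_poly_no_common_root:
  fixes p q :: "'a :: field poly"
  assumes "coprime p q" "poly p z = 0"
  shows "poly q z \<noteq> 0"
proof
  assume "poly q z = 0"
  then have "is_unit [:- z, 1:]"
    using assms by (intro coprime_common_divisor[OF assms(1)]) (auto simp: poly_eq_0_iff_dvd)
  then show False by (simp add: is_unit_iff_degree)
qed

text \<open>Over the complex numbers a nonunit common divisor has a root. This reduces coprimality
  of the two products to single factors.\<close>

lemma coprime_polyI_no_common_root:
  fixes p q :: "complex poly"
  assumes "p \<noteq> 0" "\<And>z. poly p z = 0 \<Longrightarrow> poly q z \<noteq> 0"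
  shows "coprime p q"
proof (rule coprimeI, rule ccontr)
  fix r assume r: "r dvd p" "r dvd q" "\<not> is_unit r"
  then have "r \<noteq> 0" using assms(1) by auto
  then have "degree r \<noteq> 0" using r(3) by (simp add: is_unit_iff_degree)
  then obtain z where "poly r z = 0"
    using fundamental_theorem_of_algebra[of r] constant_degree[of r] by auto
  then have "poly p z = 0" "poly q z = 0" using r by (auto elim!: dvdE)
  then show False using assms(2) by blast
qed

lemma degree_prod_le_card:
  assumes "\<And>j. j < k \<Longrightarrow> degree (f j) \<le> 1"
  shows "degree (\<Prod>j<k. f j) \<le> k"
proof -
  have "degree (\<Prod>j<k. f j) \<le> (\<Sum>j<k. degree (f j))"
    using degree_prod_sum_le[of "{..<k}" f] by (simp add: comp_def)
  also have "\<dots> \<le> (\<Sum>j<k. 1)" using assms by (intro sum_mono) auto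
  finally show ?thesis by simp
qed

text \<open>Both arcs are symmetric about the axis through their midpoints, so after the Moebius map
  only the parameter \<open>\<kappa>\<close> with \<open>\<kappa>\<^sup>2 = tan a / tan b\<close> matters.\<close>

lemma zolotarev_arcs:
  assumes m: "2 \<le> m" "2 * m \<le> n" and k: "0 < k"
  obtains r where "r \<in> rational_pairs k"
    and "zolotarev_ratio (row_arc n t m) (col_arc n t m) r \<le> ennreal (4 * exp (- (real k * pi\<^sup>2 / (2 * ln (4 * real m)))))"
proof -
  define \<theta> where "\<theta> = arc_center n t m"
  \<comment> \<open>In the coordinate \<open>h = s / 2\<close> the column arc is
    \<open>\<bar>h\<bar> \<le> a\<close> and the row arc is
    \<open>b \<le> h \<le> pi - b\<close>.\<close>
  define a where "a = pi / (2 * real n) * (real m - 1)"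
  define b where "b = pi / (2 * real n) * (real m + 1)"
  define L where "L = ln (4 * real m)"
  \<comment> \<open>Chosen so that \<open>exp (pi^2 / (4 c)) = 4 m\<close>, which makes the right
    end \<open>\<beta>\<close> of the interval at least \<open>2 m\<close>.\<close>
  define c where "c = pi\<^sup>2 / (4 * L)"
  define q where "q = exp (- c)"
  define \<beta> where "\<beta> = theta_quot q 1"
  have L: "0 < L" unfolding L_def using m by simp
  have c: "0 < c" unfolding c_def using L by simp
  have q: "0 < q" "q < 1" unfolding q_def using c by auto
  have "pi\<^sup>2 / (4 * c) = L" unfolding c_def using L by simp
  then have "exp (pi\<^sup>2 / (4 * c)) = 4 * real m" using m by (simp add: L_def)
  then have \<beta>: "2 * real m \<le> \<beta>" using theta_quot_ge[OF c] by (simp add: \<beta>_def q_def)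
  have n: "0 < real n" using m by simp
  have ab: "0 < a" "a < b" "b < pi / 2"
  proof -
    show "0 < a" unfolding a_def using n m by simp
    show "a < b" unfolding a_def b_def using n by (intro mult_strict_left_mono) auto
    have "pi / real n * (real m + 1) < pi" by (rule scaled_pi_less[OF n]) (use m in linarith)
    then show "b < pi / 2" unfolding b_def by simp
  qed
  have pos: "0 < sin a" "0 < cos a" "0 < sin b" "0 < cos b"
    using ab by (auto intro!: sin_gt_zero cos_gt_zero_pi)
  \<comment> \<open>The geometric mean of \<open>tan a\<close> and \<open>tan b\<close>: then
    \<open>tan a / g = g / tan b = \<kappa>\<close>, so the two arcs get the same bound.\<close>
  define g where "g = sqrt (sin a / cos a * (sin b / cos b))"
  define \<kappa> where "\<kappa> = sqrt (sin a * cos b / (cos a * sin b))"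
  have g: "0 < g" unfolding g_def using pos by simp
  have \<kappa>0: "0 < \<kappa>" unfolding \<kappa>_def using pos by simp
  have gk: "g * \<kappa> = sin a / cos a" "\<kappa> * (sin b / cos b) = g"
  proof -
    have "g * \<kappa> = sqrt ((sin a / cos a)\<^sup>2)"
      unfolding g_def \<kappa>_def real_sqrt_mult[symmetric] using pos by (simp add: power2_eq_square field_simps)
    then show "g * \<kappa> = sin a / cos a" using pos by simp
    have "\<kappa> * (sin b / cos b) = \<kappa> * sqrt ((sin b / cos b)\<^sup>2)" using pos by simp
    also have "\<dots> = g"
      unfolding g_def \<kappa>_def real_sqrt_mult[symmetric] using pos by (simp add: power2_eq_square field_simps)
    finally show "\<kappa> * (sin b / cos b) = g" .
  qed
  have \<kappa>2: "\<kappa>\<^sup>2 = sin a * cos b / (cos a * sin b)" unfolding \<kappa>_def using pos by simp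
  have apb: "a + b = real m * (pi / real n)" "b - a = pi / real n"
    unfolding a_def b_def using n by (simp_all add: field_simps)
  have pin: "0 < pi / real n" "pi / real n < pi"
    using n m by (auto simp: field_simps)
  have sba: "0 < sin (b - a)" unfolding apb using pin by (intro sin_gt_zero)
  then have lt: "sin a * cos b < cos a * sin b" by (simp add: sin_diff algebra_simps)
  then have "\<kappa>\<^sup>2 < 1" unfolding \<kappa>2 using pos by (simp add: divide_less_eq)
  then have \<kappa>1: "\<kappa> < 1" using \<kappa>0 by (simp add: abs_square_less_1)
  have "(1 + \<kappa>\<^sup>2) / (1 - \<kappa>\<^sup>2) = (cos a * sin b + sin a * cos b) / (cos a * sin b - sin a * cos b)"
    unfolding \<kappa>2 using pos lt by (simp add: field_simps)
  also have "\<dots> = sin (a + b) / sin (b - a)" by (simp add: sin_diff sin_add algebra_simps)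
  also have "\<dots> \<le> real m"
    using sin_mult_le[of "pi / real n" m] sba unfolding apb by (simp add: divide_le_eq)
  finally have M: "(1 + \<kappa>\<^sup>2) / (1 - \<kappa>\<^sup>2) \<le> real m" .
  \<comment> \<open>Adding the reciprocal turns \<open>b'\<close> into \<open>b' + 1/b'\<close>, a
    rational function of \<open>\<kappa>^2\<close>, which is twice the quotient of sines just
    bounded by \<open>m\<close>.\<close>
  have "(1 + \<kappa>) / (1 - \<kappa>) \<le> (1 + \<kappa>) / (1 - \<kappa>) + (1 - \<kappa>) / (1 + \<kappa>)" using \<kappa>0 \<kappa>1 by simp
  also have "\<dots> = 2 * ((1 + \<kappa>\<^sup>2) / (1 - \<kappa>\<^sup>2))"
  proof -
    have "1 - \<kappa>\<^sup>2 = (1 - \<kappa>) * (1 + \<kappa>)" by (simp add: power2_eq_square algebra_simps)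
    then show ?thesis using \<kappa>0 \<kappa>1 by (simp add: field_simps power2_eq_square)
  qed
  also have "\<dots> \<le> \<beta>" using M \<beta> by linarith
  finally have \<kappa>\<beta>: "(1 + \<kappa>) / (1 - \<kappa>) \<le> \<beta>" .
  obtain d :: "nat \<Rightarrow> real" where d: "\<And>j. j < k \<Longrightarrow> 0 < d j"
    and dle: "\<And>y. 1 / \<beta> \<le> y \<Longrightarrow> y \<le> \<beta> \<Longrightarrow> (\<Prod>j<k. \<bar>y - d j\<bar> / (y + d j)) \<le> 2 * q ^ k"
    using real_zolotarev_bound[OF q k] unfolding \<beta>_def by blast
  define P where "P = (\<Prod>j<k. arc_factor \<theta> g (- d j))"
  define Q where "Q = (\<Prod>j<k. arc_factor \<theta> g (d j))"
  \<comment> \<open>Homogeneous form of the interval bound: \<open>X / Y\<close> is the value of the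
    Moebius map up to sign, and \<open>X\<close>, \<open>Y\<close> appear directly in the moduli of
    the polynomials.\<close>
  have prod_le: "(\<Prod>j<k. \<bar>X - d j * Y\<bar>) \<le> 2 * q ^ k * (\<Prod>j<k. X + d j * Y)" "0 < (\<Prod>j<k. X + d j * Y)"
    if XY: "0 < Y" "1 / \<beta> \<le> X / Y" "X / Y \<le> \<beta>" for X Y
  proof -
    have "0 < 1 / \<beta>" using \<beta> m by simp
    then have X: "0 < X" using XY by (smt (verit) divide_nonpos_pos)
    have fpos: "0 < X + d j * Y" if "j < k" for j using X XY d[OF that] by (simp add: add_pos_pos)
    show pp: "0 < (\<Prod>j<k. X + d j * Y)" using fpos by (intro prod_pos) auto
    have "(\<Prod>j<k. \<bar>X / Y - d j\<bar> / (X / Y + d j)) = (\<Prod>j<k. \<bar>X - d j * Y\<bar> / (X + d j * Y))"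
    proof (intro prod.cong refl)
      fix j assume "j \<in> {..<k}"
      have "X / Y - d j = (X - d j * Y) / Y" "X / Y + d j = (X + d j * Y) / Y"
        using XY by (simp_all add: field_simps)
      then show "\<bar>X / Y - d j\<bar> / (X / Y + d j) = \<bar>X - d j * Y\<bar> / (X + d j * Y)"
        using XY by (simp add: abs_divide)
    qed
    then have "(\<Prod>j<k. \<bar>X - d j * Y\<bar>) / (\<Prod>j<k. X + d j * Y) \<le> 2 * q ^ k"
      using dle[OF XY(2,3)] by (simp add: prod_dividef)
    then show "(\<Prod>j<k. \<bar>X - d j * Y\<bar>) \<le> 2 * q ^ k * (\<Prod>j<k. X + d j * Y)"
      using pp by (simp add: divide_le_eq)
  qed
  have polyP: "cmod (poly P (cis (\<theta> + s))) = 2 ^ k * (\<Prod>j<k. \<bar>(sin (s / 2) - g * cos (s / 2)) - d j * (sin (s / 2) + g * cos (s / 2))\<bar>)"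
    and polyQ: "cmod (poly Q (cis (\<theta> + s))) = 2 ^ k * (\<Prod>j<k. \<bar>(sin (s / 2) - g * cos (s / 2)) + d j * (sin (s / 2) + g * cos (s / 2))\<bar>)" for s
    unfolding P_def Q_def poly_prod prod_norm[symmetric] norm_poly_arc_factor prod.distrib by simp_all
  have fin: "2 ^ k * y \<noteq> 0 \<and> 2 ^ k * x \<le> 2 * q ^ k * (2 ^ k * y)" if "x \<le> 2 * q ^ k * y" "0 < y" for x y
    using that by (simp add: mult.left_commute)
  have "zolotarev_ratio (row_arc n t m) (col_arc n t m) (P, Q) \<le> ennreal ((2 * q ^ k) * (2 * q ^ k))"
  proof (rule zolotarev_ratio_le)
    show "0 < 2 * q ^ k" using q by simp
  next
    fix z assume "z \<in> row_arc n t m"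
    then obtain s where z: "z = cis (\<theta> + s)" and s: "pi / real n * (real m + 1) \<le> s" "s \<le> 2 * pi - pi / real n * (real m + 1)"
      unfolding row_arc_def \<theta>_def by blast
    define h where "h = s / 2"
    have "pi / real n * (real m + 1) = 2 * b" by (simp add: b_def)
    then have h: "b \<le> h" "h \<le> pi - b" using s by (simp_all add: h_def)
    have sh: "0 < sin h" using h ab by (intro sin_gt_zero) auto
    have "0 \<le> sin (h - b)" "0 \<le> sin (h + b)" using h ab by (auto intro!: sin_ge_zero)
    then have "\<bar>cos h * sin b\<bar> \<le> sin h * cos b" by (simp add: sin_add sin_diff abs_le_iff)
    then have "\<bar>cos h / sin h\<bar> \<le> cos b / sin b" using pos sh by (simp add: abs_mult field_simps)
    then have "g * \<bar>cos h / sin h\<bar> \<le> g * (cos b / sin b)" using g by (intro mult_left_mono) auto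
    also have "g * (cos b / sin b) = \<kappa>" using gk(2)[symmetric] pos by simp
    finally have u: "\<bar>g * (cos h / sin h)\<bar> \<le> \<kappa>" using g by (simp add: abs_mult)
    have Y: "0 < sin h + g * cos h"
    proof -
      have "0 < 1 + g * (cos h / sin h)" using u \<kappa>1 by linarith
      then have "0 < sin h * (1 + g * (cos h / sin h))" using sh by simp
      then show ?thesis using sh by (simp add: distrib_left)
    qed
    have e: "(sin h - g * cos h) / (sin h + g * cos h) = (1 - g * (cos h / sin h)) / (1 + g * (cos h / sin h))"
    proof -
      have "1 - g * (cos h / sin h) = (sin h - g * cos h) / sin h" "1 + g * (cos h / sin h) = (sin h + g * cos h) / sin h"
        using sh by (simp_all add: field_simps)
      then show ?thesis using sh by simp
    qed
    note pl = prod_le[OF Y moebius_bounds[OF u less_imp_le[OF \<kappa>0] \<kappa>1 \<kappa>\<beta>, folded e]]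
    have "\<bar>\<Prod>j<k. (sin h - g * cos h) + d j * (sin h + g * cos h)\<bar> = (\<Prod>j<k. (sin h - g * cos h) + d j * (sin h + g * cos h))"
      using pl(2) by simp
    then have ab: "(\<Prod>j<k. \<bar>(sin h - g * cos h) + d j * (sin h + g * cos h)\<bar>) = (\<Prod>j<k. (sin h - g * cos h) + d j * (sin h + g * cos h))"
      by (simp only: abs_prod)
    show "cmod (poly Q z) \<noteq> 0 \<and> cmod (poly P z) \<le> 2 * q ^ k * cmod (poly Q z)"
      unfolding z polyP polyQ h_def[symmetric] ab by (rule fin[OF pl])
  next
    fix z assume "z \<in> col_arc n t m"
    then obtain s where z: "z = cis (\<theta> + s)" and s: "\<bar>s\<bar> \<le> pi / real n * (real m - 1)"
      unfolding col_arc_def \<theta>_def by blast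
    define h where "h = s / 2"
    have "pi / real n * (real m - 1) = 2 * a" by (simp add: a_def)
    then have h: "- a \<le> h" "h \<le> a" using s by (simp_all add: h_def abs_le_iff)
    have ch: "0 < cos h" using h ab by (intro cos_gt_zero_pi) auto
    have "0 \<le> sin (a - h)" "0 \<le> sin (a + h)" using h ab by (auto intro!: sin_ge_zero)
    then have "\<bar>sin h * cos a\<bar> \<le> cos h * sin a" by (simp add: sin_add sin_diff abs_le_iff mult.commute)
    then have "\<bar>sin h / cos h\<bar> \<le> sin a / cos a" using pos ch by (simp add: abs_mult field_simps)
    then have "\<bar>sin h / cos h\<bar> / g \<le> (sin a / cos a) / g" using g by (intro divide_right_mono) auto
    also have "(sin a / cos a) / g = \<kappa>" using gk(1)[symmetric] g by simp
    finally have u: "\<bar>sin h / (g * cos h)\<bar> \<le> \<kappa>" using g by (simp add: abs_mult mult.commute)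
    have gc: "0 < g * cos h" using g ch by simp
    have Y: "0 < g * cos h + sin h"
    proof -
      have "0 < 1 + sin h / (g * cos h)" using u \<kappa>1 by linarith
      then have "0 < (g * cos h) * (1 + sin h / (g * cos h))" using gc by (rule mult_pos_pos[rotated])
      then show ?thesis using g ch by (simp add: distrib_left)
    qed
    have e: "(g * cos h - sin h) / (g * cos h + sin h) = (1 - sin h / (g * cos h)) / (1 + sin h / (g * cos h))"
    proof -
      have "1 - sin h / (g * cos h) = (g * cos h - sin h) / (g * cos h)" "1 + sin h / (g * cos h) = (g * cos h + sin h) / (g * cos h)"
        using g ch by (simp_all add: field_simps)
      then show ?thesis using g ch by simp
    qed
    note pl = prod_le[OF Y moebius_bounds[OF u less_imp_le[OF \<kappa>0] \<kappa>1 \<kappa>\<beta>, folded e]]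
    \<comment> \<open>On the column arc the Moebius map has the value \<open>- X / Y\<close>, so
      \<open>P\<close> and \<open>Q\<close> exchange their roles.\<close>
    have e1: "\<bar>(sin h - g * cos h) + d j * (sin h + g * cos h)\<bar> = \<bar>(g * cos h - sin h) - d j * (g * cos h + sin h)\<bar>" for j
      by (simp add: abs_if algebra_simps)
    have e2: "\<bar>(sin h - g * cos h) - d j * (sin h + g * cos h)\<bar> = \<bar>(g * cos h - sin h) + d j * (g * cos h + sin h)\<bar>" for j
      by (simp add: abs_if algebra_simps)
    have "\<bar>\<Prod>j<k. (g * cos h - sin h) + d j * (g * cos h + sin h)\<bar> = (\<Prod>j<k. (g * cos h - sin h) + d j * (g * cos h + sin h))"
      using pl(2) by simp
    then have ab: "(\<Prod>j<k. \<bar>(g * cos h - sin h) + d j * (g * cos h + sin h)\<bar>) = (\<Prod>j<k. (g * cos h - sin h) + d j * (g * cos h + sin h))"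
      by (simp only: abs_prod)
    show "cmod (poly P z) \<noteq> 0 \<and> cmod (poly Q z) \<le> 2 * q ^ k * cmod (poly P z)"
      unfolding z polyP polyQ h_def[symmetric] e1 e2 ab by (rule fin[OF pl])
  qed
  moreover have "(2 * q ^ k) * (2 * q ^ k) = 4 * exp (- (real k * pi\<^sup>2 / (2 * ln (4 * real m))))"
  proof -
    have "q ^ k * q ^ k = exp (real k * - c + real k * - c)" by (simp only: exp_add exp_of_nat_mult q_def)
    also have "real k * - c + real k * - c = - (real k * pi\<^sup>2 / (2 * L))" using L by (simp add: c_def field_simps)
    finally show ?thesis by (simp add: L_def)
  qed
  moreover have "(P, Q) \<in> rational_pairs k"
  proof -
    have "P \<noteq> 0" "Q \<noteq> 0" unfolding P_def Q_def using arc_factor_nonzero[OF g] by auto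
    moreover have "degree P \<le> k" "degree Q \<le> k"
      unfolding P_def Q_def by (auto intro!: degree_prod_le_card degree_arc_factor)
    moreover have "coprime P Q"
      unfolding P_def Q_def
    proof (rule coprime_polyI_no_common_root)
      show "(\<Prod>j<k. arc_factor \<theta> g (- d j)) \<noteq> 0" using arc_factor_nonzero[OF g] by auto
      fix z assume "poly (\<Prod>j<k. arc_factor \<theta> g (- d j)) z = 0"
      then obtain i where i: "i < k" "poly (arc_factor \<theta> g (- d i)) z = 0"
        unfolding poly_prod by (auto simp: prod_zero_iff)
      have "poly (arc_factor \<theta> g (d j)) z \<noteq> 0" if "j < k" for j
        using d[OF i(1)] d[OF that] by (intro coprime_poly_no_common_root[OF coprime_arc_factor[OF g] i(2)]) auto
      then show "poly (\<Prod>j<k. arc_factor \<theta> g (d j)) z \<noteq> 0"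
        unfolding poly_prod by (auto simp: prod_zero_iff)
    qed
    ultimately show ?thesis by (simp add: rational_pairs_def)
  qed
  ultimately show thesis using that by simp
qed

lemma infinite_not_all_roots:
  fixes p :: "complex poly"
  assumes "infinite A" "p \<noteq> 0"
  obtains z where "z \<in> A" "poly p z \<noteq> 0"
  using assms poly_roots_finite[OF assms(2)] finite_subset[of A "{z. poly p z = 0}"] by blast

text \<open>Any competitor \<open>r\<close> bounds the optimal ratio. A finite optimum excludes
  poles on \<open>A\<close> and zeros on \<open>B\<close>, and the leading coefficients cancel
  between the values at \<open>z\<close> and \<open>w\<close>; coprimality separates zeros from
  poles.\<close>

lemma zolotarev_shifts_bound:
  assumes shifts: "zolotarev_shifts A B k \<tau> \<nu>" and inf: "infinite A" "infinite B"
    and r: "r \<in> rational_pairs k" "zolotarev_ratio A B r \<le> ennreal \<epsilon>" and \<epsilon>: "0 \<le> \<epsilon>"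
  shows "j < k \<Longrightarrow> \<tau> j \<noteq> \<nu> j" and "z \<in> A \<Longrightarrow> j < k \<Longrightarrow> z \<noteq> \<nu> j" and "w \<in> B \<Longrightarrow> j < k \<Longrightarrow> w \<noteq> \<tau> j"
    and "z \<in> A \<Longrightarrow> w \<in> B \<Longrightarrow> cmod (\<Prod>j<k. (z - \<tau> j) / (z - \<nu> j) * ((w - \<nu> j) / (w - \<tau> j))) \<le> \<epsilon>"
proof -
  obtain p q where pq: "(p, q) \<in> rational_pairs k"
    and opt: "\<And>r. r \<in> rational_pairs k \<Longrightarrow> zolotarev_ratio A B (p, q) \<le> zolotarev_ratio A B r"
    and p: "p = Polynomial.smult (lead_coeff p) (\<Prod>j<k. [:- \<tau> j, 1:])"
    and q: "q = Polynomial.smult (lead_coeff q) (\<Prod>j<k. [:- \<nu> j, 1:])"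
    using shifts unfolding zolotarev_shifts_def by blast
  have nz: "p \<noteq> 0" "q \<noteq> 0" and cop: "coprime p q" using pq by (auto simp: rational_pairs_def)
  define a where "a = lead_coeff p" define b where "b = lead_coeff q"
  have ab: "a \<noteq> 0" "b \<noteq> 0" using nz by (auto simp: a_def b_def)
  have pz: "poly p z = a * (\<Prod>j<k. z - \<tau> j)" for z by (subst p) (simp add: poly_prod a_def)
  have qz: "poly q z = b * (\<Prod>j<k. z - \<nu> j)" for z by (subst q) (simp add: poly_prod b_def)
  define S where "S = (SUP z\<in>A. rational_abs p q z)"
  define I where "I = (INF z\<in>B. rational_abs p q z)"
  have le: "S / I \<le> ennreal \<epsilon>"
    using opt[OF r(1)] r(2) by (simp add: S_def I_def zolotarev_ratio_def)
  have top: "rational_abs p q z = Orderings.top" if "poly q z = 0" for z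
  proof -
    have "poly p z \<noteq> 0" using coprime_poly_no_common_root[OF cop] that by blast
    then show ?thesis using that by (simp add: rational_abs_def ennreal_eq_0_iff)
  qed
  have fin: "rational_abs p q z = ennreal (cmod (poly p z) / cmod (poly q z))" if "poly q z \<noteq> 0" for z
    unfolding rational_abs_def using that by (intro divide_ennreal) auto
  \<comment> \<open>If \<open>S = 0\<close> or \<open>I\<close> were infinite, a finite ratio would
    say nothing about \<open>I\<close> or \<open>S\<close>. Each of the infinite arcs contains
    points that exclude this.\<close>
  have S0: "0 < S"
  proof -
    obtain z where z: "z \<in> A" "poly (p * q) z \<noteq> 0" using infinite_not_all_roots[OF inf(1), of "p * q"] nz by auto
    then have "0 < rational_abs p q z" by (subst fin) auto
    also have "\<dots> \<le> S" unfolding S_def by (rule SUP_upper[OF z(1)])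
    finally show ?thesis .
  qed
  have Itop: "I < Orderings.top"
  proof -
    obtain z where z: "z \<in> B" "poly q z \<noteq> 0" using infinite_not_all_roots[OF inf(2) nz(2)] by blast
    have "I \<le> rational_abs p q z" unfolding I_def by (rule INF_lower[OF z(1)])
    also have "\<dots> < Orderings.top" by (subst fin[OF z(2)]) simp
    finally show ?thesis .
  qed
  have "S / I \<noteq> Orderings.top" using le by (auto simp: top_unique)
  then have I0: "I \<noteq> 0" and Stop: "S \<noteq> Orderings.top"
    using S0 Itop by (auto simp: ennreal_divide_eq_top_iff)
  have A: "poly q z \<noteq> 0" if "z \<in> A" for z
  proof
    assume "poly q z = 0"
    then have "rational_abs p q z = Orderings.top" by (rule top)
    moreover have "rational_abs p q z \<le> S" unfolding S_def by (rule SUP_upper[OF that])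
    ultimately show False using Stop by (simp add: top_unique)
  qed
  have B: "poly p w \<noteq> 0" if "w \<in> B" for w
  proof
    assume "poly p w = 0"
    then have "rational_abs p q w = 0"
      using coprime_poly_no_common_root[OF cop] by (subst fin) auto
    moreover have "I \<le> rational_abs p q w" unfolding I_def by (rule INF_lower[OF that])
    ultimately show False using I0 by simp
  qed
  show "\<tau> j \<noteq> \<nu> j" if j: "j < k"
  proof
    assume "\<tau> j = \<nu> j"
    moreover have "poly p (\<tau> j) = 0" "poly q (\<nu> j) = 0"
      unfolding pz qz using j by (auto intro!: prod_zero)
    ultimately show False using coprime_poly_no_common_root[OF cop, of "\<tau> j"] by simp
  qed
  show zA: "z \<noteq> \<nu> j" if "z \<in> A" "j < k" for z
    using A[OF that(1)] that(2) unfolding qz by auto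
  show wB: "w \<noteq> \<tau> j" if "w \<in> B" "j < k" for w
    using B[OF that(1)] that(2) unfolding pz by auto
  show "cmod (\<Prod>j<k. (z - \<tau> j) / (z - \<nu> j) * ((w - \<nu> j) / (w - \<tau> j))) \<le> \<epsilon>" if z: "z \<in> A" and w: "w \<in> B"
  proof (cases "poly q w = 0")
    \<comment> \<open>At a pole \<open>w\<close> some factor \<open>w - \<nu> j\<close> vanishes, so
      the product is 0; otherwise the extended reals can be left.\<close>
    case True
    then have "\<exists>j<k. w - \<nu> j = 0" using ab unfolding qz by auto
    then have "(\<Prod>j<k. (z - \<tau> j) / (z - \<nu> j) * ((w - \<nu> j) / (w - \<tau> j))) = 0"
      by (intro prod_zero) auto
    then show ?thesis using \<epsilon> by (simp only: norm_zero)
  next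
    case False
    have "S / I * I = S" unfolding ennreal_divide_times using I0 Itop by (simp add: ennreal_divide_self)
    then have "S \<le> ennreal \<epsilon> * I" using mult_right_mono[OF le, of I] by simp
    then have "rational_abs p q z \<le> ennreal \<epsilon> * rational_abs p q w"
      using SUP_upper[OF z, of "rational_abs p q"] INF_lower[OF w, of "rational_abs p q"] mult_left_mono[of I "rational_abs p q w" "ennreal \<epsilon>"]
      unfolding S_def[symmetric] I_def[symmetric] by (meson order_trans zero_le)
    then have "ennreal (cmod (poly p z) / cmod (poly q z)) \<le> ennreal (\<epsilon> * (cmod (poly p w) / cmod (poly q w)))"
      unfolding fin[OF A[OF z]] fin[OF False] by (subst ennreal_mult) (use \<epsilon> in auto)
    then have le': "cmod (poly p z) / cmod (poly q z) \<le> \<epsilon> * (cmod (poly p w) / cmod (poly q w))"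
      using \<epsilon> by (subst (asm) ennreal_le_iff) auto
    have "(\<Prod>j<k. (z - \<tau> j) / (z - \<nu> j) * ((w - \<nu> j) / (w - \<tau> j)))
      = poly p z / poly q z * (poly q w / poly p w)"
      unfolding pz qz prod.distrib prod_dividef using ab by simp
    then have "cmod (\<Prod>j<k. (z - \<tau> j) / (z - \<nu> j) * ((w - \<nu> j) / (w - \<tau> j)))
      = cmod (poly p z) / cmod (poly q z) * (cmod (poly q w) / cmod (poly p w))"
      by (simp only: norm_mult norm_divide)
    also have "\<dots> \<le> \<epsilon> * (cmod (poly p w) / cmod (poly q w)) * (cmod (poly q w) / cmod (poly p w))"
      using le' by (intro mult_right_mono) auto
    also have "\<dots> = \<epsilon>" using False B[OF w] by simp
    finally show ?thesis .
  qed
qed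

text \<open>\<open>num_steps\<close> is the least natural number at which this estimate is
  guaranteed, obtained by solving it for \<open>k\<close> and rounding up.\<close>

lemma num_steps_sufficient:
  assumes m: "2 \<le> m" and k: "k = num_steps n \<epsilon> m" "0 < k" and pos: "0 < \<epsilon> / log 2 (real n)"
  shows "4 * exp (- (real k * pi\<^sup>2 / (2 * ln (4 * real m)))) \<le> \<epsilon> / log 2 (real n)"
proof -
  define e where "e = \<epsilon> / log 2 (real n)"
  define L where "L = ln (4 * real m)"
  have L: "0 < L" unfolding L_def using m by simp
  have e: "0 < e" using pos by (simp add: e_def)
  have "2 / pi\<^sup>2 * L * ln (4 / e) \<le> real k"
    unfolding k num_steps_def Let_def e_def L_def by linarith
  then have "pi\<^sup>2 / (2 * L) * (2 / pi\<^sup>2 * L * ln (4 / e)) \<le> pi\<^sup>2 / (2 * L) * real k"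
    using L by (intro mult_left_mono) auto
  moreover have "pi\<^sup>2 / (2 * L) * (2 / pi\<^sup>2 * L * ln (4 / e)) = ln (4 / e)" using L by simp
  ultimately have "- (real k * pi\<^sup>2 / (2 * L)) \<le> - ln (4 / e)" by (simp add: mult.commute)
  then have "4 * exp (- (real k * pi\<^sup>2 / (2 * L))) \<le> 4 * exp (- ln (4 / e))" by simp
  also have "\<dots> = e" using e by (simp add: exp_minus)
  finally show ?thesis by (simp add: e_def L_def)
qed

section \<open>Operator norm bounds on index sets\<close>

text \<open>A spectral norm bound for the block \<open>I \<times> J\<close> in global indices.
  Vectors are functions on all naturals, so restricting to and joining blocks needs no
  reindexing.\<close>

definition op_bound :: "nat set \<Rightarrow> nat set \<Rightarrow> (nat \<Rightarrow> nat \<Rightarrow> complex) \<Rightarrow> real \<Rightarrow> bool" where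
  "op_bound I J E c \<longleftrightarrow>
     (\<forall>x. L2_set (\<lambda>i. cmod (\<Sum>j\<in>J. E i j * x j)) I \<le> c * L2_set (\<lambda>j. cmod (x j)) J)"

lemma op_boundD: "op_bound I J E c \<Longrightarrow> L2_set (\<lambda>i. cmod (\<Sum>j\<in>J. E i j * x j)) I \<le> c * L2_set (\<lambda>j. cmod (x j)) J"
  by (simp add: op_bound_def)

lemma L2_set_subset_le: "finite J \<Longrightarrow> I \<subseteq> J \<Longrightarrow> L2_set f I \<le> L2_set f J"
  unfolding L2_set_def by (intro real_sqrt_le_mono sum_mono2) auto

lemma op_bound_cong:
  assumes "op_bound I J E c" "\<And>i j. i \<in> I \<Longrightarrow> j \<in> J \<Longrightarrow> E i j = E' i j"
  shows "op_bound I J E' c"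
  unfolding op_bound_def
proof
  fix x
  have "L2_set (\<lambda>i. cmod (\<Sum>j\<in>J. E' i j * x j)) I = L2_set (\<lambda>i. cmod (\<Sum>j\<in>J. E i j * x j)) I"
    using assms(2) by (intro L2_set_cong refl arg_cong[where f = cmod] sum.cong) auto
  then show "L2_set (\<lambda>i. cmod (\<Sum>j\<in>J. E' i j * x j)) I \<le> c * L2_set (\<lambda>j. cmod (x j)) J"
    using op_boundD[OF assms(1), of x] by simp
qed

lemma op_bound_mono: "op_bound I J E c \<Longrightarrow> c \<le> c' \<Longrightarrow> op_bound I J E c'"
  unfolding op_bound_def by (meson L2_set_nonneg mult_right_mono order_trans)

lemma op_bound_subset:
  assumes "op_bound I J E c" "I' \<subseteq> I" "J' \<subseteq> J" "finite I" "finite J"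
  shows "op_bound I' J' E c"
  unfolding op_bound_def
proof
  fix x :: "nat \<Rightarrow> complex"
  define y where "y = (\<lambda>j. if j \<in> J' then x j else 0)"
  have s: "(\<Sum>j\<in>J'. E i j * x j) = (\<Sum>j\<in>J. E i j * y j)" for i
    using assms(3,5) by (intro sum.mono_neutral_cong_left) (auto simp: y_def)
  have n: "L2_set (\<lambda>j. cmod (y j)) J = L2_set (\<lambda>j. cmod (x j)) J'"
    unfolding L2_set_def using assms(3,5)
    by (intro arg_cong[where f = sqrt] sum.mono_neutral_cong_right) (auto simp: y_def)
  have "L2_set (\<lambda>i. cmod (\<Sum>j\<in>J'. E i j * x j)) I' \<le> L2_set (\<lambda>i. cmod (\<Sum>j\<in>J. E i j * y j)) I"
    unfolding s by (rule L2_set_subset_le[OF assms(4,2)])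
  also have "\<dots> \<le> c * L2_set (\<lambda>j. cmod (x j)) J'"
    using op_boundD[OF assms(1), of y] unfolding n .
  finally show "L2_set (\<lambda>i. cmod (\<Sum>j\<in>J'. E i j * x j)) I' \<le> c * L2_set (\<lambda>j. cmod (x j)) J'" .
qed

lemma L2_set_cmult: "0 \<le> a \<Longrightarrow> L2_set (\<lambda>i. a * f i) I = a * L2_set f I"
  by (simp add: L2_set_right_distrib)

text \<open>The residual of fADI has this form. The largest \<open>cmod (u i)\<close> is attained at
  some \<open>i0\<close>, so its product with each \<open>cmod (v j)\<close> is still at most
  \<open>e\<close>: splitting the bound into two diagonal scalings loses nothing.\<close>

lemma op_bound_scale:
  assumes X: "op_bound I J X c" and c: "0 \<le> c" and fin: "finite I" and e: "0 \<le> e"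
    and le: "\<And>i j. i \<in> I \<Longrightarrow> j \<in> J \<Longrightarrow> cmod (u i * v j) \<le> e"
  shows "op_bound I J (\<lambda>i j. X i j * (u i * v j)) (e * c)"
proof (cases "I = {}")
  case True
  then show ?thesis using c e by (simp add: op_bound_def L2_set_nonneg)
next
  case False
  define a where "a = Max ((\<lambda>i. cmod (u i)) ` I)"
  have "a \<in> (\<lambda>i. cmod (u i)) ` I" unfolding a_def using fin False by (intro Max_in) auto
  then obtain i0 where i0: "i0 \<in> I" "a = cmod (u i0)" by blast
  have a: "cmod (u i) \<le> a" if "i \<in> I" for i unfolding a_def using fin that by simp
  have a0: "0 \<le> a" using i0 by simp
  show ?thesis unfolding op_bound_def
  proof
    fix x :: "nat \<Rightarrow> complex"
    have "L2_set (\<lambda>i. cmod (\<Sum>j\<in>J. X i j * (u i * v j) * x j)) I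
       = L2_set (\<lambda>i. cmod (u i) * cmod (\<Sum>j\<in>J. X i j * (v j * x j))) I"
      by (intro L2_set_cong refl) (simp add: sum_distrib_left mult_ac flip: norm_mult)
    also have "\<dots> \<le> L2_set (\<lambda>i. a * cmod (\<Sum>j\<in>J. X i j * (v j * x j))) I"
      using a by (intro L2_set_mono mult_right_mono) auto
    also have "\<dots> = a * L2_set (\<lambda>i. cmod (\<Sum>j\<in>J. X i j * (v j * x j))) I" by (rule L2_set_cmult[OF a0])
    also have "\<dots> \<le> a * (c * L2_set (\<lambda>j. cmod (v j * x j)) J)"
      by (intro mult_left_mono op_boundD X a0)
    also have "\<dots> = c * L2_set (\<lambda>j. a * cmod (v j * x j)) J"
      using a0 by (simp add: L2_set_cmult mult.left_commute)
    also have "\<dots> \<le> c * L2_set (\<lambda>j. e * cmod (x j)) J"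
    proof (intro mult_left_mono L2_set_mono c)
      fix j assume "j \<in> J"
      then have "a * cmod (v j) \<le> e" using le[OF i0(1)] i0(2) by (simp add: norm_mult)
      then show "a * cmod (v j * x j) \<le> e * cmod (x j)"
        by (simp add: norm_mult mult.assoc[symmetric] mult_right_mono)
    qed (use a0 in auto)
    also have "\<dots> = e * c * L2_set (\<lambda>j. cmod (x j)) J" using e by (simp add: L2_set_cmult mult_ac)
    finally show "L2_set (\<lambda>i. cmod (\<Sum>j\<in>J. X i j * (u i * v j) * x j)) I \<le> e * c * L2_set (\<lambda>j. cmod (x j)) J" .
  qed
qed

lemma L2_set_Un: "finite I \<Longrightarrow> finite J \<Longrightarrow> I \<inter> J = {} \<Longrightarrow> (L2_set f (I \<union> J))\<^sup>2 = (L2_set f I)\<^sup>2 + (L2_set f J)\<^sup>2"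
  by (simp add: L2_set_def sum.union_disjoint sum_nonneg)

text \<open>\<open>E\<close> is split into its block diagonal part \<open>p\<close> and its
  off-diagonal part \<open>r\<close>. The norm of each part is a maximum over its two blocks, so one
  level of the tree adds \<open>d\<close> only once.\<close>

lemma op_bound_block:
  assumes fin: "finite I" "finite J" and dis: "I \<inter> J = {}" and nn: "0 \<le> a" "0 \<le> d"
    and diag: "op_bound I I E a" "op_bound J J E a" and off: "op_bound I J E d" "op_bound J I E d"
  shows "op_bound (I \<union> J) (I \<union> J) E (a + d)"
  unfolding op_bound_def
proof
  fix x :: "nat \<Rightarrow> complex"
  define p where "p = (\<lambda>i. if i \<in> I then \<Sum>j\<in>I. E i j * x j else \<Sum>j\<in>J. E i j * x j)"
  define r where "r = (\<lambda>i. if i \<in> I then \<Sum>j\<in>J. E i j * x j else \<Sum>j\<in>I. E i j * x j)"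
  let ?N = "\<lambda>S. L2_set (\<lambda>j. cmod (x j)) S"
  have split: "(\<Sum>j\<in>I \<union> J. E i j * x j) = p i + r i" for i
    by (simp add: p_def r_def sum.union_disjoint fin dis)
  have nx: "(?N (I \<union> J))\<^sup>2 = (?N I)\<^sup>2 + (?N J)\<^sup>2" by (rule L2_set_Un[OF fin dis])
  have sq: "(L2_set f S)\<^sup>2 \<le> (c * ?N S')\<^sup>2" if "L2_set f S \<le> c * ?N S'" for f S S' c
    using that by (intro power_mono) auto
  have bound: "L2_set (\<lambda>i. cmod (h i)) (I \<union> J) \<le> c * ?N (I \<union> J)"
    if "0 \<le> c" "(L2_set (\<lambda>i. cmod (h i)) I)\<^sup>2 + (L2_set (\<lambda>i. cmod (h i)) J)\<^sup>2 \<le> c\<^sup>2 * ((?N I)\<^sup>2 + (?N J)\<^sup>2)" for h c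
  proof (rule power2_le_imp_le)
    show "(L2_set (\<lambda>i. cmod (h i)) (I \<union> J))\<^sup>2 \<le> (c * ?N (I \<union> J))\<^sup>2"
      unfolding L2_set_Un[OF fin dis] power_mult_distrib nx by (rule that(2))
    show "0 \<le> c * ?N (I \<union> J)" using that(1) by (simp add: L2_set_nonneg)
  qed
  have pI: "L2_set (\<lambda>i. cmod (p i)) I \<le> a * ?N I"
    using op_boundD[OF diag(1), of x] by (simp add: p_def cong: L2_set_cong)
  have pJ: "L2_set (\<lambda>i. cmod (p i)) J \<le> a * ?N J"
  proof -
    have "L2_set (\<lambda>i. cmod (p i)) J = L2_set (\<lambda>i. cmod (\<Sum>j\<in>J. E i j * x j)) J"
      using dis by (intro L2_set_cong) (auto simp: p_def)
    then show ?thesis using op_boundD[OF diag(2), of x] by simp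
  qed
  have rI: "L2_set (\<lambda>i. cmod (r i)) I \<le> d * ?N J"
    using op_boundD[OF off(1), of x] by (simp add: r_def cong: L2_set_cong)
  have rJ: "L2_set (\<lambda>i. cmod (r i)) J \<le> d * ?N I"
  proof -
    have "L2_set (\<lambda>i. cmod (r i)) J = L2_set (\<lambda>i. cmod (\<Sum>j\<in>I. E i j * x j)) J"
      using dis by (intro L2_set_cong) (auto simp: r_def)
    then show ?thesis using op_boundD[OF off(2), of x] by simp
  qed
  have P: "L2_set (\<lambda>i. cmod (p i)) (I \<union> J) \<le> a * ?N (I \<union> J)"
    using sq[OF pI] sq[OF pJ] by (intro bound nn) (simp add: power_mult_distrib distrib_left)
  have R: "L2_set (\<lambda>i. cmod (r i)) (I \<union> J) \<le> d * ?N (I \<union> J)"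
    using sq[OF rI] sq[OF rJ] by (intro bound nn) (simp add: power_mult_distrib distrib_left)
  have "L2_set (\<lambda>i. cmod (\<Sum>j\<in>I \<union> J. E i j * x j)) (I \<union> J) \<le> L2_set (\<lambda>i. cmod (p i) + cmod (r i)) (I \<union> J)"
    unfolding split by (intro L2_set_mono norm_triangle_ineq) auto
  also have "\<dots> \<le> L2_set (\<lambda>i. cmod (p i)) (I \<union> J) + L2_set (\<lambda>i. cmod (r i)) (I \<union> J)"
    by (rule L2_set_triangle_ineq)
  also have "\<dots> \<le> (a + d) * ?N (I \<union> J)" using P R by (simp add: distrib_right)
  finally show "L2_set (\<lambda>i. cmod (\<Sum>j\<in>I \<union> J. E i j * x j)) (I \<union> J) \<le> (a + d) * ?N (I \<union> J)" .
qed

lemma euclid_norm_L2_set: "euclid_norm x = L2_set (\<lambda>i. cmod (x $ i)) {..<dim_vec x}"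
  by (simp add: euclid_norm_def L2_set_def)

lemma euclid_norm_mult_mat_vec:
  assumes "A \<in> carrier_mat m n" "x \<in> carrier_vec n"
  shows "euclid_norm (A *\<^sub>v x) = L2_set (\<lambda>i. cmod (\<Sum>j<n. A $$ (i, j) * x $ j)) {..<m}"
  unfolding euclid_norm_L2_set using assms
  by (intro L2_set_cong) (auto simp: scalar_prod_def atLeast0LessThan)

lemma L2_set_vec:
  assumes "x \<in> carrier_vec n"
  shows "euclid_norm x = L2_set (\<lambda>i. cmod (x $ i)) {..<n}"
  using assms by (simp add: euclid_norm_L2_set)

lemma euclid_norm_unit: "i < n \<Longrightarrow> euclid_norm (unit_vec n i) = 1"
proof -
  assume i: "i < n"
  have "(\<Sum>j<n. (cmod (unit_vec n i $ j))\<^sup>2) = (\<Sum>j<n. if j = i then 1 else 0)"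
    using i by (intro sum.cong) (auto simp: unit_vec_def)
  then show ?thesis using i by (simp add: euclid_norm_def)
qed

lemma spectral_norm_le:
  assumes "A \<in> carrier_mat m n" "0 < n" "op_bound {..<m} {..<n} (\<lambda>i j. A $$ (i, j)) c"
  shows "spectral_norm A \<le> c"
  unfolding spectral_norm_def
proof (rule cSUP_least)
  have "unit_vec n 0 \<in> {x \<in> carrier_vec (dim_col A). euclid_norm x = 1}"
    using assms by (auto simp: euclid_norm_unit)
  then show "{x \<in> carrier_vec (dim_col A). euclid_norm x = 1} \<noteq> {}" by blast
  fix x assume "x \<in> {x \<in> carrier_vec (dim_col A). euclid_norm x = 1}"
  then have x: "x \<in> carrier_vec n" "euclid_norm x = 1" using assms by auto
  show "euclid_norm (A *\<^sub>v x) \<le> c"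
    using op_boundD[OF assms(3), of "\<lambda>j. x $ j"] x(2)
    unfolding euclid_norm_mult_mat_vec[OF assms(1) x(1)] L2_set_vec[OF x(1)] by simp
qed

lemma op_bound_spectral_norm:
  assumes A: "A \<in> carrier_mat m n" and n: "0 < n"
  shows "op_bound {..<m} {..<n} (\<lambda>i j. A $$ (i, j)) (spectral_norm A)" and "0 \<le> spectral_norm A"
proof -
  \<comment> \<open>Sum of the moduli of all entries; it bounds the image of the unit sphere, so
    that the real supremum is meaningful.\<close>
  define F where "F = (\<Sum>i<m. \<Sum>j<n. cmod (A $$ (i, j)))"
  have bdd: "bdd_above ((\<lambda>x. euclid_norm (A *\<^sub>v x)) ` {x \<in> carrier_vec (dim_col A). euclid_norm x = 1})"
  proof (rule bdd_aboveI2)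
    fix x assume "x \<in> {x \<in> carrier_vec (dim_col A). euclid_norm x = 1}"
    then have x: "x \<in> carrier_vec n" "L2_set (\<lambda>i. cmod (x $ i)) {..<n} = 1" using A by (auto simp: L2_set_vec)
    have xj: "cmod (x $ j) \<le> 1" if "j < n" for j
      using member_le_L2_set[of "{..<n}" j "\<lambda>i. cmod (x $ i)"] that x(2) by simp
    have "euclid_norm (A *\<^sub>v x) \<le> (\<Sum>i<m. \<bar>cmod (\<Sum>j<n. A $$ (i, j) * x $ j)\<bar>)"
      unfolding euclid_norm_mult_mat_vec[OF A x(1)] by (rule L2_set_le_sum_abs)
    also have "\<dots> \<le> F"
      unfolding F_def abs_norm_cancel
    proof (intro sum_mono order_trans[OF norm_sum])
      fix i j assume "j \<in> {..<n}"
      then show "cmod (A $$ (i, j) * x $ j) \<le> cmod (A $$ (i, j))"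
        using mult_left_mono[OF xj, of j "cmod (A $$ (i, j))"] by (simp add: norm_mult)
    qed
    finally show "euclid_norm (A *\<^sub>v x) \<le> F" .
  qed
  have le1: "euclid_norm (A *\<^sub>v x) \<le> spectral_norm A" if "x \<in> carrier_vec n" "euclid_norm x = 1" for x
    unfolding spectral_norm_def using that A by (intro cSUP_upper bdd) auto
  show "0 \<le> spectral_norm A"
    using le1[of "unit_vec n 0"] n euclid_norm_unit[of 0 n]
    by (auto intro: order_trans[rotated] simp: euclid_norm_L2_set L2_set_nonneg)
  show "op_bound {..<m} {..<n} (\<lambda>i j. A $$ (i, j)) (spectral_norm A)"
    unfolding op_bound_def
  proof
    fix x :: "nat \<Rightarrow> complex"
    define N where "N = L2_set (\<lambda>j. cmod (x j)) {..<n}"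
    show "L2_set (\<lambda>i. cmod (\<Sum>j<n. A $$ (i, j) * x j)) {..<m} \<le> spectral_norm A * N"
    proof (cases "N = 0")
      case True
      then have "x j = 0" if "j < n" for j
        using that by (auto simp: N_def L2_set_eq_0_iff)
      then show ?thesis using True by (simp add: L2_set_def)
    next
      case False
      then have N: "0 < N" by (simp add: N_def less_le L2_set_nonneg)
      define y where "y = Matrix.vec n (\<lambda>j. x j / of_real N)"
      have y: "y \<in> carrier_vec n" by (simp add: y_def)
      have "euclid_norm y = L2_set (\<lambda>j. (1 / N) * cmod (x j)) {..<n}"
        unfolding L2_set_vec[OF y] using N by (intro L2_set_cong) (auto simp: y_def norm_divide)
      also have "\<dots> = 1" using N by (subst L2_set_cmult) (auto simp: N_def)
      finally have "euclid_norm (A *\<^sub>v y) \<le> spectral_norm A" by (rule le1[OF y])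
      also have "euclid_norm (A *\<^sub>v y) = L2_set (\<lambda>i. (1 / N) * cmod (\<Sum>j<n. A $$ (i, j) * x j)) {..<m}"
        unfolding euclid_norm_mult_mat_vec[OF A y]
      proof (intro L2_set_cong refl)
        fix i assume "i \<in> {..<m}"
        have "(\<Sum>j<n. A $$ (i, j) * y $ j) = (\<Sum>j<n. A $$ (i, j) * x j) / of_real N"
          unfolding sum_divide_distrib by (intro sum.cong) (auto simp: y_def)
        then show "cmod (\<Sum>j<n. A $$ (i, j) * y $ j) = 1 / N * cmod (\<Sum>j<n. A $$ (i, j) * x j)"
          using N by (simp add: norm_divide)
      qed
      also have "\<dots> = (1 / N) * L2_set (\<lambda>i. cmod (\<Sum>j<n. A $$ (i, j) * x j)) {..<m}"
        using N by (intro L2_set_cmult) simp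
      finally have "(1 / N) * L2_set (\<lambda>i. cmod (\<Sum>j<n. A $$ (i, j) * x j)) {..<m} \<le> spectral_norm A" .
      then show ?thesis using N by (simp add: divide_le_eq)
    qed
  qed
qed

section \<open>Fourier transforms\<close>

lemma unity_root_add: "unity_root n (a + b) = unity_root n a * unity_root n b"
  by (simp add: unity_root_def cis_mult add_divide_distrib distrib_left)

lemma unity_root_0 [simp]: "unity_root n 0 = 1"
  by (simp add: unity_root_def)

lemma unity_root_period: "0 < n \<Longrightarrow> unity_root n (n * k) = 1"
proof -
  assume "0 < n"
  then have "2 * pi * real (n * k) / real n = 2 * pi * real k" by simp
  then show ?thesis unfolding unity_root_def by (simp only:) (rule cis_multiple_2pi, simp)
qed

lemma unity_root_mod: "0 < n \<Longrightarrow> unity_root n (j * (a mod n)) = unity_root n (j * a)"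
proof -
  assume n: "0 < n"
  have "j * a = j * (a mod n) + n * (j * (a div n))"
    by (metis add.commute distrib_left mult.left_commute mult_div_mod_eq)
  then show ?thesis using n by (simp add: unity_root_add unity_root_period)
qed

lemma unity_root_double: "unity_root (2 * n) (2 * a) = unity_root n a"
  by (simp add: unity_root_def mult.assoc)

lemma unity_root_half: "0 < n \<Longrightarrow> unity_root (2 * n) n = - 1"
  by (simp add: unity_root_def)

lemma unity_root_cnj: "unity_root n a * cnj (unity_root n a) = 1"
  by (simp add: unity_root_def cis_cnj cis_mult)

lemma sum_even_odd: "(\<Sum>k<2 * N. f k) = (\<Sum>k<N. f (2 * k)) + (\<Sum>k<N. f (2 * k + 1 :: nat))"
  for f :: "nat \<Rightarrow> 'a :: comm_monoid_add"
  by (induction N) (simp_all add: add_ac)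

lemmas cost_simps = bind_costed_def return_def charge_def add_c_def sub_c_def mul_c_def div_c_def
  cnj_c_def sqrt_c_def root_c_def collect_vec_def collect_mat_def

lemma result_fft:
  "dim_vec x = 2 ^ p \<Longrightarrow> result (fft p x) = vec (2 ^ p) (\<lambda>j. \<Sum>k<2 ^ p. unity_root (2 ^ p) (j * k) * x $ k)"
proof (induction p arbitrary: x)
  case 0
  then show ?case by (intro eq_vecI) (auto simp: cost_simps)
next
  case (Suc p)
  define N :: nat where "N = 2 ^ p"
  have N: "0 < N" by (simp add: N_def)
  define e where "e = vec N (\<lambda>i. x $ (2 * i))"
  define f where "f = vec N (\<lambda>i. x $ (2 * i + 1))"
  have E: "result (fft p e) = vec N (\<lambda>j. \<Sum>k<N. unity_root N (j * k) * x $ (2 * k))"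
    unfolding N_def by (subst Suc.IH) (auto simp: e_def N_def intro!: eq_vecI sum.cong)
  have F: "result (fft p f) = vec N (\<lambda>j. \<Sum>k<N. unity_root N (j * k) * x $ (2 * k + 1))"
    unfolding N_def by (subst Suc.IH) (auto simp: f_def N_def intro!: eq_vecI sum.cong)
  have r: "result (fft (Suc p) x) = vec N (\<lambda>j. result (fft p e) $ j + unity_root (2 * N) j * result (fft p f) $ j)
      @\<^sub>v vec N (\<lambda>j. result (fft p e) $ j - unity_root (2 * N) j * result (fft p f) $ j)"
    by (simp add: cost_simps e_def f_def N_def) (auto intro!: eq_vecI)
  have P: "2 ^ Suc p = 2 * N" by (simp add: N_def)
  show ?case unfolding P
  proof (rule eq_vecI)
    fix j assume j: "j < dim_vec (vec (2 * N) (\<lambda>j. \<Sum>k<2 * N. unity_root (2 * N) (j * k) * x $ k))"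
    have ev: "unity_root (2 * N) (j * (2 * k)) = unity_root N (j * k)" for j k
      using unity_root_double[of N "j * k"] by (simp add: mult_ac)
    have od: "unity_root (2 * N) (j * (2 * k + 1)) = unity_root (2 * N) j * unity_root N (j * k)" for j k
      using unity_root_double[of N "j * k"] by (simp add: mult_ac distrib_left unity_root_add)
    have S: "(\<Sum>k<2 * N. unity_root (2 * N) (j * k) * x $ k) =
        (\<Sum>k<N. unity_root N (j * k) * x $ (2 * k)) + unity_root (2 * N) j * (\<Sum>k<N. unity_root N (j * k) * x $ (2 * k + 1))" for j
      unfolding sum_even_odd ev od sum_distrib_left mult.assoc ..
    show "result (fft (Suc p) x) $ j = vec (2 * N) (\<lambda>j. \<Sum>k<2 * N. unity_root (2 * N) (j * k) * x $ k) $ j"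
    proof (cases "j < N")
      case True
      then show ?thesis using j unfolding r E F S[abs_def] by simp
    next
      case False
      define i where "i = j - N"
      have i: "j = N + i" "i < N" using False j by (auto simp: i_def)
      \<comment> \<open>In the second half of the output the half-length transforms repeat with
        period \<open>N\<close>, while the twiddle factor changes sign because
        \<open>unity_root (2 * N) N = - 1\<close>.\<close>
      have h: "unity_root N ((N + i) * k) = unity_root N (i * k)" for k
        using unity_root_period[OF N, of k] by (simp add: distrib_right unity_root_add)
      show ?thesis using i N unfolding r E F S[abs_def]
        by (simp add: h unity_root_add unity_root_half)
    qed
  qed (use r in \<open>simp add: N_def\<close>)
qed

text \<open>One level spends a root, a product, a sum and a difference on each of its pairs of
  output entries.\<close>

lemma ops_fft: "ops (fft p x) = 2 * p * 2 ^ p"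
  by (induction p arbitrary: x) (simp_all add: cost_simps algebra_simps)

lemma dft_mat_carrier [simp]: "dft_mat n \<in> carrier_mat n n"
  by (simp add: dft_mat_def)

lemma result_fft_cols:
  assumes "A \<in> carrier_mat (2 ^ p) \<rho>"
  shows "result (fft_cols p A) = dft_mat (2 ^ p) * A"
proof (rule eq_matI)
  fix i j assume "i < dim_row (dft_mat (2 ^ p) * A)" "j < dim_col (dft_mat (2 ^ p) * A)"
  then have ij: "i < 2 ^ p" "j < \<rho>" using assms by (auto simp: dft_mat_def)
  have "result (fft p (col A j)) = vec (2 ^ p) (\<lambda>i. \<Sum>k<2 ^ p. unity_root (2 ^ p) (i * k) * col A j $ k)"
    by (rule result_fft) (use assms in simp)
  then show "result (fft_cols p A) $$ (i, j) = (dft_mat (2 ^ p) * A) $$ (i, j)"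
    using ij assms
    by (simp add: fft_cols_def cost_simps dft_mat_def scalar_prod_def atLeast0LessThan sum_divide_distrib)
qed (use assms in \<open>auto simp: fft_cols_def cost_simps dft_mat_def\<close>)

lemma ops_fft_cols:
  assumes "dim_col A = \<rho>"
  shows "ops (fft_cols p A) = \<rho> * (2 * p * 2 ^ p) + 1 + 2 ^ p * \<rho>"
  using assms by (simp add: fft_cols_def cost_simps ops_fft)

lemma mat_adjoint_index:
  "i < dim_col A \<Longrightarrow> j < dim_row A \<Longrightarrow> mat_adjoint A $$ (i, j) = cnj (A $$ (j, i))"
  "dim_row (mat_adjoint A) = dim_col A" "dim_col (mat_adjoint A) = dim_row A"
  for A :: "complex mat"
  by (simp_all add: mat_adjoint_def mat_of_rows_index)

lemma mat_adjoint_carrier: "A \<in> carrier_mat m n \<Longrightarrow> mat_adjoint A \<in> carrier_mat n m" for A :: "complex mat"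
  by (auto simp: mat_adjoint_index)

lemma mult_mat_adjoint_index:
  fixes A B :: "complex mat"
  assumes "A \<in> carrier_mat m r" "B \<in> carrier_mat k r" "i < m" "j < k"
  shows "(A * mat_adjoint B) $$ (i, j) = (\<Sum>l<r. A $$ (i, l) * cnj (B $$ (j, l)))"
  using assms by (simp add: scalar_prod_def mat_adjoint_index atLeast0LessThan)

lemma mat_adjoint_mult:
  fixes A B :: "complex mat"
  assumes "A \<in> carrier_mat m r" "B \<in> carrier_mat r k"
  shows "mat_adjoint (A * B) = mat_adjoint B * mat_adjoint A"
  using assms by (intro eq_matI) (auto simp: mat_adjoint_index scalar_prod_def mult.commute intro!: sum.cong)

definition transformed :: "nat \<Rightarrow> complex mat \<Rightarrow> complex mat" where
  "transformed n T = dft_mat n * T * mat_adjoint (dft_mat n)"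

lemma transformed_carrier: "T \<in> carrier_mat n n \<Longrightarrow> transformed n T \<in> carrier_mat n n"
  unfolding transformed_def
  by (rule mult_carrier_mat[OF mult_carrier_mat[OF dft_mat_carrier] mat_adjoint_carrier[OF dft_mat_carrier]])

lemma transformed_index:
  assumes "T \<in> carrier_mat n n" "j < n" "k < n"
  shows "transformed n T $$ (j, k) = (\<Sum>b<n. \<Sum>a<n. unity_root n (j * a) * T $$ (a, b) * cnj (unity_root n (k * b))) / of_nat n"
proof -
  have "(dft_mat n * T) $$ (j, b) = (\<Sum>a<n. unity_root n (j * a) * T $$ (a, b)) / of_real (sqrt (real n))" if "b < n" for b
    using assms that by (simp add: dft_mat_def scalar_prod_def atLeast0LessThan sum_divide_distrib)
  then have "transformed n T $$ (j, k) = (\<Sum>b<n. (\<Sum>a<n. unity_root n (j * a) * T $$ (a, b)) / of_real (sqrt (real n)) * cnj (dft_mat n $$ (k, b)))"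
    unfolding transformed_def using assms
    by (subst mult_mat_adjoint_index[OF mult_carrier_mat[OF dft_mat_carrier] dft_mat_carrier]) (auto intro!: sum.cong)
  also have "\<dots> = (\<Sum>b<n. (\<Sum>a<n. unity_root n (j * a) * T $$ (a, b)) * cnj (unity_root n (k * b)) / of_nat n)"
  proof (intro sum.cong refl)
    fix b assume "b \<in> {..<n}"
    have "complex_of_real (sqrt (real n)) * of_real (sqrt (real n)) = of_nat n"
      by (simp flip: of_real_mult)
    then show "(\<Sum>a<n. unity_root n (j * a) * T $$ (a, b)) / of_real (sqrt (real n)) * cnj (dft_mat n $$ (k, b))
      = (\<Sum>a<n. unity_root n (j * a) * T $$ (a, b)) * cnj (unity_root n (k * b)) / of_nat n"
      using assms \<open>b \<in> {..<n}\<close> by (simp add: dft_mat_def)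
  qed
  finally show ?thesis by (simp add: sum_divide_distrib sum_distrib_right)
qed

text \<open>In a diagonal entry, \<open>T $$ (a, b)\<close> is multiplied by a root of unity
  depending only on \<open>a - b\<close> modulo \<open>n\<close>, so the double sum can be collected
  along cyclic diagonals. The \<open>1 / n\<close> of the two unitary transforms is the
  \<open>1 / n\<close> of the averages, hence the unscaled \<open>fft\<close> is the right
  one.\<close>

lemma transformed_diag:
  assumes T: "T \<in> carrier_mat n n" and j: "j < n"
  shows "transformed n T $$ (j, j) = (\<Sum>k<n. unity_root n (j * k) * col (circulant_proj T) 0 $ k)"
proof -
  have n: "0 < n" using j by simp
  have rot: "unity_root n (j * a) * cnj (unity_root n (j * i)) = unity_root n (j * k)" if "a = (k + i) mod n" for a k i
    unfolding that unity_root_mod[OF n] distrib_left unity_root_add mult.assoc unity_root_cnj by simp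
  \<comment> \<open>For a fixed column \<open>i\<close> the rows met by the \<open>n\<close> cyclic
    diagonals are all rows, each exactly once.\<close>
  have bij: "bij_betw (\<lambda>k. (k + i) mod n) {..<n} {..<n}" if "i < n" for i
  proof (rule bij_betw_byWitness[where f' = "\<lambda>a. (a + (n - i)) mod n"])
    have e: "a + i + (n - i) = a + n" "a + (n - i) + i = a + n" for a using that by auto
    show "\<forall>a\<in>{..<n}. ((a + i) mod n + (n - i)) mod n = a"
      unfolding mod_add_left_eq e by simp
    show "\<forall>a\<in>{..<n}. ((a + (n - i)) mod n + i) mod n = a"
      unfolding mod_add_left_eq e by simp
  qed (use n in auto)
  have shift: "(x + (n + i)) mod n = (x + i) mod n" for x i
  proof -
    have "x + (n + i) = (x + i) + n" by simp
    then show ?thesis by (simp only: mod_add_self2)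
  qed
  have "(\<Sum>k<n. unity_root n (j * k) * col (circulant_proj T) 0 $ k)
      = (\<Sum>k<n. \<Sum>i<n. unity_root n (j * k) * T $$ ((k + i) mod n, i)) / of_nat n"
    unfolding sum_divide_distrib using T n
    by (intro sum.cong refl) (simp add: circulant_proj_def Let_def sum_distrib_left sum_divide_distrib add.assoc shift)
  also have "(\<Sum>k<n. \<Sum>i<n. unity_root n (j * k) * T $$ ((k + i) mod n, i))
      = (\<Sum>i<n. \<Sum>k<n. unity_root n (j * ((k + i) mod n)) * T $$ ((k + i) mod n, i) * cnj (unity_root n (j * i)))"
  proof (subst sum.swap, intro sum.cong refl)
    fix i k
    show "unity_root n (j * k) * T $$ ((k + i) mod n, i)
      = unity_root n (j * ((k + i) mod n)) * T $$ ((k + i) mod n, i) * cnj (unity_root n (j * i))"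
      unfolding rot[OF refl, of k i, symmetric] by (simp only: mult_ac)
  qed
  also have "\<dots> = (\<Sum>i<n. \<Sum>a<n. unity_root n (j * a) * T $$ (a, i) * cnj (unity_root n (j * i)))"
  proof (rule sum.cong[OF refl])
    fix i assume "i \<in> {..<n}"
    then show "(\<Sum>k<n. unity_root n (j * ((k + i) mod n)) * T $$ ((k + i) mod n, i) * cnj (unity_root n (j * i)))
      = (\<Sum>a<n. unity_root n (j * a) * T $$ (a, i) * cnj (unity_root n (j * i)))"
      using sum.reindex_bij_betw[OF bij, of i "\<lambda>a. unity_root n (j * a) * T $$ (a, i) * cnj (unity_root n (j * i))"] by simp
  qed
  finally show ?thesis using transformed_index[OF T j j] by simp
qed

text \<open>With \<open>F\<close> the Fourier matrix, \<open>F Z = D F\<close> and the adjoint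
  relation carry the cyclic shift through both transforms, which turns the displacement equation
  into one with diagonal \<open>D\<close>.\<close>

lemma transformed_displacement:
  assumes T: "T \<in> carrier_mat n n" and G: "G \<in> carrier_mat n \<rho>" and H: "H \<in> carrier_mat n \<rho>"
    and disp: "cyclic_shift n * T - T * cyclic_shift n = G * mat_adjoint H" and j: "j < n" and k: "k < n"
  shows "(unity_root n j - unity_root n k) * transformed n T $$ (j, k)
    = (\<Sum>r<\<rho>. (dft_mat n * G) $$ (j, r) * cnj ((dft_mat n * H) $$ (k, r)))"
proof -
  let ?F = "dft_mat n" and ?Z = "cyclic_shift n"
  define D where "D = mat n n (\<lambda>(i, j). if i = j then unity_root n i else 0)"
  have n: "0 < n" using j by simp
  have Z: "?Z \<in> carrier_mat n n" and D: "D \<in> carrier_mat n n" and F: "?F \<in> carrier_mat n n" and F': "mat_adjoint ?F \<in> carrier_mat n n"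
    by (auto simp: cyclic_shift_def D_def mat_adjoint_carrier[OF dft_mat_carrier])
  have FZ: "?F * ?Z = D * ?F"
  proof (rule eq_matI)
    fix i l assume "i < dim_row (D * ?F)" "l < dim_col (D * ?F)"
    then have il: "i < n" "l < n" using D by (auto simp: dft_mat_def)
    have "(?F * ?Z) $$ (i, l) = (\<Sum>a<n. ?F $$ (i, a) * (if a = (l + 1) mod n then 1 else 0))"
      using il by (simp add: dft_mat_def cyclic_shift_def scalar_prod_def atLeast0LessThan)
    also have "\<dots> = ?F $$ (i, (l + 1) mod n)"
      using n by (simp add: if_distrib[of "\<lambda>x. _ * x"] cong: if_cong)
    also have "\<dots> = unity_root n i * ?F $$ (i, l)"
      using il n unity_root_mod[OF n, of i "l + 1"] by (simp add: dft_mat_def distrib_left unity_root_add)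
    also have "\<dots> = (\<Sum>a<n. (if i = a then unity_root n i else 0) * ?F $$ (a, l))"
      using il by (simp add: if_distrib[of "\<lambda>x. x * _"] cong: if_cong)
    also have "\<dots> = (D * ?F) $$ (i, l)"
      using il by (simp add: D_def dft_mat_def scalar_prod_def atLeast0LessThan)
    finally show "(?F * ?Z) $$ (i, l) = (D * ?F) $$ (i, l)" .
  qed (simp_all add: D_def dft_mat_def cyclic_shift_def)
  have ZF: "?Z * mat_adjoint ?F = mat_adjoint ?F * D"
  proof (rule eq_matI)
    fix i l assume "i < dim_row (mat_adjoint ?F * D)" "l < dim_col (mat_adjoint ?F * D)"
    then have il: "i < n" "l < n" using D F' by auto
    \<comment> \<open>The cyclic predecessor of \<open>i\<close>; adding \<open>n - 1\<close> avoids
      truncated subtraction at \<open>i = 0\<close>.\<close>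
    define b where "b = (i + (n - 1)) mod n"
    have b: "b < n" "Suc b mod n = i" unfolding b_def using n il by (auto simp: mod_simps)
    have bi: "i = Suc a mod n \<longleftrightarrow> a = b" if "a < n" for a
    proof -
      have "Suc c mod n = (if Suc c = n then 0 else Suc c)" if "c < n" for c using that by (simp add: mod_Suc)
      from this[OF \<open>a < n\<close>] this[OF b(1)] show ?thesis using b(2) by auto
    qed
    have "(?Z * mat_adjoint ?F) $$ (i, l) = (\<Sum>a<n. ?Z $$ (i, a) * mat_adjoint ?F $$ (a, l))"
      using il Z F' by (simp add: scalar_prod_def atLeast0LessThan)
    also have "\<dots> = (\<Sum>a<n. (if a = b then 1 else 0) * cnj (?F $$ (l, a)))"
    proof (rule sum.cong[OF refl])
      fix a assume "a \<in> {..<n}"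
      then have a: "a < n" by simp
      have "?Z $$ (i, a) = (if a = b then 1 else 0)"
        using il a bi[OF a] by (simp add: cyclic_shift_def)
      moreover have "mat_adjoint ?F $$ (a, l) = cnj (?F $$ (l, a))"
        by (rule mat_adjoint_index) (use a il in \<open>auto simp: dft_mat_def\<close>)
      ultimately show "?Z $$ (i, a) * mat_adjoint ?F $$ (a, l) = (if a = b then 1 else 0) * cnj (?F $$ (l, a))" by simp
    qed
    also have "\<dots> = cnj (?F $$ (l, b))"
      using b by (simp add: if_distrib[of "\<lambda>x. x * _"] cong: if_cong)
    also have "\<dots> = cnj (?F $$ (l, i)) * unity_root n l"
    proof -
      have "unity_root n (l * i) = unity_root n (l * b) * unity_root n l"
        unfolding b(2)[symmetric] unity_root_mod[OF n] by (simp add: unity_root_add)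
      then have "cnj (unity_root n (l * i)) * unity_root n l = cnj (unity_root n (l * b))"
        using unity_root_cnj[of n l] by (simp add: mult_ac)
      then show ?thesis using il b by (simp add: dft_mat_def)
    qed
    also have "\<dots> = (\<Sum>a<n. cnj (?F $$ (a, i)) * (if a = l then unity_root n a else 0))"
      using il by (simp add: if_distrib[of "\<lambda>x. _ * x"] cong: if_cong)
    also have "\<dots> = (\<Sum>a<n. mat_adjoint ?F $$ (i, a) * D $$ (a, l))"
    proof (rule sum.cong[OF refl])
      fix a assume "a \<in> {..<n}"
      then have a: "a < n" by simp
      have "mat_adjoint ?F $$ (i, a) = cnj (?F $$ (a, i))"
        by (rule mat_adjoint_index) (use a il in \<open>auto simp: dft_mat_def\<close>)
      then show "cnj (?F $$ (a, i)) * (if a = l then unity_root n a else 0) = mat_adjoint ?F $$ (i, a) * D $$ (a, l)"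
        using a il by (simp add: D_def)
    qed
    also have "\<dots> = (mat_adjoint ?F * D) $$ (i, l)"
      using il D F' by (simp add: scalar_prod_def atLeast0LessThan)
    finally show "(?Z * mat_adjoint ?F) $$ (i, l) = (mat_adjoint ?F * D) $$ (i, l)" .
  qed (use F' in \<open>auto simp: D_def cyclic_shift_def\<close>)
  have "(?F * G) * mat_adjoint (?F * H) = ?F * (G * mat_adjoint H) * mat_adjoint ?F"
    unfolding mat_adjoint_mult[OF F H] using F G mat_adjoint_carrier[OF H] F'
    by (simp add: assoc_mult_mat[of _ n n _ n _ n] assoc_mult_mat[of _ n n _ \<rho> _ n] assoc_mult_mat[of _ n \<rho> _ n _ n])
  also have "\<dots> = ?F * (?Z * T) * mat_adjoint ?F - ?F * (T * ?Z) * mat_adjoint ?F"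
    unfolding disp[symmetric] mult_minus_distrib_mat[OF F mult_carrier_mat[OF Z T] mult_carrier_mat[OF T Z]]
    by (rule minus_mult_distrib_mat[OF mult_carrier_mat[OF F mult_carrier_mat[OF Z T]] mult_carrier_mat[OF F mult_carrier_mat[OF T Z]] F'])
  also have "?F * (?Z * T) * mat_adjoint ?F = D * transformed n T"
  proof -
    have "?F * (?Z * T) * mat_adjoint ?F = (?F * ?Z) * T * mat_adjoint ?F"
      using F Z T by (simp add: assoc_mult_mat[of _ n n _ n _ n])
    then show ?thesis unfolding FZ transformed_def using F D T F' by (simp add: assoc_mult_mat[of _ n n _ n _ n])
  qed
  also have "?F * (T * ?Z) * mat_adjoint ?F = transformed n T * D"
  proof -
    have "?F * (T * ?Z) * mat_adjoint ?F = ?F * T * (?Z * mat_adjoint ?F)"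
      using F Z T F' by (simp add: assoc_mult_mat[of _ n n _ n _ n])
    then show ?thesis unfolding ZF transformed_def using F D T F' by (simp add: assoc_mult_mat[of _ n n _ n _ n])
  qed
  finally have eq: "(?F * G) * mat_adjoint (?F * H) = D * transformed n T - transformed n T * D" .
  have C: "transformed n T \<in> carrier_mat n n" by (rule transformed_carrier[OF T])
  have d1: "(D * transformed n T) $$ (j, k) = unity_root n j * transformed n T $$ (j, k)"
  proof -
    have "(D * transformed n T) $$ (j, k) = (\<Sum>a<n. (if j = a then unity_root n j else 0) * transformed n T $$ (a, k))"
      using j k C by (simp add: D_def scalar_prod_def atLeast0LessThan)
    then show ?thesis using j by (simp add: if_distrib[of "\<lambda>x. x * _"] cong: if_cong)
  qed
  have d2: "(transformed n T * D) $$ (j, k) = transformed n T $$ (j, k) * unity_root n k"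
  proof -
    have "(transformed n T * D) $$ (j, k) = (\<Sum>a<n. transformed n T $$ (j, a) * (if a = k then unity_root n a else 0))"
      using j k C by (simp add: D_def scalar_prod_def atLeast0LessThan)
    then show ?thesis using k by (simp add: if_distrib[of "\<lambda>x. _ * x"] cong: if_cong)
  qed
  have "((?F * G) * mat_adjoint (?F * H)) $$ (j, k) = (\<Sum>r<\<rho>. (?F * G) $$ (j, r) * cnj ((?F * H) $$ (k, r)))"
    by (rule mult_mat_adjoint_index[OF mult_carrier_mat[OF F G] mult_carrier_mat[OF F H] j k])
  moreover have "(D * transformed n T - transformed n T * D) $$ (j, k) = unity_root n j * transformed n T $$ (j, k) - transformed n T $$ (j, k) * unity_root n k"
    using C D j k d1 d2 by (subst index_minus_mat) auto
  ultimately show ?thesis unfolding eq by (simp add: algebra_simps)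
qed

section \<open>The fADI factors\<close>

text \<open>All matrices applied by fADI are diagonal, so block \<open>l\<close> of the left factor
  is the generator with row \<open>i\<close> scaled by this function of the eigenvalue. The
  rescaling quotients of the recursion telescope to \<open>\<nu> l - \<tau> l\<close>.\<close>

definition left_coeff :: "(nat \<Rightarrow> complex) \<Rightarrow> (nat \<Rightarrow> complex) \<Rightarrow> nat \<Rightarrow> complex \<Rightarrow> complex" where
  "left_coeff \<tau> \<nu> l x = (\<nu> l - \<tau> l) / (x - \<nu> l) * (\<Prod>j<l. (x - \<tau> j) / (x - \<nu> j))"

text \<open>The blocks \<open>W\<close> contain the conjugate of this value; the adjoint in
  \<open>factored\<close> conjugates once more.\<close>

definition right_coeff :: "(nat \<Rightarrow> complex) \<Rightarrow> (nat \<Rightarrow> complex) \<Rightarrow> nat \<Rightarrow> complex \<Rightarrow> complex" where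
  "right_coeff \<tau> \<nu> l y = 1 / (y - \<tau> l) * (\<Prod>j<l. (y - \<nu> j) / (y - \<tau> j))"

text \<open>The residual of ADI: each step multiplies the error by one factor of the rational function.\<close>

lemma adi_telescoping:
  assumes "\<And>j. j < k \<Longrightarrow> x \<noteq> \<nu> j" "\<And>j. j < k \<Longrightarrow> y \<noteq> \<tau> j" "x \<noteq> y"
  shows "(\<Sum>l<k. left_coeff \<tau> \<nu> l x * right_coeff \<tau> \<nu> l y)
    = (1 - (\<Prod>j<k. (x - \<tau> j) / (x - \<nu> j) * ((y - \<nu> j) / (y - \<tau> j)))) / (x - y)"
  using assms
proof (induction k)
  case (Suc k)
  define R where "R = (\<Prod>j<k. (x - \<tau> j) / (x - \<nu> j) * ((y - \<nu> j) / (y - \<tau> j)))"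
  have nz: "x - \<nu> k \<noteq> 0" "y - \<tau> k \<noteq> 0" "x - y \<noteq> 0" using Suc.prems by auto
  have "left_coeff \<tau> \<nu> k x * right_coeff \<tau> \<nu> k y = (\<nu> k - \<tau> k) / ((x - \<nu> k) * (y - \<tau> k)) * R"
    unfolding left_coeff_def right_coeff_def R_def prod.distrib
    by (simp only: times_divide_eq_left times_divide_eq_right mult_1 divide_divide_eq_left mult_ac)
  \<comment> \<open>The identity behind one step: \<open>(x - \<nu>)(y - \<tau>) - (x - \<tau>)(y -
    \<nu>) = (x - y)(\<nu> - \<tau>)\<close>.\<close>
  moreover have "(\<nu> k - \<tau> k) / ((x - \<nu> k) * (y - \<tau> k)) = (1 - (x - \<tau> k) / (x - \<nu> k) * ((y - \<nu> k) / (y - \<tau> k))) / (x - y)"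
    using nz by (simp add: divide_simps) (simp add: algebra_simps)
  moreover have "(\<Sum>l<k. left_coeff \<tau> \<nu> l x * right_coeff \<tau> \<nu> l y) = (1 - R) / (x - y)"
    unfolding R_def using Suc by simp
  moreover have "(\<Prod>j<Suc k. (x - \<tau> j) / (x - \<nu> j) * ((y - \<nu> j) / (y - \<tau> j)))
      = R * ((x - \<tau> k) / (x - \<nu> k) * ((y - \<nu> k) / (y - \<tau> k)))" by (simp add: R_def)
  moreover have "(1 - R) / (x - y) + (1 - P) / (x - y) * R = (1 - R * P) / (x - y)" for P
    unfolding times_divide_eq_left add_divide_distrib[symmetric] by (simp add: algebra_simps)
  ultimately show ?case by (simp only: sum.lessThan_Suc)
qed simp

text \<open>The recursion divides by \<open>\<nu> $ j - \<tau> $ j\<close>, the factor contained in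
  the previous block; distinct shifts let it cancel.\<close>

lemma result_fadi_left:
  assumes "\<And>j. j < k \<Longrightarrow> \<tau> $ j \<noteq> \<nu> $ j"
  shows "result (fadi_left d \<tau> \<nu> G k)
    = map (\<lambda>l. mat (dim_row G) (dim_col G) (\<lambda>(i, r). left_coeff (\<lambda>j. \<tau> $ j) (\<lambda>j. \<nu> $ j) l (d $ i) * G $$ (i, r))) [0..<k]"
  using assms
proof (induction k)
  case (Suc k)
  show ?case
  proof (cases k)
    case 0
    then show ?thesis by (simp add: cost_simps left_coeff_def)
  next
    case (Suc j)
    have IH: "result (fadi_left d \<tau> \<nu> G (Suc j))
      = map (\<lambda>l. mat (dim_row G) (dim_col G) (\<lambda>(i, r). left_coeff (\<lambda>j. \<tau> $ j) (\<lambda>j. \<nu> $ j) l (d $ i) * G $$ (i, r))) [0..<Suc j]"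
      using Suc.IH Suc.prems unfolding Suc by simp
    have l: "last (result (fadi_left d \<tau> \<nu> G (Suc j)))
      = mat (dim_row G) (dim_col G) (\<lambda>(i, r). left_coeff (\<lambda>j. \<tau> $ j) (\<lambda>j. \<nu> $ j) j (d $ i) * G $$ (i, r))"
      unfolding IH by simp
    have nz: "\<nu> $ j - \<tau> $ j \<noteq> 0" using Suc.prems[of j] unfolding Suc by simp
    have c: "(\<nu> $ Suc j - \<tau> $ Suc j) / (\<nu> $ j - \<tau> $ j) * ((x - \<tau> $ j) / (x - \<nu> $ Suc j)) * (left_coeff (\<lambda>j. \<tau> $ j) (\<lambda>j. \<nu> $ j) j x * g)
       = left_coeff (\<lambda>j. \<tau> $ j) (\<lambda>j. \<nu> $ j) (Suc j) x * g" for x g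
      unfolding left_coeff_def using nz by simp
    show ?thesis
      unfolding Suc fadi_left.simps
      by (simp add: cost_simps l[unfolded cost_simps] IH del: times_divide_eq_left times_divide_eq_right times_divide_times_eq)
        (auto intro!: eq_matI simp: c l simp del: times_divide_eq_left times_divide_eq_right times_divide_times_eq)
  qed
qed (simp add: cost_simps)

lemma result_fadi_right:
  "result (fadi_right d \<tau> \<nu> H k)
    = map (\<lambda>l. mat (dim_row H) (dim_col H) (\<lambda>(i, r). cnj (right_coeff (\<lambda>j. \<tau> $ j) (\<lambda>j. \<nu> $ j) l (d $ i)) * H $$ (i, r))) [0..<k]"
proof (induction k)
  case (Suc k)
  show ?case
  proof (cases k)
    case 0
    then show ?thesis by (simp add: cost_simps right_coeff_def)
  next
    case (Suc j)
    have IH: "result (fadi_right d \<tau> \<nu> H (Suc j))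
      = map (\<lambda>l. mat (dim_row H) (dim_col H) (\<lambda>(i, r). cnj (right_coeff (\<lambda>j. \<tau> $ j) (\<lambda>j. \<nu> $ j) l (d $ i)) * H $$ (i, r))) [0..<Suc j]"
      using Suc.IH unfolding Suc .
    have l: "last (result (fadi_right d \<tau> \<nu> H (Suc j)))
      = mat (dim_row H) (dim_col H) (\<lambda>(i, r). cnj (right_coeff (\<lambda>j. \<tau> $ j) (\<lambda>j. \<nu> $ j) j (d $ i)) * H $$ (i, r))"
      unfolding IH by simp
    have c: "(cnj x - cnj (\<nu> $ j)) / (cnj x - cnj (\<tau> $ Suc j)) * (cnj (right_coeff (\<lambda>j. \<tau> $ j) (\<lambda>j. \<nu> $ j) j x) * g)
       = cnj (right_coeff (\<lambda>j. \<tau> $ j) (\<lambda>j. \<nu> $ j) (Suc j) x) * g" for x g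
      unfolding right_coeff_def by simp
    show ?thesis
      unfolding Suc fadi_right.simps
      by (simp add: cost_simps l[unfolded cost_simps] IH del: times_divide_eq_left times_divide_eq_right times_divide_times_eq)
        (auto intro!: eq_matI simp: c l simp del: times_divide_eq_left times_divide_eq_right times_divide_times_eq)
  qed
qed (simp add: cost_simps)

lemma ops_fadi_left: "ops (fadi_left d \<tau> \<nu> G k) \<le> k * (3 + 5 * dim_row G * dim_col G)"
  by (induction d \<tau> \<nu> G k rule: fadi_left.induct) (simp_all add: cost_simps algebra_simps)

lemma ops_fadi_right: "ops (fadi_right d \<tau> \<nu> H k) \<le> k * (3 + 5 * dim_row H * dim_col H)"
  by (induction d \<tau> \<nu> H k rule: fadi_right.induct) (simp_all add: cost_simps algebra_simps)

lemma pick_interval: "i < m \<Longrightarrow> pick {s..<s + m} i = s + i"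
proof -
  assume "i < m"
  moreover have "{a \<in> {s..<s + m}. a < s + i} = {s..<s + i}" using \<open>i < m\<close> by auto
  ultimately show ?thesis using pick_card_in_set[of "s + i" "{s..<s + m}"] by simp
qed

lemma card_interval_rows: "s + m \<le> n \<Longrightarrow> card {i. i < n \<and> i \<in> {s..<s + m}} = m"
proof -
  assume "s + m \<le> n"
  then have "{i. i < n \<and> i \<in> {s..<s + m}} = {s..<s + m}" by auto
  then show ?thesis by simp
qed

lemma submatrix_rows:
  assumes "G \<in> carrier_mat n \<rho>" "s + m \<le> n"
  shows "submatrix G {s..<s + m} UNIV = mat m \<rho> (\<lambda>(i, r). G $$ (s + i, r))"
  using assms card_interval_rows[OF assms(2)]
  by (intro eq_matI) (auto simp: submatrix_def pick_interval pick_UNIV)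

lemma submatrix_block:
  assumes "M \<in> carrier_mat n n" "s + m \<le> n" "t + m \<le> n"
  shows "submatrix M {s..<s + m} {t..<t + m} = mat m m (\<lambda>(i, j). M $$ (s + i, t + j))"
  using assms card_interval_rows[OF assms(2)] card_interval_rows[OF assms(3)]
  by (intro eq_matI) (auto simp: submatrix_def pick_interval)

text \<open>The product is a sum of \<open>r\<close> matrices of rank at most one, one per column,
  and rank is subadditive.\<close>

lemma rank_mult_adjoint_le:
  fixes A B :: "complex mat"
  assumes A: "A \<in> carrier_mat m r" and B: "B \<in> carrier_mat m r"
  shows "vec_space.rank m (A * mat_adjoint B) \<le> r"
proof -
  interpret vec_space "TYPE(complex)" m .
  define M where "M = (\<lambda>k. mat m m (\<lambda>(i, j). \<Sum>l<k. A $$ (i, l) * cnj (B $$ (j, l))))"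
  have "rank (M k) \<le> k" for k
  proof (induction k)
    case 0
    have "M 0 = 0\<^sub>m m m" unfolding M_def by (intro eq_matI) auto
    then show ?case using rank_0I[of m] by simp
  next
    case (Suc k)
    define U where "U = mat m m (\<lambda>(i, j). A $$ (i, k) * cnj (B $$ (j, k)))"
    have "M (Suc k) = M k + U" unfolding M_def U_def by (intro eq_matI) auto
    moreover have "rank U \<le> 1"
      by (rule rank_le_1_product_entries[of _ m "\<lambda>i. A $$ (i, k)" "\<lambda>j. cnj (B $$ (j, k))"]) (auto simp: U_def)
    moreover have "rank (M k + U) \<le> rank (M k) + rank U"
      by (rule rank_subadditive[of _ m]) (auto simp: M_def U_def)
    ultimately show ?case using Suc by simp
  qed
  moreover have "A * mat_adjoint B = M r"
  proof (rule eq_matI)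
    fix i j assume "i < dim_row (M r)" "j < dim_col (M r)"
    then have ij: "i < m" "j < m" by (auto simp: M_def)
    then show "(A * mat_adjoint B) $$ (i, j) = M r $$ (i, j)"
      by (subst mult_mat_adjoint_index[OF A B ij]) (simp add: M_def)
  qed (use A B in \<open>auto simp: M_def mat_adjoint_index\<close>)
  ultimately show ?thesis by simp
qed

lemma hconcat_carrier: "length As = k \<Longrightarrow> hconcat m \<rho> As \<in> carrier_mat m (k * \<rho>)"
  by (simp add: hconcat_def)

lemma factored_hconcat_index:
  assumes "length Zs = k" "length Ws = k" "i < m" "j < m"
  shows "factored (hconcat m \<rho> Zs, hconcat m \<rho> Ws) $$ (i, j)
    = (\<Sum>l<k. \<Sum>r<\<rho>. (Zs ! l) $$ (i, r) * cnj ((Ws ! l) $$ (j, r)))"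
proof -
  have "factored (hconcat m \<rho> Zs, hconcat m \<rho> Ws) $$ (i, j)
    = (\<Sum>c<k * \<rho>. (Zs ! (c div \<rho>)) $$ (i, c mod \<rho>) * cnj ((Ws ! (c div \<rho>)) $$ (j, c mod \<rho>)))"
    unfolding factored.simps
    by (subst mult_mat_adjoint_index[OF hconcat_carrier[OF assms(1)] hconcat_carrier[OF assms(2)] assms(3,4)])
       (use assms in \<open>auto simp: hconcat_def intro!: sum.cong\<close>)
  also have "\<dots> = (\<Sum>l<k. \<Sum>c\<in>{l * \<rho>..<l * \<rho> + \<rho>}. (Zs ! (c div \<rho>)) $$ (i, c mod \<rho>) * cnj ((Ws ! (c div \<rho>)) $$ (j, c mod \<rho>)))"
    by (rule sum.nat_group[symmetric])
  also have "\<dots> = (\<Sum>l<k. \<Sum>r<\<rho>. (Zs ! l) $$ (i, r) * cnj ((Ws ! l) $$ (j, r)))"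
  proof (rule sum.cong[OF refl])
    fix l
    have "(\<Sum>c\<in>{l * \<rho>..<l * \<rho> + \<rho>}. (Zs ! (c div \<rho>)) $$ (i, c mod \<rho>) * cnj ((Ws ! (c div \<rho>)) $$ (j, c mod \<rho>)))
      = (\<Sum>r\<in>{0..<\<rho>}. (Zs ! ((r + l * \<rho>) div \<rho>)) $$ (i, (r + l * \<rho>) mod \<rho>) * cnj ((Ws ! ((r + l * \<rho>) div \<rho>)) $$ (j, (r + l * \<rho>) mod \<rho>)))"
      using sum.shift_bounds_nat_ivl[of "\<lambda>c. (Zs ! (c div \<rho>)) $$ (i, c mod \<rho>) * cnj ((Ws ! (c div \<rho>)) $$ (j, c mod \<rho>))" 0 "l * \<rho>" \<rho>]
      by (simp add: add.commute)
    then show "(\<Sum>c\<in>{l * \<rho>..<l * \<rho> + \<rho>}. (Zs ! (c div \<rho>)) $$ (i, c mod \<rho>) * cnj ((Ws ! (c div \<rho>)) $$ (j, c mod \<rho>)))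
      = (\<Sum>r<\<rho>. (Zs ! l) $$ (i, r) * cnj ((Ws ! l) $$ (j, r)))"
      by (simp add: atLeast0LessThan)
  qed
  finally show ?thesis .
qed

text \<open>All blocks scale the same generator rows, so the sum over steps separates from the sum
  over \<open>r\<close>, which is the right-hand side of the displacement equation.\<close>

lemma fadi_block_index:
  fixes \<tau> \<nu> :: "nat \<Rightarrow> nat \<Rightarrow> nat \<Rightarrow> complex"
  assumes G: "G \<in> carrier_mat n \<rho>" and H: "H \<in> carrier_mat n \<rho>" and st: "s + m \<le> n" "t + m \<le> n"
    and k: "k = num_steps n' \<epsilon> m" and neq: "\<And>j. j < k \<Longrightarrow> \<tau> s t j \<noteq> \<nu> s t j" and ij: "i < m" "j < m"
  shows "factored (result (fadi_block \<kappa> \<tau> \<nu> n' \<epsilon> d G H s t m)) $$ (i, j)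
    = (\<Sum>l<k. left_coeff (\<tau> s t) (\<nu> s t) l (d $ (s + i)) * right_coeff (\<tau> s t) (\<nu> s t) l (d $ (t + j)))
      * (\<Sum>r<\<rho>. G $$ (s + i, r) * cnj (H $$ (t + j, r)))"
proof -
  define ts where "ts = vec k (\<tau> s t)"
  define ns where "ns = vec k (\<nu> s t)"
  define dl where "dl = vec m (\<lambda>i. d $ (s + i))"
  define dr where "dr = vec m (\<lambda>i. d $ (t + i))"
  define Gs where "Gs = mat m \<rho> (\<lambda>(i, r). G $$ (s + i, r))"
  define Hs where "Hs = mat m \<rho> (\<lambda>(i, r). H $$ (t + i, r))"
  have lc: "left_coeff (\<lambda>j. ts $ j) (\<lambda>j. ns $ j) l x = left_coeff (\<tau> s t) (\<nu> s t) l x" if "l < k" for l x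
    unfolding left_coeff_def using that by (auto simp: ts_def ns_def intro!: prod.cong)
  have rc: "right_coeff (\<lambda>j. ts $ j) (\<lambda>j. ns $ j) l x = right_coeff (\<tau> s t) (\<nu> s t) l x" if "l < k" for l x
    unfolding right_coeff_def using that by (auto simp: ts_def ns_def intro!: prod.cong)
  define Zs where "Zs = result (fadi_left dl ts ns Gs k)"
  define Ws where "Ws = result (fadi_right dr ts ns Hs k)"
  have Zs: "Zs = map (\<lambda>l. mat m \<rho> (\<lambda>(i, r). left_coeff (\<lambda>j. ts $ j) (\<lambda>j. ns $ j) l (dl $ i) * Gs $$ (i, r))) [0..<k]"
    unfolding Zs_def by (subst result_fadi_left) (use neq in \<open>auto simp: Gs_def ts_def ns_def\<close>)
  have Ws: "Ws = map (\<lambda>l. mat m \<rho> (\<lambda>(i, r). cnj (right_coeff (\<lambda>j. ts $ j) (\<lambda>j. ns $ j) l (dr $ i)) * Hs $$ (i, r))) [0..<k]"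
    unfolding Ws_def by (subst result_fadi_right) (auto simp: Hs_def)
  have "result (fadi_block \<kappa> \<tau> \<nu> n' \<epsilon> d G H s t m) = (hconcat m \<rho> Zs, hconcat m \<rho> Ws)"
    unfolding fadi_block_def submatrix_rows[OF G st(1)] submatrix_rows[OF H st(2)]
    using G H by (simp add: cost_simps Zs_def Ws_def ts_def ns_def dl_def dr_def Gs_def Hs_def k)
  then have "factored (result (fadi_block \<kappa> \<tau> \<nu> n' \<epsilon> d G H s t m)) $$ (i, j)
    = (\<Sum>l<k. \<Sum>r<\<rho>. (Zs ! l) $$ (i, r) * cnj ((Ws ! l) $$ (j, r)))"
    by (simp only:) (rule factored_hconcat_index, use ij Zs Ws in auto)
  also have "\<dots> = (\<Sum>l<k. \<Sum>r<\<rho>. (left_coeff (\<tau> s t) (\<nu> s t) l (d $ (s + i)) * right_coeff (\<tau> s t) (\<nu> s t) l (d $ (t + j)))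
      * (G $$ (s + i, r) * cnj (H $$ (t + j, r))))"
    unfolding Zs Ws using ij by (intro sum.cong refl) (simp add: lc rc dl_def dr_def Gs_def Hs_def)
  finally show ?thesis by (simp only: sum_product)
qed

lemma fadi_block_fits:
  assumes "G \<in> carrier_mat n \<rho>" "H \<in> carrier_mat n \<rho>" "s + m \<le> n" "t + m \<le> n"
    and neq: "\<And>j. j < num_steps n' \<epsilon> m \<Longrightarrow> \<tau> s t j \<noteq> \<nu> s t j"
  obtains Z W where "result (fadi_block \<kappa> \<tau> \<nu> n' \<epsilon> d G H s t m) = (Z, W)"
    "Z \<in> carrier_mat m (num_steps n' \<epsilon> m * \<rho>)" "W \<in> carrier_mat m (num_steps n' \<epsilon> m * \<rho>)"
proof -
  have dims: "dim_col G = \<rho>" "dim_col H = \<rho>" using assms by auto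
  show ?thesis
  proof (rule that)
    show "result (fadi_block \<kappa> \<tau> \<nu> n' \<epsilon> d G H s t m) = (fst (result (fadi_block \<kappa> \<tau> \<nu> n' \<epsilon> d G H s t m)), snd (result (fadi_block \<kappa> \<tau> \<nu> n' \<epsilon> d G H s t m)))"
      by simp
    show "fst (result (fadi_block \<kappa> \<tau> \<nu> n' \<epsilon> d G H s t m)) \<in> carrier_mat m (num_steps n' \<epsilon> m * \<rho>)"
      using neq by (simp add: fadi_block_def cost_simps dims result_fadi_left hconcat_carrier)
    show "snd (result (fadi_block \<kappa> \<tau> \<nu> n' \<epsilon> d G H s t m)) \<in> carrier_mat m (num_steps n' \<epsilon> m * \<rho>)"
      by (simp add: fadi_block_def cost_simps dims result_fadi_right hconcat_carrier)
  qed
qed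

lemma ops_fadi_block:
  assumes "G \<in> carrier_mat n \<rho>" "H \<in> carrier_mat n \<rho>" "s + m \<le> n" "t + m \<le> n"
  shows "ops (fadi_block \<kappa> \<tau> \<nu> n' \<epsilon> d G H s t m)
    \<le> \<kappa> + num_steps n' \<epsilon> m * (2 * \<kappa> + 6 + 10 * m * \<rho>)"
proof -
  let ?k = "num_steps n' \<epsilon> m"
  define Gs where "Gs = submatrix G {s..<s + m} UNIV"
  define Hs where "Hs = submatrix H {t..<t + m} UNIV"
  have d: "dim_row Gs = m" "dim_col Gs = \<rho>" "dim_row Hs = m" "dim_col Hs = \<rho>"
    unfolding Gs_def Hs_def submatrix_rows[OF assms(1,3)] submatrix_rows[OF assms(2,4)] by auto
  have "ops (fadi_block \<kappa> \<tau> \<nu> n' \<epsilon> d G H s t m) = \<kappa> + (?k * \<kappa> + (?k * \<kappa> +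
      (ops (fadi_left (vec m (\<lambda>i. d $ (s + i))) (vec ?k (\<tau> s t)) (vec ?k (\<nu> s t)) Gs ?k)
     + ops (fadi_right (vec m (\<lambda>i. d $ (t + i))) (vec ?k (\<tau> s t)) (vec ?k (\<nu> s t)) Hs ?k))))"
    by (simp add: fadi_block_def cost_simps Gs_def Hs_def)
  also have "\<dots> \<le> \<kappa> + (?k * \<kappa> + (?k * \<kappa> + (?k * (3 + 5 * m * \<rho>) + ?k * (3 + 5 * m * \<rho>))))"
    using ops_fadi_left[where G = Gs] ops_fadi_right[where H = Hs] unfolding d by (intro add_mono order_refl) auto
  also have "\<dots> = \<kappa> + ?k * (2 * \<kappa> + 6 + 10 * m * \<rho>)" by (simp add: algebra_simps)
  finally show ?thesis .
qed

section \<open>Errors of the off-diagonal blocks\<close>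

text \<open>Supplies what the arc lemmas ask of a block: siblings are adjacent, and
  \<open>2 * m\<close> does not exceed the matrix size.\<close>

lemma offdiag_blocks_range:
  assumes "(s, t, m) \<in> offdiag_blocks nmin q s0"
  shows "nmin \<le> m" "t = s + m \<or> s = t + m" "s0 \<le> s" "s0 \<le> t" "s + m \<le> s0 + 2 ^ q" "t + m \<le> s0 + 2 ^ q" "2 * m \<le> 2 ^ q"
proof -
  have "nmin \<le> m \<and> (t = s + m \<or> s = t + m) \<and> s0 \<le> s \<and> s0 \<le> t \<and> s + m \<le> s0 + 2 ^ q \<and> t + m \<le> s0 + 2 ^ q \<and> 2 * m \<le> 2 ^ q"
    using assms
  proof (induction q arbitrary: s0)
    case (Suc q)
    then have "\<not> 2 ^ q < nmin" by (auto split: if_splits)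
    then consider "(s, t, m) = (s0, s0 + 2 ^ q, 2 ^ q)" | "(s, t, m) = (s0 + 2 ^ q, s0, 2 ^ q)"
      | "(s, t, m) \<in> offdiag_blocks nmin q s0" | "(s, t, m) \<in> offdiag_blocks nmin q (s0 + 2 ^ q)"
      using Suc.prems by auto
    then show ?case
    proof cases
      case 3
      from Suc.IH[OF 3] show ?thesis by auto
    next
      case 4
      from Suc.IH[OF 4] show ?thesis by auto
    qed (use \<open>\<not> 2 ^ q < nmin\<close> in auto)
  qed simp
  then show "nmin \<le> m" "t = s + m \<or> s = t + m" "s0 \<le> s" "s0 \<le> t" "s + m \<le> s0 + 2 ^ q" "t + m \<le> s0 + 2 ^ q" "2 * m \<le> 2 ^ q"
    by auto
qed

lemma finite_offdiag_blocks: "finite (offdiag_blocks nmin q s)"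
  by (induction q arbitrary: s) auto

lemma unity_root_inj: "i < n \<Longrightarrow> j < n \<Longrightarrow> unity_root n i = unity_root n j \<Longrightarrow> i = j"
proof -
  assume ij: "i < n" "j < n" and eq: "unity_root n i = unity_root n j"
  have "inj_on (\<lambda>k. cis (2 * pi * real k / real n)) {..<n}"
    using Complex.bij_betw_roots_unity[of n] ij by (auto dest: bij_betw_imp_inj_on)
  then show "i = j" using ij eq by (auto simp: unity_root_def dest: inj_onD)
qed

lemma unity_root_eq_arc:
  assumes "0 < n"
  shows "unity_root n j = cis (arc_center n t m + pi / real n * (2 * real j - 2 * real t - real m + 1))"
proof -
  have "arc_center n t m + pi / real n * (2 * real j - 2 * real t - real m + 1) = pi / real n * (2 * real j)"
    unfolding arc_center_def distrib_left[symmetric] by simp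
  also have "\<dots> = 2 * pi * real j / real n" by simp
  finally show ?thesis by (simp add: unity_root_def)
qed

lemma unity_root_col_arc:
  assumes "j \<in> {t..<t + m}" "0 < n"
  shows "unity_root n j \<in> col_arc n t m"
proof -
  let ?s = "2 * real j - 2 * real t - real m + 1"
  have "real j \<le> real t + real m - 1" "real t \<le> real j" using assms by auto
  then have "\<bar>?s\<bar> \<le> real m - 1" by linarith
  then have "pi / real n * \<bar>?s\<bar> \<le> pi / real n * (real m - 1)" by (intro mult_left_mono) auto
  then have "\<bar>pi / real n * ?s\<bar> \<le> pi / real n * (real m - 1)" by (simp add: abs_mult)
  then show ?thesis unfolding unity_root_eq_arc[OF assms(2), of j t m] col_arc_def by blast
qed

lemma unity_root_row_arc:
  assumes j: "j \<in> {s..<s + m}" and st: "t = s + m \<or> s = t + m" and n: "0 < n" "2 * m \<le> n"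
  shows "unity_root n j \<in> row_arc n t m"
proof -
  have *: "cis (arc_center n t m + pi / real n * x) \<in> row_arc n t m" if x: "real m + 1 \<le> x" "x \<le> 2 * real n - (real m + 1)" for x
  proof -
    have "pi / real n * (real m + 1) \<le> pi / real n * x" using x by (intro mult_left_mono) auto
    moreover have "pi / real n * x \<le> pi / real n * (2 * real n - (real m + 1))" using x by (intro mult_left_mono) auto
    moreover have "pi / real n * (2 * real n - (real m + 1)) = 2 * pi - pi / real n * (real m + 1)"
      using n unfolding right_diff_distrib by simp
    ultimately show ?thesis unfolding row_arc_def by auto
  qed
  have nm: "2 * real m \<le> real n" using n by linarith
  let ?x = "2 * real j - 2 * real t - real m + 1"
  show ?thesis using st
  proof
    assume "s = t + m"
    then have "real t + real m \<le> real j" "real j \<le> real t + 2 * real m - 1" using j by auto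
    then show ?thesis unfolding unity_root_eq_arc[OF n(1), of j t m] using nm by (intro *) linarith+
  next
    assume "t = s + m"
    then have jt: "real j \<le> real t - 1" "real t \<le> real j + real m" using j by auto
    \<comment> \<open>When the rows precede the columns the angle relative to the centre is
      negative; a full turn moves it into the parameter range of \<open>row_arc\<close>.\<close>
    have "pi / real n * (?x + 2 * real n) = pi / real n * ?x + 2 * pi" using n by (simp add: distrib_left)
    then have "cis (arc_center n t m + pi / real n * (?x + 2 * real n)) = cis (arc_center n t m + pi / real n * ?x) * cis (2 * pi)"
      by (simp only: cis_mult add.assoc)
    then have "unity_root n j = cis (arc_center n t m + pi / real n * (?x + 2 * real n))"
      unfolding unity_root_eq_arc[OF n(1), of j t m] by simp
    also have "\<dots> \<in> row_arc n t m" using jt nm by (intro *) linarith+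
    finally show ?thesis .
  qed
qed

text \<open>By the displacement equation the eigenvalue difference cancels against the denominator
  in \<open>adi_telescoping\<close>, leaving an error of \<open>C $$ (i, j)\<close> times a product
  of a row and a column factor, which the Zolotarev bound controls.\<close>

lemma fadi_block_error:
  fixes \<tau> \<nu> :: "nat \<Rightarrow> nat \<Rightarrow> nat \<Rightarrow> complex"
  assumes G: "G \<in> carrier_mat n \<rho>" and H: "H \<in> carrier_mat n \<rho>" and C: "C \<in> carrier_mat n n"
    and d: "\<And>i. i < n \<Longrightarrow> d $ i = unity_root n i"
    and disp: "\<And>j k. j < n \<Longrightarrow> k < n \<Longrightarrow> (unity_root n j - unity_root n k) * C $$ (j, k) = (\<Sum>r<\<rho>. G $$ (j, r) * cnj (H $$ (k, r)))"
    and st: "t = s + m \<or> s = t + m" "s + m \<le> n" "t + m \<le> n" and m: "2 \<le> m" "2 * m \<le> n"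
    and \<epsilon>: "0 < \<epsilon>"
    and shifts: "zolotarev_shifts (row_arc n t m) (col_arc n t m) (num_steps n \<epsilon> m) (\<tau> s t) (\<nu> s t)"
  shows "\<And>j. j < num_steps n \<epsilon> m \<Longrightarrow> \<tau> s t j \<noteq> \<nu> s t j"
    and "op_bound {s..<s + m} {t..<t + m}
      (\<lambda>i j. C $$ (i, j) - factored (result (fadi_block \<kappa> \<tau> \<nu> n \<epsilon> d G H s t m)) $$ (i - s, j - t))
      (\<epsilon> / log 2 (real n) * spectral_norm C)"
proof -
  define k where "k = num_steps n \<epsilon> m"
  define e where "e = \<epsilon> / log 2 (real n)"
  have n: "0 < n" using m by simp
  have e0: "0 < e" unfolding e_def using \<epsilon> m by simp
  define X where "X = (\<lambda>i j. C $$ (i, j))"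
  have X: "op_bound {s..<s + m} {t..<t + m} X (spectral_norm C)" and nn: "0 \<le> spectral_norm C"
    unfolding X_def using op_bound_spectral_norm[OF C n] st by (auto elim!: op_bound_subset)
  let ?R = "\<lambda>i j. factored (result (fadi_block \<kappa> \<tau> \<nu> n \<epsilon> d G H s t m)) $$ (i - s, j - t)"
  show neq: "\<tau> s t j \<noteq> \<nu> s t j" if "j < num_steps n \<epsilon> m" for j
  proof -
    have "0 < num_steps n \<epsilon> m" using that by simp
    from zolotarev_arcs[OF m this] obtain r where r: "r \<in> rational_pairs (num_steps n \<epsilon> m)"
      "zolotarev_ratio (row_arc n t m) (col_arc n t m) r \<le> ennreal (4 * exp (- (real (num_steps n \<epsilon> m) * pi\<^sup>2 / (2 * ln (4 * real m)))))"
      by blast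
    show ?thesis
      by (rule zolotarev_shifts_bound(1)[OF shifts infinite_row_arc[OF m(2,1)] infinite_col_arc[OF m(2,1)] r _ that]) simp
  qed
  have R: "?R i j = (\<Sum>l<k. left_coeff (\<tau> s t) (\<nu> s t) l (unity_root n i) * right_coeff (\<tau> s t) (\<nu> s t) l (unity_root n j))
      * ((unity_root n i - unity_root n j) * C $$ (i, j))" if "i \<in> {s..<s + m}" "j \<in> {t..<t + m}" for i j
  proof -
    have "i - s < m" "j - t < m" using that by auto
    from fadi_block_index[where \<tau> = \<tau> and \<nu> = \<nu> and n' = n and \<epsilon> = \<epsilon> and \<kappa> = \<kappa> and d = d, OF G H st(2,3) refl neq this]
    show ?thesis using that st by (simp add: disp d k_def)
  qed
  show "op_bound {s..<s + m} {t..<t + m} (\<lambda>i j. C $$ (i, j) - ?R i j) (\<epsilon> / log 2 (real n) * spectral_norm C)"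
  proof (cases "k = 0")
    \<comment> \<open>Zero steps occur only for tolerances \<open>e \<ge> 4\<close>; then the zero
      block is good enough, since the error is the block of \<open>C\<close> itself.\<close>
    case True
    have "op_bound {s..<s + m} {t..<t + m} (\<lambda>i j. C $$ (i, j) - ?R i j) (spectral_norm C)"
      by (rule op_bound_cong[OF X]) (simp add: R True X_def)
    moreover have "4 \<le> e"
    proof -
      have "2 / pi\<^sup>2 * ln (4 * real m) * ln (4 / e) \<le> 0"
        using True unfolding k_def num_steps_def Let_def e_def by (simp add: ceiling_le_zero)
      moreover have "0 < 2 / pi\<^sup>2 * ln (4 * real m)" using m by simp
      ultimately have "ln (4 / e) \<le> 0" by (meson mult_pos_pos not_le)
      then have "4 / e \<le> 1" using e0 by simp
      then show ?thesis using e0 by (simp add: divide_le_eq)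
    qed
    then have "spectral_norm C \<le> e * spectral_norm C" using nn mult_right_mono[of 1 e "spectral_norm C"] by simp
    ultimately show ?thesis unfolding e_def[symmetric] by (rule op_bound_mono)
  next
    case False
    then have k: "0 < k" by simp
    from zolotarev_arcs[OF m k] obtain r where r: "r \<in> rational_pairs k"
      "zolotarev_ratio (row_arc n t m) (col_arc n t m) r \<le> ennreal (4 * exp (- (real k * pi\<^sup>2 / (2 * ln (4 * real m)))))"
      by blast
    have "4 * exp (- (real k * pi\<^sup>2 / (2 * ln (4 * real m)))) \<le> e"
      using num_steps_sufficient[OF m(1) k_def k] e0 by (simp add: e_def)
    then have r2: "zolotarev_ratio (row_arc n t m) (col_arc n t m) r \<le> ennreal e"
      using r(2) by (meson ennreal_leI order_trans)
    note zb = zolotarev_shifts_bound[OF shifts[folded k_def] infinite_row_arc[OF m(2,1)] infinite_col_arc[OF m(2,1)] r(1) r2 less_imp_le[OF e0]]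
    \<comment> \<open>\<open>u\<close> and \<open>v\<close> are the optimal rational function and
      its reciprocal at the eigenvalues, without leading coefficients, which would cancel in
      \<open>u i * v j\<close>.\<close>
    define u where "u = (\<lambda>i. \<Prod>l<k. (unity_root n i - \<tau> s t l) / (unity_root n i - \<nu> s t l))"
    define v where "v = (\<lambda>j. \<Prod>l<k. (unity_root n j - \<nu> s t l) / (unity_root n j - \<tau> s t l))"
    have "op_bound {s..<s + m} {t..<t + m} (\<lambda>i j. X i j * (u i * v j)) (e * spectral_norm C)"
    proof (rule op_bound_scale[OF X nn _ less_imp_le[OF e0]])
      fix i j assume ij: "i \<in> {s..<s + m}" "j \<in> {t..<t + m}"
      have "u i * v j = (\<Prod>l<k. (unity_root n i - \<tau> s t l) / (unity_root n i - \<nu> s t l) * ((unity_root n j - \<nu> s t l) / (unity_root n j - \<tau> s t l)))"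
        unfolding u_def v_def by (rule prod.distrib[symmetric])
      then show "cmod (u i * v j) \<le> e"
        using zb(4)[OF unity_root_row_arc[OF ij(1) st(1) n m(2)] unity_root_col_arc[OF ij(2) n]] by (simp only:)
    qed simp
    then show ?thesis unfolding e_def[symmetric]
    proof (rule op_bound_cong)
      fix i j assume ij: "i \<in> {s..<s + m}" "j \<in> {t..<t + m}"
      have ne: "unity_root n i \<noteq> unity_root n j"
        using unity_root_inj[of i n j] ij st by auto
      have "?R i j = (1 - u i * v j) / (unity_root n i - unity_root n j) * ((unity_root n i - unity_root n j) * C $$ (i, j))"
        unfolding R[OF ij] u_def v_def prod.distrib[symmetric]
        by (subst adi_telescoping)
          (use zb(2)[OF unity_root_row_arc[OF ij(1) st(1) n m(2)]] zb(3)[OF unity_root_col_arc[OF ij(2) n]] ne in auto)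
      also have "\<dots> = (1 - u i * v j) * C $$ (i, j)" using ne by simp
      finally show "X i j * (u i * v j) = C $$ (i, j) - ?R i j"
        by (simp add: X_def algebra_simps)
    qed
  qed
qed

lemma result_sum_c: "result (sum_c k f) = (\<Sum>i<k. result (f i))"
  by (induction k) (simp_all add: cost_simps)

lemma ops_sum_c: "ops (sum_c k f) = (\<Sum>i<k. ops (f i)) + k"
  by (induction k) (simp_all add: cost_simps)

lemma result_leaf_block:
  assumes G: "G \<in> carrier_mat n \<rho>" and C: "C \<in> carrier_mat n n"
    and d: "\<And>i. i < n \<Longrightarrow> d $ i = unity_root n i"
    and c: "\<And>i. i < n \<Longrightarrow> c $ i = C $$ (i, i)"
    and disp: "\<And>j k. j < n \<Longrightarrow> k < n \<Longrightarrow> (unity_root n j - unity_root n k) * C $$ (j, k) = (\<Sum>r<\<rho>. G $$ (j, r) * cnj (H $$ (k, r)))"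
    and s: "s + m \<le> n"
  shows "result (leaf_block d c G H s m) = mat m m (\<lambda>(i, j). C $$ (s + i, s + j))"
proof (rule eq_matI)
  fix i j assume "i < dim_row (mat m m (\<lambda>(i, j). C $$ (s + i, s + j)))" "j < dim_col (mat m m (\<lambda>(i, j). C $$ (s + i, s + j)))"
  then have ij: "i < m" "j < m" by auto
  show "result (leaf_block d c G H s m) $$ (i, j) = mat m m (\<lambda>(i, j). C $$ (s + i, s + j)) $$ (i, j)"
  proof (cases "i = j")
    case True
    then show ?thesis using ij s c by (simp add: leaf_block_def cost_simps)
  next
    case False
    then have "unity_root n (s + i) - unity_root n (s + j) \<noteq> 0"
      using unity_root_inj[of "s + i" n "s + j"] ij s by auto
    moreover have "dim_col G = \<rho>" using G by simp
    ultimately show ?thesis using False ij s disp[of "s + i" "s + j", symmetric] d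
      by (simp add: leaf_block_def collect_mat_def bind_costed_def result_sum_c) (simp add: cost_simps)
  qed
qed (simp_all add: leaf_block_def cost_simps)

lemma ops_leaf_block:
  assumes "dim_col G = \<rho>"
  shows "ops (leaf_block d c G H s m) \<le> m * (m * (3 * \<rho> + 2))"
proof -
  have "ops (leaf_block d c G H s m) \<le> (\<Sum>i<m. \<Sum>j<m. 3 * \<rho> + 2)"
    unfolding leaf_block_def collect_mat_def costed.sel
    by (intro sum_mono) (simp add: cost_simps ops_sum_c assms)
  then show ?thesis by simp
qed

section \<open>The HODLR construction\<close>

text \<open>The bound \<open>q * \<delta>\<close> charges one \<open>\<delta>\<close> to each level.
  The last claim, that the stored products sit unchanged at their positions, serves the rank bound.
  The set \<open>S\<close> stays fixed in the induction, so the hypotheses on blocks pass to both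
  subtrees.\<close>

lemma hodlr_build_correct:
  fixes \<tau> \<nu> :: "nat \<Rightarrow> nat \<Rightarrow> nat \<Rightarrow> complex" and \<kappa> n :: nat
  defines "F \<equiv> \<lambda>d G H \<epsilon> s t m. result (fadi_block \<kappa> \<tau> \<nu> n \<epsilon> d G H s t m)"
  assumes C: "C \<in> carrier_mat n n"
    and leaf: "\<And>s m. s + m \<le> n \<Longrightarrow> result (leaf_block d c G H s m) = mat m m (\<lambda>(i, j). C $$ (s + i, s + j))"
    and fits: "\<And>s t m. (s, t, m) \<in> S \<Longrightarrow> fits_factors m (F d G H \<epsilon> s t m)"
    and err: "\<And>s t m. (s, t, m) \<in> S \<Longrightarrow> op_bound {s..<s + m} {t..<t + m}
      (\<lambda>i j. C $$ (i, j) - factored (F d G H \<epsilon> s t m) $$ (i - s, j - t)) \<delta>"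
    and \<delta>: "0 \<le> \<delta>" and sub: "offdiag_blocks nmin q s \<subseteq> S" and s: "s + 2 ^ q \<le> n"
  defines "h \<equiv> \<lambda>q s. result (hodlr_build \<kappa> \<tau> \<nu> n \<epsilon> d c G H nmin q s)"
  shows "fits_partition nmin q (h q s) \<and> hodlr_mat (h q s) \<in> carrier_mat (2 ^ q) (2 ^ q)
    \<and> op_bound {s..<s + 2 ^ q} {s..<s + 2 ^ q} (\<lambda>i j. C $$ (i, j) - hodlr_mat (h q s) $$ (i - s, j - s)) (real q * \<delta>)
    \<and> (\<forall>(s', t', m) \<in> offdiag_blocks nmin q s. \<forall>i<m. \<forall>j<m.
        hodlr_mat (h q s) $$ (s' - s + i, t' - s + j) = factored (F d G H \<epsilon> s' t' m) $$ (i, j))"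
  using sub s
proof (induction q arbitrary: s)
  case leaf0: 0
  have "h 0 s = Leaf (mat 1 1 (\<lambda>(i, j). C $$ (s + i, s + j)))"
    using leaf[of s 1] leaf0 by (simp add: h_def cost_simps)
  then show ?case
    by (auto simp: op_bound_def L2_set_def)
next
  case (Suc q)
  show ?case
  proof (cases "2 ^ q < nmin")
    case True
    have h: "h (Suc q) s = Leaf (mat (2 ^ Suc q) (2 ^ Suc q) (\<lambda>(i, j). C $$ (s + i, s + j)))"
      using leaf[of s "2 ^ Suc q"] Suc.prems True by (simp add: h_def bind_costed_def return_def)
    \<comment> \<open>A leaf reproduces \<open>C\<close> exactly; the error 0 is within the
      allowance of the levels that are no longer split.\<close>
    have z: "op_bound {s..<s + 2 ^ Suc q} {s..<s + 2 ^ Suc q} (\<lambda>i j. 0) (real (Suc q) * \<delta>)"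
      unfolding op_bound_def using \<delta> by (auto simp: L2_set_def intro!: mult_nonneg_nonneg sum_nonneg)
    have "op_bound {s..<s + 2 ^ Suc q} {s..<s + 2 ^ Suc q} (\<lambda>i j. C $$ (i, j) - hodlr_mat (h (Suc q) s) $$ (i - s, j - s)) (real (Suc q) * \<delta>)"
      by (rule op_bound_cong[OF z]) (auto simp: h)
    then show ?thesis using True unfolding h by simp
  next
    case False
    define N :: nat where "N = 2 ^ q"
    define X where "X = F d G H \<epsilon> s (s + N) N"
    define Y where "Y = F d G H \<epsilon> (s + N) s N"
    have N2: "2 ^ Suc q = N + N" by (simp add: N_def)
    have hS: "h (Suc q) s = Node (h q s) X Y (h q (s + N))"
      using False by (simp add: h_def bind_costed_def return_def X_def Y_def F_def N_def)
    have ob: "offdiag_blocks nmin (Suc q) s = {(s, s + N, N), (s + N, s, N)} \<union> offdiag_blocks nmin q s \<union> offdiag_blocks nmin q (s + N)"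
      using False by (simp add: N_def)
    have inS: "(s, s + N, N) \<in> S" "(s + N, s, N) \<in> S" using Suc.prems(1) unfolding ob by auto
    have A: "fits_partition nmin q (h q s)" "hodlr_mat (h q s) \<in> carrier_mat N N"
      "op_bound {s..<s + N} {s..<s + N} (\<lambda>i j. C $$ (i, j) - hodlr_mat (h q s) $$ (i - s, j - s)) (real q * \<delta>)"
      and Ab: "\<And>s' t' m i j. (s', t', m) \<in> offdiag_blocks nmin q s \<Longrightarrow> i < m \<Longrightarrow> j < m \<Longrightarrow>
        hodlr_mat (h q s) $$ (s' - s + i, t' - s + j) = factored (F d G H \<epsilon> s' t' m) $$ (i, j)"
      using Suc.IH[of s] Suc.prems unfolding ob N2 by (auto simp: N_def)
    have B: "fits_partition nmin q (h q (s + N))" "hodlr_mat (h q (s + N)) \<in> carrier_mat N N"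
      "op_bound {s + N..<s + N + N} {s + N..<s + N + N} (\<lambda>i j. C $$ (i, j) - hodlr_mat (h q (s + N)) $$ (i - (s + N), j - (s + N))) (real q * \<delta>)"
      and Bb: "\<And>s' t' m i j. (s', t', m) \<in> offdiag_blocks nmin q (s + N) \<Longrightarrow> i < m \<Longrightarrow> j < m \<Longrightarrow>
        hodlr_mat (h q (s + N)) $$ (s' - (s + N) + i, t' - (s + N) + j) = factored (F d G H \<epsilon> s' t' m) $$ (i, j)"
      using Suc.IH[of "s + N"] Suc.prems unfolding ob N2 by (auto simp: N_def)
    have fXY: "fits_factors N X" "fits_factors N Y" using fits inS by (auto simp: X_def Y_def)
    have cX: "factored X \<in> carrier_mat N N" and cY: "factored Y \<in> carrier_mat N N"
      using fXY by (cases X; cases Y; auto intro!: mult_carrier_mat mat_adjoint_carrier)+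
    define M where "M = four_block_mat (hodlr_mat (h q s)) (factored X) (factored Y) (hodlr_mat (h q (s + N)))"
    have M: "hodlr_mat (h (Suc q) s) = M" by (simp add: hS M_def)
    have cM: "M \<in> carrier_mat (N + N) (N + N)" unfolding M_def by (rule four_block_carrier_mat[OF A(2) B(2)])
    have ix: "M $$ (i, j) = (if i < N then if j < N then hodlr_mat (h q s) $$ (i, j) else factored X $$ (i, j - N)
      else if j < N then factored Y $$ (i - N, j) else hodlr_mat (h q (s + N)) $$ (i - N, j - N))" if "i < N + N" "j < N + N" for i j
      unfolding M_def using that A(2) B(2) by (subst index_mat_four_block) auto
    let ?E = "\<lambda>i j. C $$ (i, j) - M $$ (i - s, j - s)"
    have "op_bound ({s..<s + N} \<union> {s + N..<s + N + N}) ({s..<s + N} \<union> {s + N..<s + N + N}) ?E (real q * \<delta> + \<delta>)"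
    proof (rule op_bound_block)
      show "op_bound {s..<s + N} {s..<s + N} ?E (real q * \<delta>)"
        by (rule op_bound_cong[OF A(3)]) (auto simp: ix)
      show "op_bound {s + N..<s + N + N} {s + N..<s + N + N} ?E (real q * \<delta>)"
        by (rule op_bound_cong[OF B(3)]) (auto simp: ix)
      show "op_bound {s..<s + N} {s + N..<s + N + N} ?E \<delta>"
        by (rule op_bound_cong[OF err[OF inS(1)]]) (auto simp: ix X_def)
      show "op_bound {s + N..<s + N + N} {s..<s + N} ?E \<delta>"
        by (rule op_bound_cong[OF err[OF inS(2)]]) (auto simp: ix Y_def)
    qed (use \<delta> in auto)
    moreover have "{s..<s + N} \<union> {s + N..<s + N + N} = {s..<s + 2 ^ Suc q}" unfolding N2 by auto
    ultimately have E: "op_bound {s..<s + 2 ^ Suc q} {s..<s + 2 ^ Suc q} ?E (real (Suc q) * \<delta>)"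
      by (simp add: distrib_right add.commute)
    have blocks: "M $$ (s' - s + i, t' - s + j) = factored (F d G H \<epsilon> s' t' m) $$ (i, j)"
      if st: "(s', t', m) \<in> offdiag_blocks nmin (Suc q) s" and ij: "i < m" "j < m" for s' t' m i j
    proof -
      consider "(s', t', m) = (s, s + N, N)" | "(s', t', m) = (s + N, s, N)"
        | "(s', t', m) \<in> offdiag_blocks nmin q s" | "(s', t', m) \<in> offdiag_blocks nmin q (s + N)"
        using st unfolding ob by blast
      then show ?thesis
      proof cases
        case 3
        have "s' + m \<le> s + N" "t' + m \<le> s + N" "s \<le> s'" "s \<le> t'"
          using offdiag_blocks_range(3-6)[OF 3] by (simp_all add: N_def)
        then have "s' - s + i < N" "t' - s + j < N" using ij by linarith+
        then show ?thesis using Ab[OF 3 ij] by (subst ix) simp_all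
      next
        case 4
        define i' where "i' = s' - (s + N) + i"
        define j' where "j' = t' - (s + N) + j"
        have "s' + m \<le> s + N + N" "t' + m \<le> s + N + N" "s + N \<le> s'" "s + N \<le> t'"
          using offdiag_blocks_range(3-6)[OF 4] by (simp_all add: N_def)
        then have e: "s' - s + i = N + i'" "t' - s + j = N + j'" "i' < N" "j' < N"
          unfolding i'_def j'_def using ij by linarith+
        have "M $$ (N + i', N + j') = hodlr_mat (h q (s + N)) $$ (i', j')"
          using e(3,4) by (subst ix) simp_all
        then show ?thesis unfolding e(1,2) using Bb[OF 4 ij] unfolding i'_def j'_def by (simp only:)
      qed (use ij in \<open>auto simp: ix X_def Y_def\<close>)
    qed
    have fp: "fits_partition nmin (Suc q) (h (Suc q) s)"
      using A(1) B(1) fXY False unfolding hS by (simp add: N_def)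
    show ?thesis
      unfolding M
    proof (intro conjI ballI)
      show "fits_partition nmin (Suc q) (h (Suc q) s)" by (rule fp)
      show "M \<in> carrier_mat (2 ^ Suc q) (2 ^ Suc q)" unfolding N2 by (rule cM)
      show "op_bound {s..<s + 2 ^ Suc q} {s..<s + 2 ^ Suc q} ?E (real (Suc q) * \<delta>)" by (rule E)
      fix x assume x: "x \<in> offdiag_blocks nmin (Suc q) s"
      obtain s' t' m where "x = (s', t', m)" by (cases x)
      then show "case x of (s', t', m) \<Rightarrow> \<forall>i<m. \<forall>j<m. M $$ (s' - s + i, t' - s + j) = factored (F d G H \<epsilon> s' t' m) $$ (i, j)"
        using blocks x by (simp del: offdiag_blocks.simps)
    qed
  qed
qed

text \<open>If the logarithm of \<open>4 / \<epsilon>\<^sub>v\<close> is negative, the real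
  expression is decreasing in \<open>m\<close>, but then it is nonpositive and \<open>nat\<close>
  truncates it to 0.\<close>

lemma num_steps_mono:
  assumes "1 \<le> m" "m \<le> m'"
  shows "num_steps n \<epsilon> m \<le> num_steps n \<epsilon> m'"
proof (cases "0 \<le> ln (4 / (\<epsilon> / log 2 (real n)))")
  case True
  have "ln (4 * real m) \<le> ln (4 * real m')" using assms by simp
  then have "2 / pi\<^sup>2 * ln (4 * real m) * ln (4 / (\<epsilon> / log 2 (real n))) \<le> 2 / pi\<^sup>2 * ln (4 * real m') * ln (4 / (\<epsilon> / log 2 (real n)))"
    using True by (intro mult_right_mono mult_left_mono) auto
  then show ?thesis unfolding num_steps_def Let_def by (intro nat_mono ceiling_mono)
next
  case False
  have "0 \<le> ln (4 * real m)" using assms by simp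
  then have "2 / pi\<^sup>2 * ln (4 * real m) * ln (4 / (\<epsilon> / log 2 (real n))) \<le> 0"
    using False by (intro mult_nonneg_nonpos) auto
  then show ?thesis unfolding num_steps_def Let_def by (simp add: ceiling_le_zero)
qed

text \<open>The leaf term is linear in the number of indices and is thus preserved when two halves
  are added. The two fADI blocks of a vertex cost at most a constant per index, which yields the
  second term with one share for each level.\<close>

lemma ops_hodlr_build:
  fixes \<tau> \<nu> :: "nat \<Rightarrow> nat \<Rightarrow> nat \<Rightarrow> complex"
  assumes G: "G \<in> carrier_mat n \<rho>" and H: "H \<in> carrier_mat n \<rho>" and nmin: "2 \<le> nmin"
    and K: "\<And>m. 1 \<le> m \<Longrightarrow> m \<le> n \<Longrightarrow> num_steps n \<epsilon> m \<le> K"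
  shows "s + 2 ^ q \<le> n \<Longrightarrow> ops (hodlr_build \<kappa> \<tau> \<nu> n \<epsilon> d c G H nmin q s)
    \<le> 2 ^ q * (2 * nmin * (3 * \<rho> + 2)) + q * 2 ^ q * (\<kappa> + K * (2 * \<kappa> + 6 + 10 * \<rho>))"
proof (induction q arbitrary: s)
  case 0
  have "ops (hodlr_build \<kappa> \<tau> \<nu> n \<epsilon> d c G H nmin 0 s) = ops (leaf_block d c G H s 1)"
    by (simp add: bind_costed_def return_def)
  also have "\<dots> \<le> 1 * (1 * (3 * \<rho> + 2))" by (rule ops_leaf_block) (use G in simp)
  also have "\<dots> \<le> 2 * nmin * (3 * \<rho> + 2)" using mult_le_mono1[of 1 "2 * nmin" "3 * \<rho> + 2"] nmin by simp
  finally show ?case by simp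
next
  case (Suc q)
  show ?case
  proof (cases "2 ^ q < nmin")
    case True
    then have "ops (hodlr_build \<kappa> \<tau> \<nu> n \<epsilon> d c G H nmin (Suc q) s) = ops (leaf_block d c G H s (2 ^ Suc q))"
      by (simp add: bind_costed_def return_def)
    also have "\<dots> \<le> 2 ^ Suc q * (2 ^ Suc q * (3 * \<rho> + 2))" by (rule ops_leaf_block) (use G in simp)
    \<comment> \<open>A vertex is a leaf once its halves are smaller than \<open>nmin\<close>, so a
      leaf has fewer than \<open>2 * nmin\<close> indices; only one of the two size factors is
      replaced.\<close>
    also have "\<dots> \<le> 2 ^ Suc q * (2 * nmin * (3 * \<rho> + 2))" using True by (intro mult_left_mono mult_right_mono) auto
    finally show ?thesis by (rule trans_le_add1)
  next
    case False
    define N :: nat where "N = 2 ^ q"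
    define b where "b = \<kappa> + K * (2 * \<kappa> + 6 + 10 * \<rho>)"
    have N: "1 \<le> N" "s + N \<le> n" "s + N + N \<le> n" using Suc.prems by (auto simp: N_def)
    have blk: "ops (fadi_block \<kappa> \<tau> \<nu> n \<epsilon> d G H s' t' N) \<le> N * b" if "s' + N \<le> n" "t' + N \<le> n" for s' t'
    proof -
      have "ops (fadi_block \<kappa> \<tau> \<nu> n \<epsilon> d G H s' t' N) \<le> \<kappa> + num_steps n \<epsilon> N * (2 * \<kappa> + 6 + 10 * N * \<rho>)"
        by (rule ops_fadi_block[OF G H that])
      also have "\<dots> \<le> \<kappa> + K * (2 * \<kappa> + 6 + 10 * N * \<rho>)" using K[of N] N by (intro add_left_mono mult_right_mono) auto
      also have "\<dots> \<le> N * \<kappa> + K * (N * (2 * \<kappa> + 6 + 10 * \<rho>))"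
      proof (intro add_mono mult_left_mono)
        have "2 * \<kappa> + 6 \<le> N * (2 * \<kappa> + 6)" using N(1) by simp
        then show "2 * \<kappa> + 6 + 10 * N * \<rho> \<le> N * (2 * \<kappa> + 6 + 10 * \<rho>)" by (simp add: distrib_left mult_ac)
      qed (use N in auto)
      also have "\<dots> = N * b" by (simp add: b_def algebra_simps)
      finally show ?thesis .
    qed
    have "ops (hodlr_build \<kappa> \<tau> \<nu> n \<epsilon> d c G H nmin (Suc q) s) =
      ops (hodlr_build \<kappa> \<tau> \<nu> n \<epsilon> d c G H nmin q s) + (ops (fadi_block \<kappa> \<tau> \<nu> n \<epsilon> d G H s (s + N) N) +
      (ops (fadi_block \<kappa> \<tau> \<nu> n \<epsilon> d G H (s + N) s N) + ops (hodlr_build \<kappa> \<tau> \<nu> n \<epsilon> d c G H nmin q (s + N))))"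
      using False by (simp add: bind_costed_def return_def N_def)
    also have "\<dots> \<le> (N * (2 * nmin * (3 * \<rho> + 2)) + q * N * b) + (N * b + (N * b + (N * (2 * nmin * (3 * \<rho> + 2)) + q * N * b)))"
      using N Suc.IH[of s] Suc.IH[of "s + N"] by (intro add_mono blk) (auto simp: N_def b_def)
    also have "\<dots> = 2 ^ Suc q * (2 * nmin * (3 * \<rho> + 2)) + Suc q * 2 ^ Suc q * b" by (simp add: N_def algebra_simps)
    finally show ?thesis by (simp add: b_def)
  qed
qed

lemma lnln4_pos: "0 < ln (ln (4 :: real))" and ln4_gt_1: "1 < ln (4 :: real)"
proof -
  have "exp 1 < (4 :: real)" using exp_le by simp
  then show "1 < ln (4 :: real)" by (subst exp_less_cancel_iff[symmetric]) simp
  then show "0 < ln (ln (4 :: real))" by simp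
qed

text \<open>For \<open>n \<ge> 4\<close> the quantity \<open>ln (ln n)\<close> is at least
  \<open>ln (ln 4) > 0\<close>, so additive constants can be absorbed into the product of
  logarithms.\<close>

lemma num_steps_bound:
  obtains c where "0 \<le> c" "\<And>n \<epsilon>. 4 \<le> n \<Longrightarrow> 0 < \<epsilon> \<Longrightarrow>
    real (num_steps n \<epsilon> n) \<le> c * (ln (real n) * (ln (ln (real n)) + \<bar>ln \<epsilon>\<bar>))"
proof -
  define a where "a = ln (ln (4 :: real))"
  define b where "b = ln 4 - ln (ln (2 :: real))"
  have a: "0 < a" unfolding a_def by (rule lnln4_pos)
  have "ln (2 :: real) < 1" using ln_less_self[of "2 :: real"] ln_2_less_1 by simp
  then have "ln (ln (2 :: real)) < 0" by simp
  then have b: "0 \<le> b" unfolding b_def using ln4_gt_1 by linarith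
  \<comment> \<open>\<open>4 / pi^2\<close> comes from \<open>ln (4 n) \<le> 2 ln n\<close>,
    \<open>b / a\<close> absorbs the constant \<open>ln 4 - ln (ln 2)\<close> of the second
    logarithm, and \<open>1 / a\<close> the rounding up.\<close>
  define c where "c = 4 / pi\<^sup>2 * (1 + b / a) + 1 / a"
  have c: "0 \<le> c" unfolding c_def using a b by (intro add_nonneg_nonneg mult_nonneg_nonneg) auto
  have "real (num_steps n \<epsilon> n) \<le> c * (ln (real n) * (ln (ln (real n)) + \<bar>ln \<epsilon>\<bar>))" if n: "4 \<le> n" and \<epsilon>: "0 < \<epsilon>" for n \<epsilon>
  proof -
    define l where "l = ln (real n)"
    define L where "L = ln (ln (real n)) + \<bar>ln \<epsilon>\<bar>"
    have l4: "ln 4 \<le> l" unfolding l_def using n by simp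
    then have l: "1 \<le> l" using ln4_gt_1 by linarith
    have "a \<le> ln l" unfolding a_def using l4 ln4_gt_1 by (subst ln_le_cancel_iff) auto
    then have L: "a \<le> L" unfolding L_def l_def by linarith
    define x where "x = 2 / pi\<^sup>2 * ln (4 * real n) * ln (4 / (\<epsilon> / log 2 (real n)))"
    have lg: "log 2 (real n) = l / ln 2" by (simp add: log_def l_def)
    have "ln (4 / (\<epsilon> / log 2 (real n))) = ln 4 + (ln l - ln (ln 2)) - ln \<epsilon>"
      unfolding lg using \<epsilon> l by (simp add: ln_div ln_mult)
    also have "\<dots> \<le> b + L" unfolding b_def L_def l_def by linarith
    also have "\<dots> \<le> (1 + b / a) * L"
    proof -
      have "b = b / a * a" using a by simp
      also have "\<dots> \<le> b / a * L" using L a b by (intro mult_left_mono) auto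
      finally show ?thesis by (simp add: distrib_right)
    qed
    finally have y: "ln (4 / (\<epsilon> / log 2 (real n))) \<le> (1 + b / a) * L" .
    have "ln (4 * real n) \<le> 2 * l" unfolding l_def using n by (simp add: ln_mult)
    moreover have "0 \<le> ln (4 * real n)" using n by simp
    ultimately have "x \<le> 2 / pi\<^sup>2 * (2 * l) * ((1 + b / a) * L)"
      unfolding x_def using y L a b l by (smt (verit) mult_left_mono mult_right_mono mult_nonneg_nonneg divide_nonneg_nonneg zero_le_power2)
    then have x: "x \<le> 4 / pi\<^sup>2 * (1 + b / a) * (l * L)" by (simp add: mult_ac)
    have "1 \<le> 1 / a * (l * L)"
    proof -
      have "1 * a \<le> l * L" using l L a by (intro mult_mono) auto
      then show ?thesis using a by (simp add: field_simps)
    qed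
    then have "x + 1 \<le> c * (l * L)" unfolding c_def distrib_right using x by linarith
    moreover have "0 \<le> c * (l * L)" using c l L a by simp
    moreover have "real (num_steps n \<epsilon> n) \<le> max 0 (x + 1)"
      unfolding num_steps_def Let_def x_def[symmetric] by linarith
    ultimately show ?thesis unfolding l_def L_def by linarith
  qed
  with c show thesis by (rule that)
qed

lemma hodlr_construction_result:
  assumes n: "n = 2 ^ p" and G: "G \<in> carrier_mat n \<rho>" and H: "H \<in> carrier_mat n \<rho>"
    and a: "dim_vec (result avg) = n"
  defines "c \<equiv> vec n (\<lambda>j. \<Sum>k<n. unity_root n (j * k) * result avg $ k)"
    and "d \<equiv> vec n (\<lambda>j. unity_root n j)"
  shows "result (hodlr_construction \<kappa> \<tau> \<nu> \<epsilon> nmin p avg G H)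
      = result (hodlr_build \<kappa> \<tau> \<nu> n \<epsilon> d c (dft_mat n * G) (dft_mat n * H) nmin p 0)"
    and "ops (hodlr_construction \<kappa> \<tau> \<nu> \<epsilon> nmin p avg G H)
      = 2 * (\<rho> * (2 * p * n) + 1 + n * \<rho>) + ops avg + 2 * p * n + n
        + ops (hodlr_build \<kappa> \<tau> \<nu> n \<epsilon> d c (dft_mat n * G) (dft_mat n * H) nmin p 0)"
proof -
  have c: "result (fft p (result avg)) = c" unfolding c_def n by (rule result_fft) (use a n in simp)
  have r: "result (fft_cols p G) = dft_mat n * G" "result (fft_cols p H) = dft_mat n * H"
    using G H unfolding n by (auto intro!: result_fft_cols)
  have d: "result (collect_vec (2 ^ p) (\<lambda>j. root_c (2 ^ p) j)) = d" "ops (collect_vec (2 ^ p) (\<lambda>j. root_c (2 ^ p) j)) = n"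
    by (simp_all add: cost_simps d_def n)
  have o: "ops (fft_cols p G) = \<rho> * (2 * p * n) + 1 + n * \<rho>" "ops (fft_cols p H) = \<rho> * (2 * p * n) + 1 + n * \<rho>"
    unfolding n by (rule ops_fft_cols, use G H in simp)+
  show "result (hodlr_construction \<kappa> \<tau> \<nu> \<epsilon> nmin p avg G H)
      = result (hodlr_build \<kappa> \<tau> \<nu> n \<epsilon> d c (dft_mat n * G) (dft_mat n * H) nmin p 0)"
    unfolding hodlr_construction_def bind_costed_def costed.sel r c d n ..
  show "ops (hodlr_construction \<kappa> \<tau> \<nu> \<epsilon> nmin p avg G H)
      = 2 * (\<rho> * (2 * p * n) + 1 + n * \<rho>) + ops avg + 2 * p * n + n
        + ops (hodlr_build \<kappa> \<tau> \<nu> n \<epsilon> d c (dft_mat n * G) (dft_mat n * H) nmin p 0)"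
    unfolding hodlr_construction_def bind_costed_def costed.sel r c d o ops_fft by (simp add: n)
qed

text \<open>Each of at most \<open>p = log 2 n\<close> levels contributes the error
  \<open>\<epsilon> / log 2 n\<close> times the norm of \<open>C\<close>, and the sum is the
  required bound.\<close>

lemma hodlr_construction_correct:
  fixes \<tau> \<nu> :: "nat \<Rightarrow> nat \<Rightarrow> nat \<Rightarrow> complex" and \<kappa> :: nat
  assumes n: "n = 2 ^ p" "4 \<le> n" and \<epsilon>: "0 < \<epsilon>" and nmin: "2 \<le> nmin"
    and T: "T \<in> carrier_mat n n" and G: "G \<in> carrier_mat n \<rho>" and H: "H \<in> carrier_mat n \<rho>"
    and disp: "cyclic_shift n * T - T * cyclic_shift n = G * mat_adjoint H"
    and avg: "result avg = col (circulant_proj T) 0"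
    and shifts: "\<And>s t m. (s, t, m) \<in> offdiag_blocks nmin p 0 \<Longrightarrow>
      zolotarev_shifts (row_arc n t m) (col_arc n t m) (num_steps n \<epsilon> m) (\<tau> s t) (\<nu> s t)"
  defines "C \<equiv> transformed n T" and "h \<equiv> result (hodlr_construction \<kappa> \<tau> \<nu> \<epsilon> nmin p avg G H)"
  shows "fits_partition nmin p h" "spectral_norm (C - hodlr_mat h) \<le> \<epsilon> * spectral_norm C"
    "hodlr_rank nmin p (hodlr_mat h) \<le> num_steps n \<epsilon> n * \<rho>"
proof -
  have n0: "0 < n" using n by simp
  have C: "C \<in> carrier_mat n n" unfolding C_def by (rule transformed_carrier[OF T])
  define c where "c = vec n (\<lambda>j. \<Sum>k<n. unity_root n (j * k) * result avg $ k)"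
  define d where "d = vec n (\<lambda>j. unity_root n j)"
  define Gt where "Gt = dft_mat n * G"
  define Ht where "Ht = dft_mat n * H"
  have Gt: "Gt \<in> carrier_mat n \<rho>" and Ht: "Ht \<in> carrier_mat n \<rho>"
    unfolding Gt_def Ht_def by (auto intro!: mult_carrier_mat[OF dft_mat_carrier] G H)
  have da: "dim_vec (result avg) = n" unfolding avg using T by (simp add: circulant_proj_def Let_def)
  have h: "h = result (hodlr_build \<kappa> \<tau> \<nu> n \<epsilon> d c Gt Ht nmin p 0)"
    unfolding h_def c_def d_def Gt_def Ht_def by (rule hodlr_construction_result(1)[OF n(1) G H da])
  have di: "d $ i = unity_root n i" if "i < n" for i using that by (simp add: d_def)
  have ci: "c $ i = C $$ (i, i)" if "i < n" for i
    using that transformed_diag[OF T that] by (simp add: c_def C_def avg)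
  have ds: "(unity_root n j - unity_root n k) * C $$ (j, k) = (\<Sum>r<\<rho>. Gt $$ (j, r) * cnj (Ht $$ (k, r)))" if "j < n" "k < n" for j k
    unfolding C_def Gt_def Ht_def by (rule transformed_displacement[OF T G H disp that])
  define S where "S = offdiag_blocks nmin p 0"
  have S: "t = s + m \<or> s = t + m" "s + m \<le> n" "t + m \<le> n" "2 \<le> m" "2 * m \<le> n" if "(s, t, m) \<in> S" for s t m
    using offdiag_blocks_range[OF that[unfolded S_def]] nmin n by auto
  define e where "e = \<epsilon> / log 2 (real n)"
  have lg: "log 2 (real n) = real p" unfolding n(1) by simp
  have p0: "0 < p" using n by (cases p) auto
  have nn: "0 \<le> spectral_norm C" by (rule op_bound_spectral_norm(2)[OF C n0])
  have e0: "0 < e" unfolding e_def lg using \<epsilon> p0 by simp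
  let ?F = "\<lambda>s t m. result (fadi_block \<kappa> \<tau> \<nu> n \<epsilon> d Gt Ht s t m)"
  have neq: "\<tau> s t j \<noteq> \<nu> s t j" if "(s, t, m) \<in> S" "j < num_steps n \<epsilon> m" for s t m j
    by (rule fadi_block_error(1)[where d = d and \<tau> = \<tau> and \<nu> = \<nu>, OF Gt Ht C di ds S[OF that(1)] \<epsilon> shifts[OF that(1)[unfolded S_def]] that(2)])
  have err: "op_bound {s..<s + m} {t..<t + m} (\<lambda>i j. C $$ (i, j) - factored (?F s t m) $$ (i - s, j - t)) (e * spectral_norm C)"
    if "(s, t, m) \<in> S" for s t m
    unfolding e_def
    by (rule fadi_block_error(2)[where d = d and \<tau> = \<tau> and \<nu> = \<nu> and \<kappa> = \<kappa>, OF Gt Ht C di ds S[OF that] \<epsilon> shifts[OF that[unfolded S_def]]])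
  have fits: "fits_factors m (?F s t m)" if st: "(s, t, m) \<in> S" for s t m
  proof -
    obtain Z W where "?F s t m = (Z, W)" "Z \<in> carrier_mat m (num_steps n \<epsilon> m * \<rho>)" "W \<in> carrier_mat m (num_steps n \<epsilon> m * \<rho>)"
      using fadi_block_fits[where \<tau> = \<tau> and \<nu> = \<nu> and \<kappa> = \<kappa> and d = d, OF Gt Ht S(2,3)[OF st] neq[OF st]] by blast
    then show ?thesis by auto
  qed
  have main: "fits_partition nmin p h \<and> hodlr_mat h \<in> carrier_mat (2 ^ p) (2 ^ p)
    \<and> op_bound {0..<0 + 2 ^ p} {0..<0 + 2 ^ p} (\<lambda>i j. C $$ (i, j) - hodlr_mat h $$ (i - 0, j - 0)) (real p * (e * spectral_norm C))
    \<and> (\<forall>(s', t', m) \<in> offdiag_blocks nmin p 0. \<forall>i<m. \<forall>j<m.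
        hodlr_mat h $$ (s' - 0 + i, t' - 0 + j) = factored (?F s' t' m) $$ (i, j))"
    unfolding h
  proof (rule hodlr_build_correct[OF C _ _ _ _ _ _, where S = S])
    show "result (leaf_block d c Gt Ht s m) = mat m m (\<lambda>(i, j). C $$ (s + i, s + j))" if "s + m \<le> n" for s m
      by (rule result_leaf_block[OF Gt C di ci ds that])
    show "offdiag_blocks nmin p 0 \<subseteq> S" by (simp add: S_def)
  qed (use fits err e0 nn n in auto)
  then show "fits_partition nmin p h" by blast
  have M: "hodlr_mat h \<in> carrier_mat n n" using main n by simp
  have "op_bound {..<n} {..<n} (\<lambda>i j. C $$ (i, j) - hodlr_mat h $$ (i, j)) (real p * (e * spectral_norm C))"
    using main by (simp add: n(1) atLeast0LessThan)
  moreover have "real p * (e * spectral_norm C) = \<epsilon> * spectral_norm C" unfolding e_def lg using p0 by simp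
  ultimately have "op_bound {..<n} {..<n} (\<lambda>i j. (C - hodlr_mat h) $$ (i, j)) (\<epsilon> * spectral_norm C)"
    using C M by (auto intro: op_bound_cong)
  then show "spectral_norm (C - hodlr_mat h) \<le> \<epsilon> * spectral_norm C"
    using C M n0 by (intro spectral_norm_le[of _ n n]) auto
  have rank: "vec_space.rank m (submatrix (hodlr_mat h) {s..<s + m} {t..<t + m}) \<le> num_steps n \<epsilon> n * \<rho>"
    if st: "(s, t, m) \<in> offdiag_blocks nmin p 0" for s t m
  proof -
    note st' = st[folded S_def]
    obtain Z W where ZW: "?F s t m = (Z, W)" "Z \<in> carrier_mat m (num_steps n \<epsilon> m * \<rho>)" "W \<in> carrier_mat m (num_steps n \<epsilon> m * \<rho>)"
      using fadi_block_fits[where \<tau> = \<tau> and \<nu> = \<nu> and \<kappa> = \<kappa> and d = d, OF Gt Ht S(2,3)[OF st'] neq[OF st']] by blast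
    have f: "factored (?F s t m) \<in> carrier_mat m m"
      unfolding ZW(1) factored.simps by (rule mult_carrier_mat[OF ZW(2) mat_adjoint_carrier[OF ZW(3)]])
    have "submatrix (hodlr_mat h) {s..<s + m} {t..<t + m} = factored (?F s t m)"
      unfolding submatrix_block[OF M S(2,3)[OF st']]
    proof (rule eq_matI)
      fix i j assume "i < dim_row (factored (?F s t m))" "j < dim_col (factored (?F s t m))"
      then have "i < m" "j < m" using f by auto
      then show "mat m m (\<lambda>(i, j). hodlr_mat h $$ (s + i, t + j)) $$ (i, j) = factored (?F s t m) $$ (i, j)"
        using main st by auto
    qed (use f in auto)
    also have "\<dots> = Z * mat_adjoint W" by (simp add: ZW(1))
    finally have "vec_space.rank m (submatrix (hodlr_mat h) {s..<s + m} {t..<t + m}) \<le> num_steps n \<epsilon> m * \<rho>"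
      using rank_mult_adjoint_le[OF ZW(2,3)] by simp
    \<comment> \<open>Passing from \<open>m\<close> to \<open>n\<close> makes the rank bound
      independent of the block.\<close>
    also have "\<dots> \<le> num_steps n \<epsilon> n * \<rho>" using S[OF st'] by (intro mult_right_mono num_steps_mono) auto
    finally show ?thesis .
  qed
  show "hodlr_rank nmin p (hodlr_mat h) \<le> num_steps n \<epsilon> n * \<rho>"
    unfolding hodlr_rank_def using finite_offdiag_blocks[of nmin p 0] by (subst Max_le_iff) (auto intro: rank)
qed

text \<open>Every term is compared with \<open>W\<close>, that is, \<open>\<rho> n (ln n)^2\<close>.
  Only the fADI steps carry the factor \<open>L\<close>; the other terms are multiplied by
  \<open>L / ln (ln 4) \<ge> 1\<close>.\<close>

lemma ops_hodlr_construction_le: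
  fixes \<tau> \<nu> :: "nat \<Rightarrow> nat \<Rightarrow> nat \<Rightarrow> complex"
  assumes n: "n = 2 ^ p" "4 \<le> n" and \<rho>: "1 \<le> \<rho>" and nmin: "2 \<le> nmin" "nmin \<le> nb"
    and G: "G \<in> carrier_mat n \<rho>" and H: "H \<in> carrier_mat n \<rho>" and a: "dim_vec (result avg) = n"
    and avg: "real (ops avg) \<le> ab * (real n * ln (real n))"
    and k: "0 \<le> c1" "real (num_steps n \<epsilon> n) \<le> c1 * (ln (real n) * L)" and L: "ln (ln 4) \<le> L"
  shows "real (ops (hodlr_construction \<kappa> \<tau> \<nu> \<epsilon> nmin p avg G H))
    \<le> ((19 + \<bar>ab\<bar> + 10 * real nb + 2 * real \<kappa>) / ln (ln 4) + (4 * real \<kappa> + 32) * c1) * (real \<rho> * real n * (ln (real n))\<^sup>2 * L)"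
proof -
  define l where "l = ln (real n)"
  define K where "K = num_steps n \<epsilon> n"
  define c where "c = vec n (\<lambda>j. \<Sum>k<n. unity_root n (j * k) * result avg $ k)"
  define d where "d = vec n (\<lambda>j. unity_root n j)"
  define W where "W = real \<rho> * real n * l\<^sup>2"
  have "ln 4 \<le> l" unfolding l_def using n(2) by simp
  then have l: "1 \<le> l" using ln4_gt_1 by linarith
  \<comment> \<open>\<open>n = 2^p\<close> and \<open>ln 2 \<ge> 1/2\<close>; this is the source of
    the factors 2 in front of \<open>l\<close> below.\<close>
  have p: "real p \<le> 2 * l"
  proof -
    have "l = real p * ln 2" unfolding l_def n(1) by (simp add: ln_realpow)
    moreover have "1 / 2 \<le> ln (2 :: real)"
    proof -
      have "ln (4 :: real) = 2 * ln 2" using ln_realpow[of 2 2] by simp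
      then show ?thesis using ln4_gt_1 by simp
    qed
    ultimately show ?thesis using mult_left_mono[of "1 / 2" "ln 2" "real p"] by simp
  qed
  have l2: "l \<le> l\<^sup>2" using l by (simp add: power2_eq_square)
  have W1: "real n * l \<le> W"
  proof -
    have "1 * (real n * l) \<le> real \<rho> * (real n * l\<^sup>2)" using \<rho> l l2 by (intro mult_mono mult_left_mono) auto
    then show ?thesis by (simp add: W_def mult.assoc)
  qed
  have W2: "real \<rho> * real n * l \<le> W" unfolding W_def using l2 by (intro mult_left_mono) auto
  have W3: "real n \<le> W" using mult_left_mono[of 1 l "real n"] l W1 by simp
  have W4: "real \<rho> * real n \<le> W" using mult_left_mono[of 1 l "real \<rho> * real n"] l W2 by simp
  have "1 \<le> real n" using n(2) by simp
  then have W0: "0 \<le> W" and W5: "1 \<le> W" using W3 by auto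
  have build: "ops (hodlr_build \<kappa> \<tau> \<nu> n \<epsilon> d c (dft_mat n * G) (dft_mat n * H) nmin p 0)
    \<le> 2 ^ p * (2 * nmin * (3 * \<rho> + 2)) + p * 2 ^ p * (\<kappa> + K * (2 * \<kappa> + 6 + 10 * \<rho>))"
    by (rule ops_hodlr_build[OF mult_carrier_mat[OF dft_mat_carrier G] mult_carrier_mat[OF dft_mat_carrier H] nmin(1)])
       (auto simp: K_def n(1) intro: num_steps_mono)
  have f1: "2 * nmin * (3 * \<rho> + 2) \<le> 2 * nb * (5 * \<rho>)" using nmin \<rho> by (intro mult_mono) auto
  have f2: "K * (2 * \<kappa> + 6 + 10 * \<rho>) \<le> K * ((2 * \<kappa> + 16) * \<rho>)"
  proof (rule mult_left_mono)
    have "(2 * \<kappa> + 6) * 1 \<le> (2 * \<kappa> + 6) * \<rho>" using \<rho> by (intro mult_left_mono) auto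
    then show "2 * \<kappa> + 6 + 10 * \<rho> \<le> (2 * \<kappa> + 16) * \<rho>" by (simp add: algebra_simps)
  qed simp
  have "2 ^ p * (2 * nmin * (3 * \<rho> + 2)) + p * 2 ^ p * (\<kappa> + K * (2 * \<kappa> + 6 + 10 * \<rho>))
     \<le> n * (2 * nb * (5 * \<rho>)) + p * n * (\<kappa> + K * ((2 * \<kappa> + 16) * \<rho>))"
    unfolding n(1)[symmetric] by (rule add_mono[OF mult_left_mono[OF f1] mult_left_mono[OF add_left_mono[OF f2]]]) simp_all
  with build have "ops (hodlr_build \<kappa> \<tau> \<nu> n \<epsilon> d c (dft_mat n * G) (dft_mat n * H) nmin p 0)
    \<le> n * (2 * nb * (5 * \<rho>)) + p * n * (\<kappa> + K * ((2 * \<kappa> + 16) * \<rho>))" by (rule order_trans)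
  then have "real (ops (hodlr_build \<kappa> \<tau> \<nu> n \<epsilon> d c (dft_mat n * G) (dft_mat n * H) nmin p 0))
    \<le> real (n * (2 * nb * (5 * \<rho>)) + p * n * (\<kappa> + K * ((2 * \<kappa> + 16) * \<rho>)))" by (rule of_nat_mono)
  also have "\<dots> = 10 * real nb * (real \<rho> * real n) + real p * (real \<kappa> * real n) + real p * ((2 * real \<kappa> + 16) * (real \<rho> * real n) * real K)"
    by (simp add: algebra_simps)
  also have "\<dots> \<le> 10 * real nb * W + 2 * l * (real \<kappa> * real n) + 2 * l * ((2 * real \<kappa> + 16) * (real \<rho> * real n) * (c1 * (l * L)))"
  proof -
    have kk: "real K \<le> c1 * (l * L)" using k(2) unfolding K_def l_def .
    show ?thesis
      by (rule add_mono[OF add_mono[OF mult_left_mono[OF W4] mult_right_mono[OF p]] mult_mono[OF p mult_left_mono[OF kk]]]) (use l in auto)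
  qed
  also have "\<dots> = 10 * real nb * W + 2 * real \<kappa> * (real n * l) + (4 * real \<kappa> + 32) * c1 * (W * L)"
    by (simp add: W_def power2_eq_square algebra_simps)
  also have "\<dots> \<le> 10 * real nb * W + 2 * real \<kappa> * W + (4 * real \<kappa> + 32) * c1 * (W * L)"
    by (rule add_mono[OF add_mono[OF order_refl mult_left_mono[OF W1]] order_refl]) simp
  finally have b: "real (ops (hodlr_build \<kappa> \<tau> \<nu> n \<epsilon> d c (dft_mat n * G) (dft_mat n * H) nmin p 0))
    \<le> 10 * real nb * W + 2 * real \<kappa> * W + (4 * real \<kappa> + 32) * c1 * (W * L)" .
  have v: "real (ops avg) \<le> \<bar>ab\<bar> * W"
  proof -
    have "real (ops avg) \<le> ab * (real n * l)" using avg unfolding l_def .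
    also have "\<dots> \<le> \<bar>ab\<bar> * (real n * l)" using l by (intro mult_right_mono) auto
    also have "\<dots> \<le> \<bar>ab\<bar> * W" using W1 by (intro mult_left_mono) auto
    finally show ?thesis .
  qed
  have f: "4 * (real p * (real \<rho> * real n)) \<le> 8 * W"
  proof -
    have "real p * (real \<rho> * real n) \<le> 2 * l * (real \<rho> * real n)" using p by (intro mult_right_mono) auto
    moreover have "2 * l * (real \<rho> * real n) = 2 * (real \<rho> * real n * l)" by simp
    ultimately show ?thesis using W2 by linarith
  qed
  have g: "2 * (real p * real n) \<le> 4 * W"
  proof -
    have "real p * real n \<le> 2 * l * real n" using p by (intro mult_right_mono) auto
    moreover have "2 * l * real n = 2 * (real n * l)" by simp
    ultimately show ?thesis using W1 by linarith
  qed
  have "real (ops (hodlr_construction \<kappa> \<tau> \<nu> \<epsilon> nmin p avg G H))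
    = 4 * (real p * (real \<rho> * real n)) + 2 + 2 * (real \<rho> * real n) + real (ops avg) + 2 * (real p * real n) + real n
      + real (ops (hodlr_build \<kappa> \<tau> \<nu> n \<epsilon> d c (dft_mat n * G) (dft_mat n * H) nmin p 0))"
    unfolding hodlr_construction_result(2)[OF n(1) G H a] c_def d_def by (simp add: algebra_simps)
  \<comment> \<open>In order: generator FFTs, the two square roots, the scaling of the generators,
    the averages, the FFT of the averages, the roots of unity, the tree.\<close>
  also have "\<dots> \<le> 8 * W + 2 * W + 2 * W + \<bar>ab\<bar> * W + 4 * W + W + (10 * real nb * W + 2 * real \<kappa> * W + (4 * real \<kappa> + 32) * c1 * (W * L))"
    using f g v b W3 W4 W5 by linarith
  also have "\<dots> = (17 + \<bar>ab\<bar> + 10 * real nb + 2 * real \<kappa>) * W + (4 * real \<kappa> + 32) * c1 * (W * L)"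
    by (simp add: algebra_simps)
  also have "\<dots> \<le> (19 + \<bar>ab\<bar> + 10 * real nb + 2 * real \<kappa>) * (W * L / ln (ln 4)) + (4 * real \<kappa> + 32) * c1 * (W * L)"
  proof (rule add_mono[OF mult_mono order_refl])
    have "W * ln (ln 4) \<le> W * L" using L W0 by (intro mult_left_mono) auto
    then show "W \<le> W * L / ln (ln 4)" using lnln4_pos by (simp add: le_divide_eq)
  qed (use W0 in auto)
  also have "\<dots> = ((19 + \<bar>ab\<bar> + 10 * real nb + 2 * real \<kappa>) / ln (ln 4) + (4 * real \<kappa> + 32) * c1) * (W * L)"
    by (simp only: distrib_right[of "_ / _"] times_divide_eq_left times_divide_eq_right)
  finally show ?thesis unfolding W_def l_def .
qed

theorem corollary3p2:
  shows "\<exists>k :: nat \<Rightarrow> real \<Rightarrow> nat.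
    (\<exists>c. \<forall>n \<epsilon>. 4 \<le> n \<longrightarrow> 0 < \<epsilon> \<longrightarrow>
       real (k n \<epsilon>) \<le> c * (ln (real n) * (ln (ln (real n)) + \<bar>ln \<epsilon>\<bar>))) \<and>
    (\<forall>(nmin_bound::nat) (\<kappa>::nat) (avg_bound::real). \<exists>c::real.
      \<forall>(p::nat) (n::nat) (\<rho>::nat) (nmin::nat) (\<epsilon>::real)
        (T::complex mat) (G::complex mat) (H::complex mat) (avg::complex vec costed)
        (\<tau>::nat \<Rightarrow> nat \<Rightarrow> nat \<Rightarrow> complex) (\<nu>::nat \<Rightarrow> nat \<Rightarrow> nat \<Rightarrow> complex).
        n = 2 ^ p \<longrightarrow> 4 \<le> n \<longrightarrow> 1 \<le> \<rho> \<longrightarrow> 0 < \<epsilon> \<longrightarrow>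
        2 \<le> nmin \<longrightarrow> nmin \<le> nmin_bound \<longrightarrow>
        T \<in> carrier_mat n n \<longrightarrow> G \<in> carrier_mat n \<rho> \<longrightarrow> H \<in> carrier_mat n \<rho> \<longrightarrow>
        cyclic_shift n * T - T * cyclic_shift n = G * mat_adjoint H \<longrightarrow>
        result avg = col (circulant_proj T) 0 \<longrightarrow>
        real (ops avg) \<le> avg_bound * (real n * ln (real n)) \<longrightarrow>
        (\<forall>(s, t, m) \<in> offdiag_blocks nmin p 0.
           zolotarev_shifts (row_arc n t m) (col_arc n t m) (num_steps n \<epsilon> m) (\<tau> s t) (\<nu> s t)) \<longrightarrow>
        (let C = dft_mat n * T * mat_adjoint (dft_mat n);
             run = hodlr_construction \<kappa> \<tau> \<nu> \<epsilon> nmin p avg G H;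
             Ct = hodlr_mat (result run)
         in real (ops run) \<le> c * (real \<rho> * real n * (ln (real n))\<^sup>2 * (ln (ln (real n)) + \<bar>ln \<epsilon>\<bar>)) \<and>
            fits_partition nmin p (result run) \<and>
            spectral_norm (C - Ct) \<le> \<epsilon> * spectral_norm C \<and>
            hodlr_rank nmin p Ct \<le> k n \<epsilon> * \<rho>))"
proof -
  obtain c1 where c1: "0 \<le> c1" "\<And>n \<epsilon>. 4 \<le> n \<Longrightarrow> 0 < \<epsilon> \<Longrightarrow>
    real (num_steps n \<epsilon> n) \<le> c1 * (ln (real n) * (ln (ln (real n)) + \<bar>ln \<epsilon>\<bar>))"
    using num_steps_bound by blast
  show ?thesis
  \<comment> \<open>The step count for a hypothetical block of full size \<open>n\<close> dominates
    that of every actual block.\<close>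
  proof (rule exI[where x = "\<lambda>n \<epsilon>. num_steps n \<epsilon> n"], intro conjI, goal_cases)
    case 1
    show ?case using c1(2) by blast
  next
    case 2
    show ?case
    proof (intro allI, goal_cases)
      case (1 nb \<kappa> ab)
      show ?case
      proof (rule exI[where x = "(19 + \<bar>ab\<bar> + 10 * real nb + 2 * real \<kappa>) / ln (ln 4) + (4 * real \<kappa> + 32) * c1"],
          intro allI impI, goal_cases)
        case (1 p n \<rho> nmin \<epsilon> T G H avg \<tau> \<nu>)
      have shifts: "zolotarev_shifts (row_arc n t m) (col_arc n t m) (num_steps n \<epsilon> m) (\<tau> s t) (\<nu> s t)"
        if "(s, t, m) \<in> offdiag_blocks nmin p 0" for s t m
        using 1 that by blast
      have a: "dim_vec (result avg) = n" using 1 by (simp add: circulant_proj_def Let_def)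
      have L: "ln (ln 4) \<le> ln (ln (real n)) + \<bar>ln \<epsilon>\<bar>"
      proof -
        have "ln 4 \<le> ln (real n)" using \<open>4 \<le> n\<close> by simp
        then have "ln (ln 4) \<le> ln (ln (real n))" using ln4_gt_1 by (subst ln_le_cancel_iff) auto
        then show ?thesis by linarith
      qed
      have "real (ops (hodlr_construction \<kappa> \<tau> \<nu> \<epsilon> nmin p avg G H))
        \<le> ((19 + \<bar>ab\<bar> + 10 * real nb + 2 * real \<kappa>) / ln (ln 4) + (4 * real \<kappa> + 32) * c1)
          * (real \<rho> * real n * (ln (real n))\<^sup>2 * (ln (ln (real n)) + \<bar>ln \<epsilon>\<bar>))"
        by (rule ops_hodlr_construction_le[OF 1(1,2,3,5,6,8,9) a 1(12) c1(1) c1(2)[OF 1(2,4)] L])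
      moreover note hodlr_construction_correct[where \<kappa> = \<kappa> and \<tau> = \<tau> and \<nu> = \<nu>, OF 1(1,2,4,5,7,8,9,10,11) shifts]
      ultimately show ?case unfolding Let_def transformed_def by blast
      qed
    qed
  qed
qed

end
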